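(* Let $A$ be a commutative ring, let $\mathfrak{a}$ be an ideal in $A$, and let $M$ be an $A$-module. The following conditions are equivalent: (i) The $A$-module $M$ is $\mathfrak{a}$-adically flat. (ii) For every $i > 0$ and $k \geq 0$ the module $\operatorname{Tor}^{A}_i(A_{k}, M)$ vanishes, and $A_{k} \otimes_A M$ is a flat $A_k$-module. (iii) For every $i > 0$ the module $\operatorname{Tor}^{A}_i(A_{0}, M)$ vanishes, and $A_{0} \otimes_A M$ is a flat $A_0$-module.
   Context: For $k \geq 0$, $A_k := A/\mathfrak{a}^{k+1}$ (so $A_0 = A/\mathfrak{a}$). An $A$-module $N$ is called $\mathfrak{a}$-torsion if every element of $N$ is annihilated by some power of $\mathfrak{a}$. An $A$-module $M$ is called $\mathfrak{a}$-adically flat if $\operatorname{Tor}^A_i(N, M) = 0$ for every $i > 0$ and every $\mathfrak{a}$-torsion $A$-module $N$. *)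

theory Defs
  imports "HOL-Algebra.Module" "HOL-Algebra.QuotRing" "HOL-Algebra.Ideal_Product" "HOL-Library.Equipollence"
begin

section \<open>Homomorphisms, submodules and quotients of modules\<close>

definition mod_hom ::
    "('a, 'r) ring_scheme \<Rightarrow> ('a, 'b, 'p) module_scheme \<Rightarrow> ('a, 'c, 'q) module_scheme \<Rightarrow> ('b \<Rightarrow> 'c) set"
  where "mod_hom R M N =
    {h \<in> carrier M \<rightarrow> carrier N.
       (\<forall>x\<in>carrier M. \<forall>y\<in>carrier M. h (x \<oplus>\<^bsub>M\<^esub> y) = h x \<oplus>\<^bsub>N\<^esub> h y) \<and>
       (\<forall>a\<in>carrier R. \<forall>x\<in>carrier M. h (a \<odot>\<^bsub>M\<^esub> x) = a \<odot>\<^bsub>N\<^esub> h x)}"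

definition submod_span ::
    "('a, 'r) ring_scheme \<Rightarrow> ('a, 'b, 'p) module_scheme \<Rightarrow> 'b set \<Rightarrow> 'b set"
  where "submod_span R M S = \<Inter> {H. submodule H R M \<and> S \<subseteq> H}"

text \<open>The record type of modules extends that of rings; the multiplication and unit fields play
  no role for modules and are left unspecified.\<close>

definition quot_mod :: "('a, 'b, 'p) module_scheme \<Rightarrow> 'b set \<Rightarrow> ('a, 'b set) module"
  where "quot_mod M H =
    \<lparr>carrier = a_rcosets\<^bsub>M\<^esub> H,
     mult = undefined, one = undefined, zero = H, add = set_add M,
     smult = (\<lambda>a C. \<Union>c\<in>C. H +>\<^bsub>M\<^esub> (a \<odot>\<^bsub>M\<^esub> c))\<rparr>"

definition zero_mod :: "('a, 'b, 'p) module_scheme \<Rightarrow> bool"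
  where "zero_mod M \<longleftrightarrow> carrier M = {\<zero>\<^bsub>M\<^esub>}"


section \<open>Free modules\<close>

definition free_mod :: "('a, 'r) ring_scheme \<Rightarrow> 'x set \<Rightarrow> ('a, 'x \<Rightarrow> 'a) module"
  where "free_mod R X =
    \<lparr>carrier = {f \<in> UNIV \<rightarrow> carrier R. finite {x. f x \<noteq> \<zero>\<^bsub>R\<^esub>} \<and> (\<forall>x. x \<notin> X \<longrightarrow> f x = \<zero>\<^bsub>R\<^esub>)},
     mult = undefined, one = undefined,
     zero = (\<lambda>_. \<zero>\<^bsub>R\<^esub>), add = (\<lambda>f g x. f x \<oplus>\<^bsub>R\<^esub> g x), smult = (\<lambda>a f x. a \<otimes>\<^bsub>R\<^esub> f x)\<rparr>"

definition free_gen :: "('a, 'r) ring_scheme \<Rightarrow> 'x \<Rightarrow> 'x \<Rightarrow> 'a"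
  where "free_gen R x = (\<lambda>y. if y = x then \<one>\<^bsub>R\<^esub> else \<zero>\<^bsub>R\<^esub>)"

text \<open>The linear extension of a map \<open>\<phi>\<close> on basis elements to a map from a free module to \<open>N\<close>.\<close>

definition free_lift ::
    "('a, 'r) ring_scheme \<Rightarrow> ('a, 'b, 'p) module_scheme \<Rightarrow> ('x \<Rightarrow> 'b) \<Rightarrow> ('x \<Rightarrow> 'a) \<Rightarrow> 'b"
  where "free_lift R N \<phi> f = (\<Oplus>\<^bsub>N\<^esub>x\<in>{x. f x \<noteq> \<zero>\<^bsub>R\<^esub>}. f x \<odot>\<^bsub>N\<^esub> \<phi> x)"


section \<open>Tensor products\<close>

definition tensor_rels ::
    "('a, 'r) ring_scheme \<Rightarrow> ('a, 'm, 'p) module_scheme \<Rightarrow> ('a, 'n, 'q) module_scheme \<Rightarrow>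
     ('m \<times> 'n \<Rightarrow> 'a) set"
  where "tensor_rels R M N = (let F = free_mod R (carrier M \<times> carrier N); e = free_gen R in
      {e (x \<oplus>\<^bsub>M\<^esub> x', y) \<ominus>\<^bsub>F\<^esub> (e (x, y) \<oplus>\<^bsub>F\<^esub> e (x', y)) | x x' y.
         x \<in> carrier M \<and> x' \<in> carrier M \<and> y \<in> carrier N} \<union>
      {e (x, y \<oplus>\<^bsub>N\<^esub> y') \<ominus>\<^bsub>F\<^esub> (e (x, y) \<oplus>\<^bsub>F\<^esub> e (x, y')) | x y y'.
         x \<in> carrier M \<and> y \<in> carrier N \<and> y' \<in> carrier N} \<union>
      {e (a \<odot>\<^bsub>M\<^esub> x, y) \<ominus>\<^bsub>F\<^esub> a \<odot>\<^bsub>F\<^esub> e (x, y) | a x y.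
         a \<in> carrier R \<and> x \<in> carrier M \<and> y \<in> carrier N} \<union>
      {e (x, a \<odot>\<^bsub>N\<^esub> y) \<ominus>\<^bsub>F\<^esub> a \<odot>\<^bsub>F\<^esub> e (x, y) | a x y.
         a \<in> carrier R \<and> x \<in> carrier M \<and> y \<in> carrier N})"

definition tensor_ker ::
    "('a, 'r) ring_scheme \<Rightarrow> ('a, 'm, 'p) module_scheme \<Rightarrow> ('a, 'n, 'q) module_scheme \<Rightarrow>
     ('m \<times> 'n \<Rightarrow> 'a) set"
  where "tensor_ker R M N =
    submod_span R (free_mod R (carrier M \<times> carrier N)) (tensor_rels R M N)"

definition tensor ::
    "('a, 'r) ring_scheme \<Rightarrow> ('a, 'm, 'p) module_scheme \<Rightarrow> ('a, 'n, 'q) module_scheme \<Rightarrow>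
     ('a, ('m \<times> 'n \<Rightarrow> 'a) set) module"
  where "tensor R M N = quot_mod (free_mod R (carrier M \<times> carrier N)) (tensor_ker R M N)"

definition pure_tensor ::
    "('a, 'r) ring_scheme \<Rightarrow> ('a, 'm, 'p) module_scheme \<Rightarrow> ('a, 'n, 'q) module_scheme \<Rightarrow>
     'm \<Rightarrow> 'n \<Rightarrow> ('m \<times> 'n \<Rightarrow> 'a) set"
  where "pure_tensor R M N x y =
    tensor_ker R M N +>\<^bsub>free_mod R (carrier M \<times> carrier N)\<^esub> free_gen R (x, y)"

text \<open>The map out of a tensor product into \<open>P\<close> induced by a bilinear map \<open>\<phi>\<close>: its linear extension
  to the free module is constant on cosets, so the image of a coset is a singleton.\<close>

definition tensor_lift ::
    "('a, 'r) ring_scheme \<Rightarrow> ('a, 'b, 'p) module_scheme \<Rightarrow> ('m \<times> 'n \<Rightarrow> 'b) \<Rightarrow>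
     ('m \<times> 'n \<Rightarrow> 'a) set \<Rightarrow> 'b"
  where "tensor_lift R P \<phi> C = the_elem (free_lift R P \<phi> ` C)"

text \<open>\<open>tensor_map R M' N' f g\<close> is the map from any \<open>tensor R M N\<close> to \<open>tensor R M' N'\<close> induced by
  homomorphisms \<open>f\<close> from \<open>M\<close> to \<open>M'\<close> and \<open>g\<close> from \<open>N\<close> to \<open>N'\<close>.\<close>

definition tensor_map ::
    "('a, 'r) ring_scheme \<Rightarrow> ('a, 'm1, 'p) module_scheme \<Rightarrow> ('a, 'n1, 'q) module_scheme \<Rightarrow>
     ('m \<Rightarrow> 'm1) \<Rightarrow> ('n \<Rightarrow> 'n1) \<Rightarrow> ('m \<times> 'n \<Rightarrow> 'a) set \<Rightarrow> ('m1 \<times> 'n1 \<Rightarrow> 'a) set"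
  where "tensor_map R M' N' f g =
    tensor_lift R (tensor R M' N') (\<lambda>(x, y). pure_tensor R M' N' (f x) (g y))"


section \<open>Change of rings\<close>

text \<open>For a ring homomorphism \<open>\<phi>\<close> from \<open>R\<close> to \<open>B\<close>: the \<open>R\<close>-module \<open>B\<close>, and the \<open>B\<close>-module
  obtained from an \<open>R\<close>-module \<open>M\<close> by tensoring with \<open>B\<close>.\<close>

definition ring_as_mod :: "('b, 's) ring_scheme \<Rightarrow> ('a \<Rightarrow> 'b) \<Rightarrow> ('a, 'b) module"
  where "ring_as_mod B \<phi> =
    \<lparr>carrier = carrier B, mult = mult B, one = \<one>\<^bsub>B\<^esub>,
     zero = \<zero>\<^bsub>B\<^esub>, add = add B,
     smult = (\<lambda>a b. \<phi> a \<otimes>\<^bsub>B\<^esub> b)\<rparr>"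

definition base_change ::
    "('a, 'r) ring_scheme \<Rightarrow> ('b, 's) ring_scheme \<Rightarrow> ('a \<Rightarrow> 'b) \<Rightarrow> ('a, 'm, 'p) module_scheme \<Rightarrow>
     ('b, ('b \<times> 'm \<Rightarrow> 'a) set) module"
  where "base_change R B \<phi> M = (let T = tensor R (ring_as_mod B \<phi>) M in
    \<lparr>carrier = carrier T, mult = mult T, one = \<one>\<^bsub>T\<^esub>,
     zero = \<zero>\<^bsub>T\<^esub>, add = add T,
     smult = (\<lambda>b. tensor_map R (ring_as_mod B \<phi>) M (\<lambda>b'. b \<otimes>\<^bsub>B\<^esub> b') (\<lambda>x. x))\<rparr>)"


section \<open>Flatness\<close>

text \<open>HOL cannot quantify over types inside a formula, so a quantifier over all modules needs a
  universe: a type \<open>'n\<close>, passed as an argument, of which the carriers are arbitrary subsets. As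
  \<open>'n\<close> may be instantiated with any type, statements about an arbitrary \<open>'n\<close> cover all modules;
  the universe must be large enough to hold a copy of the ring for flatness to be meaningful.\<close>

definition flat_mod ::
    "'n itself \<Rightarrow> ('a, 'r) ring_scheme \<Rightarrow> ('a, 'm, 'p) module_scheme \<Rightarrow> bool"
  where "flat_mod (_ :: 'n itself) R M \<longleftrightarrow>
    module R M \<and>
    (\<forall>(N' :: ('a, 'n) module) (N :: ('a, 'n) module) f.
       module R N' \<and> module R N \<and> f \<in> mod_hom R N' N \<and> inj_on f (carrier N') \<longrightarrow>
       inj_on (tensor_map R N M f (\<lambda>x. x)) (carrier (tensor R N' M)))"


section \<open>A free resolution\<close>

text \<open>A functorial free resolution of a module \<open>M\<close>, all of whose terms have the same type. The
  basis in degree \<open>0\<close> is \<open>carrier M\<close>. The basis in degree \<open>i + 1\<close> consists of the formal finite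
  linear combinations (as lists, so with repetitions) of basis elements of degree \<open>i\<close> that denote
  cycles; the differential sends such a formal combination to the cycle it denotes.\<close>

datatype ('a, 'm) syz = Elt (syz_elt: 'm) | Comb (syz_list: "('a \<times> ('a, 'm) syz) list")

definition lin_comb :: "('a, 'r) ring_scheme \<Rightarrow> ('a \<times> 'x) list \<Rightarrow> 'x \<Rightarrow> 'a"
  where "lin_comb R xs =
    (\<lambda>x. foldr (\<lambda>(a, y) c. if y = x then a \<oplus>\<^bsub>R\<^esub> c else c) xs \<zero>\<^bsub>R\<^esub>)"

definition syz_aug ::
    "('a, 'r) ring_scheme \<Rightarrow> ('a, 'm, 'p) module_scheme \<Rightarrow> (('a, 'm) syz \<Rightarrow> 'a) \<Rightarrow> 'm"
  where "syz_aug R M = free_lift R M syz_elt"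

definition syz_bd ::
    "('a, 'r) ring_scheme \<Rightarrow> ('a, 'm) syz set \<Rightarrow> (('a, 'm) syz \<Rightarrow> 'a) \<Rightarrow> ('a, 'm) syz \<Rightarrow> 'a"
  where "syz_bd R X = free_lift R (free_mod R X) (\<lambda>s. lin_comb R (syz_list s))"

fun syz_gens ::
    "('a, 'r) ring_scheme \<Rightarrow> ('a, 'm, 'p) module_scheme \<Rightarrow> nat \<Rightarrow> ('a, 'm) syz set"
  where
    "syz_gens R M 0 = Elt ` carrier M"
  | "syz_gens R M (Suc 0) =
       {Comb xs | xs. set xs \<subseteq> carrier R \<times> syz_gens R M 0 \<and>
                      syz_aug R M (lin_comb R xs) = \<zero>\<^bsub>M\<^esub>}"
  | "syz_gens R M (Suc (Suc i)) =
       {Comb xs | xs. set xs \<subseteq> carrier R \<times> syz_gens R M (Suc i) \<and>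
                      syz_bd R (syz_gens R M i) (lin_comb R xs) = (\<lambda>_. \<zero>\<^bsub>R\<^esub>)}"

definition res_mod ::
    "('a, 'r) ring_scheme \<Rightarrow> ('a, 'm, 'p) module_scheme \<Rightarrow> nat \<Rightarrow> ('a, ('a, 'm) syz \<Rightarrow> 'a) module"
  where "res_mod R M i = free_mod R (syz_gens R M i)"

definition res_bd ::
    "('a, 'r) ring_scheme \<Rightarrow> ('a, 'm, 'p) module_scheme \<Rightarrow> nat \<Rightarrow>
     (('a, 'm) syz \<Rightarrow> 'a) \<Rightarrow> ('a, 'm) syz \<Rightarrow> 'a" \<comment> \<open>from degree \<open>i + 1\<close> to degree \<open>i\<close>\<close>
  where "res_bd R M i = syz_bd R (syz_gens R M i)"


section \<open>Tor\<close>

text \<open>\<open>Tor R i N M\<close> is the homology in degree \<open>i\<close> of the tensor product of \<open>N\<close> with the above free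
  resolution of \<open>M\<close>.\<close>

definition tor_term ::
    "('a, 'r) ring_scheme \<Rightarrow> nat \<Rightarrow> ('a, 'n, 'q) module_scheme \<Rightarrow> ('a, 'm, 'p) module_scheme \<Rightarrow>
     ('a, ('n \<times> (('a, 'm) syz \<Rightarrow> 'a) \<Rightarrow> 'a) set) module"
  where "tor_term R i N M = tensor R N (res_mod R M i)"

definition tor_bd ::
    "('a, 'r) ring_scheme \<Rightarrow> nat \<Rightarrow> ('a, 'n, 'q) module_scheme \<Rightarrow> ('a, 'm, 'p) module_scheme \<Rightarrow>
     ('n \<times> (('a, 'm) syz \<Rightarrow> 'a) \<Rightarrow> 'a) set \<Rightarrow> ('n \<times> (('a, 'm) syz \<Rightarrow> 'a) \<Rightarrow> 'a) set"
     \<comment> \<open>from degree \<open>i + 1\<close> to degree \<open>i\<close>\<close>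
  where "tor_bd R i N M = tensor_map R N (res_mod R M i) (\<lambda>x. x) (res_bd R M i)"

definition tor_cycles ::
    "('a, 'r) ring_scheme \<Rightarrow> nat \<Rightarrow> ('a, 'n, 'q) module_scheme \<Rightarrow> ('a, 'm, 'p) module_scheme \<Rightarrow>
     ('n \<times> (('a, 'm) syz \<Rightarrow> 'a) \<Rightarrow> 'a) set set"
  where "tor_cycles R i N M =
    (case i of 0 \<Rightarrow> carrier (tor_term R 0 N M)
     | Suc j \<Rightarrow> a_kernel (tor_term R (Suc j) N M) (tor_term R j N M) (tor_bd R j N M))"

definition Tor ::
    "('a, 'r) ring_scheme \<Rightarrow> nat \<Rightarrow> ('a, 'n, 'q) module_scheme \<Rightarrow> ('a, 'm, 'p) module_scheme \<Rightarrow>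
     ('a, ('n \<times> (('a, 'm) syz \<Rightarrow> 'a) \<Rightarrow> 'a) set set) module"
  where "Tor R i N M =
    quot_mod ((tor_term R i N M)\<lparr>carrier := tor_cycles R i N M\<rparr>)
      (tor_bd R i N M ` carrier (tor_term R (Suc i) N M))"


section \<open>Adic flatness\<close>

definition ideal_pow :: "('a, 'r) ring_scheme \<Rightarrow> 'a set \<Rightarrow> nat \<Rightarrow> 'a set"
  where "ideal_pow R I n = I [^]\<^bsub>ideals_set R\<^esub> n"

definition adic_torsion ::
    "('a, 'r) ring_scheme \<Rightarrow> 'a set \<Rightarrow> ('a, 'n, 'q) module_scheme \<Rightarrow> bool"
  where "adic_torsion R I N \<longleftrightarrow>
    (\<forall>x\<in>carrier N. \<exists>n. \<forall>a\<in>ideal_pow R I n. a \<odot>\<^bsub>N\<^esub> x = \<zero>\<^bsub>N\<^esub>)"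

definition adically_flat ::
    "'n itself \<Rightarrow> ('a, 'r) ring_scheme \<Rightarrow> 'a set \<Rightarrow> ('a, 'm, 'p) module_scheme \<Rightarrow> bool"
  where "adically_flat (_ :: 'n itself) R I M \<longleftrightarrow>
    (\<forall>(N :: ('a, 'n) module) i. module R N \<and> adic_torsion R I N \<and> i > 0 \<longrightarrow>
       zero_mod (Tor R i N M))"

definition adic_ring :: "('a, 'r) ring_scheme \<Rightarrow> 'a set \<Rightarrow> nat \<Rightarrow> 'a set ring"
  where "adic_ring R I k = R Quot (ideal_pow R I (k + 1))"

definition adic_proj :: "('a, 'r) ring_scheme \<Rightarrow> 'a set \<Rightarrow> nat \<Rightarrow> 'a \<Rightarrow> 'a set"
  where "adic_proj R I k a = ideal_pow R I (k + 1) +>\<^bsub>R\<^esub> a"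

definition adic_mod :: "('a, 'r) ring_scheme \<Rightarrow> 'a set \<Rightarrow> nat \<Rightarrow> ('a, 'a set) module"
  where "adic_mod R I k = ring_as_mod (adic_ring R I k) (adic_proj R I k)"

definition adic_base_change ::
    "('a, 'r) ring_scheme \<Rightarrow> 'a set \<Rightarrow> nat \<Rightarrow> ('a, 'm, 'p) module_scheme \<Rightarrow>
     ('a set, ('a set \<times> 'm \<Rightarrow> 'a) set) module"
  where "adic_base_change R I k M = base_change R (adic_ring R I k) (adic_proj R I k) M"


section \<open>The resolution is exact and the tensor product is universal\<close>

lemma free_mod_simps:
  "f \<in> carrier (free_mod R X) \<longleftrightarrow>
     (\<forall>x. f x \<in> carrier R) \<and> finite {x. f x \<noteq> \<zero>\<^bsub>R\<^esub>} \<and> (\<forall>x. x \<notin> X \<longrightarrow> f x = \<zero>\<^bsub>R\<^esub>)"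
  "\<zero>\<^bsub>free_mod R X\<^esub> = (\<lambda>_. \<zero>\<^bsub>R\<^esub>)"
  "f \<oplus>\<^bsub>free_mod R X\<^esub> g = (\<lambda>x. f x \<oplus>\<^bsub>R\<^esub> g x)"
  "a \<odot>\<^bsub>free_mod R X\<^esub> f = (\<lambda>x. a \<otimes>\<^bsub>R\<^esub> f x)"
  by (auto simp: free_mod_def)

lemma module_free_mod:
  fixes R :: "('a, 'r) ring_scheme" (structure) and X :: "'x set"
  assumes "cring R"
  shows "module R (free_mod R X)"
proof -
  interpret cring R by fact
  have fin_add: "finite {x. f x \<oplus> g x \<noteq> \<zero>}"
    if "finite {x. f x \<noteq> \<zero>}" "finite {x. g x \<noteq> \<zero>}" for f g :: "'x \<Rightarrow> 'a"
    by (rule finite_subset[OF _ finite_UnI[OF that]]) auto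
  have fin_smult: "finite {x. a \<otimes> f x \<noteq> \<zero>}"
    if "a \<in> carrier R" "finite {x. f x \<noteq> \<zero>}" for a and f :: "'x \<Rightarrow> 'a"
    by (rule finite_subset[OF _ that(2)]) (use that(1) in auto)
  show ?thesis
  proof (intro moduleI assms abelian_groupI, goal_cases)
    case (6 f)
    have "(\<lambda>x. \<ominus> f x) \<in> carrier (free_mod R X)"
    proof -
      have "finite {x. \<ominus> f x \<noteq> \<zero>}"
        by (rule finite_subset[of _ "{x. f x \<noteq> \<zero>}"]) (use 6 in \<open>auto simp: free_mod_simps\<close>)
      then show ?thesis using 6 by (auto simp: free_mod_simps)
    qed
    then show ?case
      using 6 by (intro bexI[of _ "\<lambda>x. \<ominus> f x"]) (auto simp: free_mod_simps l_neg fun_eq_iff)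
  qed (auto simp: free_mod_simps fun_eq_iff a_ac m_assoc l_distr r_distr fin_add fin_smult)
qed

lemma free_gen_carrier:
  assumes "cring R" "x \<in> X"
  shows "free_gen R x \<in> carrier (free_mod R X)"
proof -
  interpret cring R by fact
  have "finite {y. free_gen R x y \<noteq> \<zero>\<^bsub>R\<^esub>}"
    by (rule finite_subset[of _ "{x}"]) (auto simp: free_gen_def)
  then show ?thesis using assms by (auto simp: free_mod_simps free_gen_def)
qed

lemma free_lift_eq:
  assumes "module R N" "f \<in> carrier (free_mod R X)" "\<phi> \<in> X \<rightarrow> carrier N"
    "finite S" "{x. f x \<noteq> \<zero>\<^bsub>R\<^esub>} \<subseteq> S" "S \<subseteq> X"
  shows "free_lift R N \<phi> f = (\<Oplus>\<^bsub>N\<^esub>x\<in>S. f x \<odot>\<^bsub>N\<^esub> \<phi> x)"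
proof -
  interpret module R N by fact
  have "\<phi> x \<in> carrier N" if "x \<in> S" for x using assms that by auto
  then show ?thesis unfolding free_lift_def
    by (intro M.add.finprod_mono_neutral_cong_left) (use assms in \<open>auto simp: free_mod_simps\<close>)
qed

lemma free_lift_hom:
  assumes "module R N" "\<phi> \<in> X \<rightarrow> carrier N"
  shows "free_lift R N \<phi> \<in> mod_hom R (free_mod R X) N"
proof -
  interpret module R N by fact
  interpret F: module R "free_mod R X" by (rule module_free_mod) (rule R.is_cring)
  have supp: "finite {x. f x \<noteq> \<zero>\<^bsub>R\<^esub>}" "{x. f x \<noteq> \<zero>\<^bsub>R\<^esub>} \<subseteq> X"
    if "f \<in> carrier (free_mod R X)" for f
    using that by (auto simp: free_mod_simps)
  have phi: "\<phi> x \<in> carrier N" if "x \<in> X" for x using assms that by auto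
  have val: "f x \<in> carrier R" if "f \<in> carrier (free_mod R X)" for f x
    using that by (auto simp: free_mod_simps)
  show ?thesis unfolding mod_hom_def
  proof (intro CollectI conjI ballI)
    show "free_lift R N \<phi> \<in> carrier (free_mod R X) \<rightarrow> carrier N"
      unfolding free_lift_def using supp phi val by (intro Pi_I M.finsum_closed) blast
  next
    fix f g assume f: "f \<in> carrier (free_mod R X)" and g: "g \<in> carrier (free_mod R X)"
    let ?S = "{x. f x \<noteq> \<zero>\<^bsub>R\<^esub>} \<union> {x. g x \<noteq> \<zero>\<^bsub>R\<^esub>}"
    have fg: "f \<oplus>\<^bsub>free_mod R X\<^esub> g \<in> carrier (free_mod R X)" using f g by simp
    have S: "finite ?S" "?S \<subseteq> X" using supp[OF f] supp[OF g] by auto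
    have "free_lift R N \<phi> (f \<oplus>\<^bsub>free_mod R X\<^esub> g)
        = (\<Oplus>\<^bsub>N\<^esub>x\<in>?S. (f \<oplus>\<^bsub>free_mod R X\<^esub> g) x \<odot>\<^bsub>N\<^esub> \<phi> x)"
      by (rule free_lift_eq[OF assms(1) fg assms(2)]) (use S in \<open>auto simp: free_mod_simps\<close>)
    also have "\<dots> = (\<Oplus>\<^bsub>N\<^esub>x\<in>?S. f x \<odot>\<^bsub>N\<^esub> \<phi> x \<oplus>\<^bsub>N\<^esub> g x \<odot>\<^bsub>N\<^esub> \<phi> x)"
      by (rule M.finsum_cong')
        (use S phi val[OF f] val[OF g] in \<open>auto simp: free_mod_simps smult_l_distr subset_iff\<close>)
    also have "\<dots> = (\<Oplus>\<^bsub>N\<^esub>x\<in>?S. f x \<odot>\<^bsub>N\<^esub> \<phi> x) \<oplus>\<^bsub>N\<^esub> (\<Oplus>\<^bsub>N\<^esub>x\<in>?S. g x \<odot>\<^bsub>N\<^esub> \<phi> x)"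
      by (rule M.finsum_addf) (use S phi val[OF f] val[OF g] in \<open>auto simp: subset_iff\<close>)
    also have "(\<Oplus>\<^bsub>N\<^esub>x\<in>?S. f x \<odot>\<^bsub>N\<^esub> \<phi> x) = free_lift R N \<phi> f"
      by (rule free_lift_eq[symmetric, OF assms(1) f assms(2)]) (use S in auto)
    also have "(\<Oplus>\<^bsub>N\<^esub>x\<in>?S. g x \<odot>\<^bsub>N\<^esub> \<phi> x) = free_lift R N \<phi> g"
      by (rule free_lift_eq[symmetric, OF assms(1) g assms(2)]) (use S in auto)
    finally show "free_lift R N \<phi> (f \<oplus>\<^bsub>free_mod R X\<^esub> g) =
      free_lift R N \<phi> f \<oplus>\<^bsub>N\<^esub> free_lift R N \<phi> g" .
  next
    fix a f assume a: "a \<in> carrier R" and f: "f \<in> carrier (free_mod R X)"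
    let ?S = "{x. f x \<noteq> \<zero>\<^bsub>R\<^esub>}"
    have af: "a \<odot>\<^bsub>free_mod R X\<^esub> f \<in> carrier (free_mod R X)" using a f by simp
    have "free_lift R N \<phi> (a \<odot>\<^bsub>free_mod R X\<^esub> f)
        = (\<Oplus>\<^bsub>N\<^esub>x\<in>?S. (a \<odot>\<^bsub>free_mod R X\<^esub> f) x \<odot>\<^bsub>N\<^esub> \<phi> x)"
      by (rule free_lift_eq[OF assms(1) af assms(2)]) (use supp[OF f] a in \<open>auto simp: free_mod_simps\<close>)
    also have "\<dots> = (\<Oplus>\<^bsub>N\<^esub>x\<in>?S. a \<odot>\<^bsub>N\<^esub> (f x \<odot>\<^bsub>N\<^esub> \<phi> x))"
      by (rule M.finsum_cong')
        (use supp[OF f] phi val[OF f] a in \<open>auto simp: free_mod_simps smult_assoc1 subset_iff\<close>)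
    also have "\<dots> = a \<odot>\<^bsub>N\<^esub> free_lift R N \<phi> f" unfolding free_lift_def
      by (rule finsum_smult_ldistr[symmetric])
        (use supp[OF f] phi val[OF f] a in \<open>auto simp: subset_iff\<close>)
    finally show "free_lift R N \<phi> (a \<odot>\<^bsub>free_mod R X\<^esub> f) = a \<odot>\<^bsub>N\<^esub> free_lift R N \<phi> f" .
  qed
qed

lemma free_lift_gen:
  assumes "module R N" "\<phi> x \<in> carrier N"
  shows "free_lift R N \<phi> (free_gen R x) = \<phi> x"
proof -
  interpret module R N by fact
  have "free_lift R N \<phi> (free_gen R x) = (\<Oplus>\<^bsub>N\<^esub>y\<in>{x}. free_gen R x y \<odot>\<^bsub>N\<^esub> \<phi> y)"
    by (rule free_lift_eq[where X = "{x}"])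
      (use assms in \<open>auto simp: free_gen_def intro: free_gen_carrier[OF R.is_cring, unfolded free_gen_def]\<close>)
  also have "\<dots> = \<phi> x" using assms by (simp add: free_gen_def)
  finally show ?thesis .
qed

lemma lin_comb_Nil: "lin_comb R [] = (\<lambda>_. \<zero>\<^bsub>R\<^esub>)"
  by (simp add: lin_comb_def)

lemma lin_comb_Cons:
  assumes "cring R" "a \<in> carrier R" "lin_comb R xs \<in> carrier (free_mod R X)"
  shows "lin_comb R ((a, x) # xs) = a \<odot>\<^bsub>free_mod R X\<^esub> free_gen R x \<oplus>\<^bsub>free_mod R X\<^esub> lin_comb R xs"
proof -
  interpret cring R by fact
  show ?thesis using assms by (auto simp: lin_comb_def free_mod_simps free_gen_def fun_eq_iff)
qed

lemma lin_comb_carrier: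
  assumes "cring R" "set xs \<subseteq> carrier R \<times> X"
  shows "lin_comb R xs \<in> carrier (free_mod R X)"
  using assms(2)
proof (induction xs)
  case Nil
  interpret F: module R "free_mod R X" by (rule module_free_mod) fact
  show ?case using F.M.zero_closed by (simp add: lin_comb_Nil free_mod_simps(2))
next
  case (Cons p xs)
  interpret F: module R "free_mod R X" by (rule module_free_mod) fact
  obtain a x where [simp]: "p = (a, x)" by force
  show ?case using Cons assms(1) by (auto simp: lin_comb_Cons intro!: F.M.a_closed free_gen_carrier)
qed

lemma lin_comb_surj:
  assumes "cring R" "f \<in> carrier (free_mod R X)"
  obtains xs where "set xs \<subseteq> carrier R \<times> X" "lin_comb R xs = f"
proof -
  interpret cring R by fact
  have "\<exists>xs. set xs \<subseteq> carrier R \<times> X \<and> lin_comb R xs = f"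
    if "finite S" "f \<in> carrier (free_mod R X)" "{x. f x \<noteq> \<zero>\<^bsub>R\<^esub>} = S" for S f
    using that
  proof (induction S arbitrary: f rule: finite_induct)
    case empty
    then have "lin_comb R [] = f" by (auto simp: lin_comb_Nil)
    then show ?case by (intro exI[of _ "[]"]) auto
  next
    case (insert s S)
    let ?g = "\<lambda>x. if x = s then \<zero>\<^bsub>R\<^esub> else f x"
    have supp: "{x. ?g x \<noteq> \<zero>\<^bsub>R\<^esub>} = S" using insert.hyps insert.prems(2) by auto
    have gc: "?g \<in> carrier (free_mod R X)"
      unfolding free_mod_simps supp using insert by (auto simp: free_mod_simps)
    from insert.IH[OF gc supp] obtain xs
      where xs: "set xs \<subseteq> carrier R \<times> X" "lin_comb R xs = ?g" by blast
    have "lin_comb R ((f s, s) # xs) = f"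
      using insert.prems xs(2) by (auto simp: lin_comb_def fun_eq_iff free_mod_simps)
    moreover have "s \<in> X" "f s \<in> carrier R" using insert.prems by (auto simp: free_mod_simps)
    ultimately show ?case using xs(1) by (intro exI[of _ "(f s, s) # xs"]) auto
  qed
  moreover have "finite {x. f x \<noteq> \<zero>\<^bsub>R\<^esub>}" using assms(2) by (simp add: free_mod_simps)
  ultimately show ?thesis using assms(2) that by blast
qed

lemma mod_hom_finsum_zero:
  assumes "module R M" "module R N" "h \<in> mod_hom R M N" "finite S" "g \<in> S \<rightarrow> carrier M"
    "\<And>x. x \<in> S \<Longrightarrow> h (g x) = \<zero>\<^bsub>N\<^esub>"
  shows "h (\<Oplus>\<^bsub>M\<^esub>x\<in>S. g x) = \<zero>\<^bsub>N\<^esub>"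
proof -
  interpret M: module R M by fact
  interpret N: module R N by fact
  have h0: "h \<zero>\<^bsub>M\<^esub> = \<zero>\<^bsub>N\<^esub>"
  proof -
    have "h \<zero>\<^bsub>M\<^esub> = h (\<zero>\<^bsub>R\<^esub> \<odot>\<^bsub>M\<^esub> \<zero>\<^bsub>M\<^esub>)" by simp
    also have "\<dots> = \<zero>\<^bsub>R\<^esub> \<odot>\<^bsub>N\<^esub> h \<zero>\<^bsub>M\<^esub>"
      using assms(3) M.R.zero_closed M.M.zero_closed unfolding mod_hom_def by blast
    also have "\<dots> = \<zero>\<^bsub>N\<^esub>" using assms(3) by (intro N.smult_l_null) (auto simp: mod_hom_def)
    finally show ?thesis .
  qed
  have "g ` T \<subseteq> carrier M \<and> h (\<Oplus>\<^bsub>M\<^esub>x\<in>T. g x) = \<zero>\<^bsub>N\<^esub>" if "finite T" "T \<subseteq> S" for T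
    using that
  proof (induction T rule: finite_induct)
    case (insert t T)
    have gT: "g \<in> T \<rightarrow> carrier M" "g t \<in> carrier M" using assms(5) insert by auto
    have "h (g t \<oplus>\<^bsub>M\<^esub> (\<Oplus>\<^bsub>M\<^esub>x\<in>T. g x)) = h (g t) \<oplus>\<^bsub>N\<^esub> h (\<Oplus>\<^bsub>M\<^esub>x\<in>T. g x)"
      using assms(3) gT by (auto simp: mod_hom_def)
    then show ?case using insert gT assms(6)[of t] by (auto simp: M.M.finsum_insert)
  qed (simp add: h0)
  then show ?thesis using assms(4) by blast
qed

lemma kernel_step:
  assumes "module R N" "h \<in> mod_hom R (free_mod R X) N"
  defines "Y \<equiv> {Comb xs | xs. set xs \<subseteq> carrier R \<times> X \<and> h (lin_comb R xs) = \<zero>\<^bsub>N\<^esub>}"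
  shows "a_kernel (free_mod R X) N h = syz_bd R X ` carrier (free_mod R Y)"
proof -
  interpret module R N by fact
  interpret F: module R "free_mod R X" by (rule module_free_mod) (rule R.is_cring)
  have Yc: "(\<lambda>s. lin_comb R (syz_list s)) \<in> Y \<rightarrow> carrier (free_mod R X)"
    by (auto simp: Y_def intro!: lin_comb_carrier R.is_cring)
  have bd: "syz_bd R X \<in> mod_hom R (free_mod R Y) (free_mod R X)"
    unfolding syz_bd_def by (rule free_lift_hom[OF F.module_axioms Yc])
  show ?thesis
  proof (intro equalityI subsetI)
    fix f assume "f \<in> a_kernel (free_mod R X) N h"
    then have f: "f \<in> carrier (free_mod R X)" "h f = \<zero>\<^bsub>N\<^esub>" by (auto simp: a_kernel_def')
    obtain xs where xs: "set xs \<subseteq> carrier R \<times> X" "lin_comb R xs = f"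
      using lin_comb_surj[OF R.is_cring f(1)] .
    have y: "Comb xs \<in> Y" using xs f by (auto simp: Y_def)
    have "syz_bd R X (free_gen R (Comb xs)) = f"
      unfolding syz_bd_def using xs f by (subst free_lift_gen[OF F.module_axioms]) auto
    then show "f \<in> syz_bd R X ` carrier (free_mod R Y)"
      using free_gen_carrier[OF R.is_cring y] by blast
  next
    fix f assume "f \<in> syz_bd R X ` carrier (free_mod R Y)"
    then obtain g where g: "g \<in> carrier (free_mod R Y)" "f = syz_bd R X g" by blast
    have h_s: "h (a \<odot>\<^bsub>free_mod R X\<^esub> u) = a \<odot>\<^bsub>N\<^esub> h u"
      if "a \<in> carrier R" "u \<in> carrier (free_mod R X)" for a u
      using assms(2) that unfolding mod_hom_def by blast
    have "h f = \<zero>\<^bsub>N\<^esub>" unfolding g(2) syz_bd_def free_lift_def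
    proof (rule mod_hom_finsum_zero[OF F.module_axioms assms(1,2)])
      show "finite {x. g x \<noteq> \<zero>\<^bsub>R\<^esub>}" using g by (auto simp: free_mod_simps)
      show "(\<lambda>x. g x \<odot>\<^bsub>free_mod R X\<^esub> lin_comb R (syz_list x)) \<in> {x. g x \<noteq> \<zero>\<^bsub>R\<^esub>} \<rightarrow> carrier (free_mod R X)"
      proof (intro Pi_I F.smult_closed)
        fix x assume "x \<in> {x. g x \<noteq> \<zero>\<^bsub>R\<^esub>}"
        then have "x \<in> Y" using g by (auto simp: free_mod_simps)
        then show "lin_comb R (syz_list x) \<in> carrier (free_mod R X)" using Yc by auto
        show "g x \<in> carrier R" using g by (auto simp: free_mod_simps)
      qed
      fix x assume "x \<in> {x. g x \<noteq> \<zero>\<^bsub>R\<^esub>}"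
      then have x: "x \<in> Y" using g by (auto simp: free_mod_simps)
      then have "h (lin_comb R (syz_list x)) = \<zero>\<^bsub>N\<^esub>" by (auto simp: Y_def)
      moreover have "g x \<in> carrier R" using g by (auto simp: free_mod_simps)
      ultimately show "h (g x \<odot>\<^bsub>free_mod R X\<^esub> lin_comb R (syz_list x)) = \<zero>\<^bsub>N\<^esub>"
        using x Yc by (subst h_s) auto
    qed
    moreover have "f \<in> carrier (free_mod R X)" using bd g by (auto simp: mod_hom_def)
    ultimately show "f \<in> a_kernel (free_mod R X) N h" by (simp add: a_kernel_def')
  qed
qed

lemma syz_aug_hom:
  assumes "module R M"
  shows "syz_aug R M \<in> mod_hom R (res_mod R M 0) M"
  unfolding syz_aug_def res_mod_def by (rule free_lift_hom[OF assms]) auto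

lemma res_bd_hom:
  assumes "module R M"
  shows "res_bd R M i \<in> mod_hom R (res_mod R M (Suc i)) (res_mod R M i)"
proof -
  interpret module R M by fact
  show ?thesis unfolding res_bd_def res_mod_def syz_bd_def
    by (rule free_lift_hom[OF module_free_mod])
      (cases i; auto intro!: R.is_cring lin_comb_carrier)+
qed

lemma res_exact:
  assumes "module R M"
  shows "syz_aug R M ` carrier (res_mod R M 0) = carrier M"
    and "a_kernel (res_mod R M 0) M (syz_aug R M) = res_bd R M 0 ` carrier (res_mod R M (Suc 0))"
    and "a_kernel (res_mod R M (Suc i)) (res_mod R M i) (res_bd R M i) =
      res_bd R M (Suc i) ` carrier (res_mod R M (Suc (Suc i)))"
proof -
  interpret module R M by fact
  note aug = syz_aug_hom[OF assms]
  have "m \<in> syz_aug R M ` carrier (res_mod R M 0)" if "m \<in> carrier M" for m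
  proof
    show "m = syz_aug R M (free_gen R (Elt m))"
      using that unfolding syz_aug_def by (subst free_lift_gen[OF assms]) auto
    show "free_gen R (Elt m) \<in> carrier (res_mod R M 0)"
      unfolding res_mod_def using that by (intro free_gen_carrier R.is_cring) auto
  qed
  then show "syz_aug R M ` carrier (res_mod R M 0) = carrier M"
    using aug by (auto simp: mod_hom_def)
  show "a_kernel (res_mod R M 0) M (syz_aug R M) = res_bd R M 0 ` carrier (res_mod R M (Suc 0))"
    using kernel_step[OF assms aug[unfolded res_mod_def]] by (simp add: res_mod_def res_bd_def)
  show "a_kernel (res_mod R M (Suc i)) (res_mod R M i) (res_bd R M i) =
      res_bd R M (Suc i) ` carrier (res_mod R M (Suc (Suc i)))"
    using kernel_step[OF module_free_mod[OF R.is_cring] res_bd_hom[OF assms, unfolded res_mod_def]]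
    by (simp add: res_mod_def res_bd_def free_mod_simps)
qed

lemma span_submodule:
  assumes "module R M" "S \<subseteq> carrier M"
  shows "submodule (submod_span R M S) R M" "S \<subseteq> submod_span R M S"
    "\<And>H. submodule H R M \<Longrightarrow> S \<subseteq> H \<Longrightarrow> submod_span R M S \<subseteq> H"
proof -
  interpret module R M by fact
  let ?F = "{H. submodule H R M \<and> S \<subseteq> H}"
  have car: "carrier M \<in> ?F" using carrier_is_submodule assms by auto
  show "submodule (submod_span R M S) R M"
    unfolding submod_span_def
  proof (rule submoduleI)
    show "\<Inter> ?F \<subseteq> carrier M" using car by blast
    show "\<zero>\<^bsub>M\<^esub> \<in> \<Inter> ?F" using submodule.axioms(1) subgroup.one_closed by fastforce
  qed (use submoduleE(3-5) in auto)
  show "S \<subseteq> submod_span R M S" by (auto simp: submod_span_def)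
  show "\<And>H. submodule H R M \<Longrightarrow> S \<subseteq> H \<Longrightarrow> submod_span R M S \<subseteq> H" by (auto simp: submod_span_def)
qed

lemma module_quot_mod:
  assumes "module R M" "submodule H R M"
  shows "module R (quot_mod M H)"
    "\<And>a x. a \<in> carrier R \<Longrightarrow> x \<in> carrier M \<Longrightarrow> a \<odot>\<^bsub>quot_mod M H\<^esub> (H +>\<^bsub>M\<^esub> x) = H +>\<^bsub>M\<^esub> (a \<odot>\<^bsub>M\<^esub> x)"
proof -
  interpret module R M by fact
  interpret S: submodule H R M by fact
  have A: "abelian_subgroup H M"
    by (rule abelian_subgroupI3) (auto intro: additive_subgroup.intro S.subgroup_axioms M.abelian_group_axioms)
  interpret A: abelian_subgroup H M by (rule A)
  show sm: "a \<odot>\<^bsub>quot_mod M H\<^esub> (H +>\<^bsub>M\<^esub> x) = H +>\<^bsub>M\<^esub> (a \<odot>\<^bsub>M\<^esub> x)"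
    if "a \<in> carrier R" "x \<in> carrier M" for a x
  proof -
    have "H +>\<^bsub>M\<^esub> (a \<odot>\<^bsub>M\<^esub> c) = H +>\<^bsub>M\<^esub> (a \<odot>\<^bsub>M\<^esub> x)" if c: "c \<in> H +>\<^bsub>M\<^esub> x" for c
    proof -
      obtain h where h: "h \<in> H" "c = h \<oplus>\<^bsub>M\<^esub> x" using c by (auto simp: a_r_coset_def')
      have "h \<in> carrier M" using h A.a_subset by auto
      then have "a \<odot>\<^bsub>M\<^esub> c = (a \<odot>\<^bsub>M\<^esub> h) \<oplus>\<^bsub>M\<^esub> (a \<odot>\<^bsub>M\<^esub> x)"
        using h that \<open>a \<in> _\<close> \<open>x \<in> _\<close> by (simp add: smult_r_distr)
      moreover have "a \<odot>\<^bsub>M\<^esub> h \<in> H" using h \<open>a \<in> _\<close> by (simp add: S.smult_closed)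
      ultimately have "a \<odot>\<^bsub>M\<^esub> c \<in> H +>\<^bsub>M\<^esub> (a \<odot>\<^bsub>M\<^esub> x)" by (auto simp: a_r_coset_def')
      then show ?thesis using that(1) \<open>a \<in> _\<close> \<open>x \<in> _\<close> 
        by (metis A.a_repr_independence' smult_closed)
    qed
    moreover have "x \<in> H +>\<^bsub>M\<^esub> x" using that A.a_rcos_self by simp
    ultimately have "(\<Union>c\<in>H +>\<^bsub>M\<^esub> x. H +>\<^bsub>M\<^esub> (a \<odot>\<^bsub>M\<^esub> c)) = H +>\<^bsub>M\<^esub> (a \<odot>\<^bsub>M\<^esub> x)"
      by (blast intro: UN_constant_eq)
    then show ?thesis by (simp add: quot_mod_def)
  qed
  have rep: "\<exists>x\<in>carrier M. C = H +>\<^bsub>M\<^esub> x" if "C \<in> carrier (quot_mod M H)" for C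
    using that by (auto simp: quot_mod_def A_RCOSETS_def')
  have mem: "H +>\<^bsub>M\<^esub> x \<in> carrier (quot_mod M H)" if "x \<in> carrier M" for x
    using that by (auto simp: quot_mod_def A_RCOSETS_def')
  have ad: "(H +>\<^bsub>M\<^esub> x) \<oplus>\<^bsub>quot_mod M H\<^esub> (H +>\<^bsub>M\<^esub> y) = H +>\<^bsub>M\<^esub> (x \<oplus>\<^bsub>M\<^esub> y)"
    if "x \<in> carrier M" "y \<in> carrier M" for x y
    using that by (simp add: quot_mod_def A.a_rcos_sum)
  have ze: "\<zero>\<^bsub>quot_mod M H\<^esub> = H +>\<^bsub>M\<^esub> \<zero>\<^bsub>M\<^esub>"
    using A.a_subset by (simp add: quot_mod_def M.a_coset_add_zero)
  show "module R (quot_mod M H)"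
  proof (intro moduleI abelian_groupI R.is_cring, goal_cases)
    case (6 C) then obtain x where x: "x \<in> carrier M" "C = H +>\<^bsub>M\<^esub> x" using rep by blast
    show ?case using x by (intro bexI[of _ "H +>\<^bsub>M\<^esub> (\<ominus>\<^bsub>M\<^esub> x)"]) (auto simp: ad ze mem M.l_neg)
  qed (auto dest!: rep simp: ad ze sm mem M.a_ac smult_l_distr smult_r_distr smult_assoc1)
qed

lemma tensor_universal:
  assumes M: "module R M" and N: "module R N" and P: "module R P"
    and c: "\<And>x y. x \<in> carrier M \<Longrightarrow> y \<in> carrier N \<Longrightarrow> \<phi> (x, y) \<in> carrier P"
    and "\<And>x x' y. x \<in> carrier M \<Longrightarrow> x' \<in> carrier M \<Longrightarrow> y \<in> carrier N \<Longrightarrow> \<phi> (x \<oplus>\<^bsub>M\<^esub> x', y) = \<phi> (x, y) \<oplus>\<^bsub>P\<^esub> \<phi> (x', y)"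
    and "\<And>x y y'. x \<in> carrier M \<Longrightarrow> y \<in> carrier N \<Longrightarrow> y' \<in> carrier N \<Longrightarrow> \<phi> (x, y \<oplus>\<^bsub>N\<^esub> y') = \<phi> (x, y) \<oplus>\<^bsub>P\<^esub> \<phi> (x, y')"
    and "\<And>a x y. a \<in> carrier R \<Longrightarrow> x \<in> carrier M \<Longrightarrow> y \<in> carrier N \<Longrightarrow> \<phi> (a \<odot>\<^bsub>M\<^esub> x, y) = a \<odot>\<^bsub>P\<^esub> \<phi> (x, y)"
    and "\<And>a x y. a \<in> carrier R \<Longrightarrow> x \<in> carrier M \<Longrightarrow> y \<in> carrier N \<Longrightarrow> \<phi> (x, a \<odot>\<^bsub>N\<^esub> y) = a \<odot>\<^bsub>P\<^esub> \<phi> (x, y)"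
  shows "module R (tensor R M N)"
    and "\<And>x y. x \<in> carrier M \<Longrightarrow> y \<in> carrier N \<Longrightarrow> tensor_lift R P \<phi> (pure_tensor R M N x y) = \<phi> (x, y)"
    and "\<And>f. f \<in> carrier (free_mod R (carrier M \<times> carrier N)) \<Longrightarrow>
       tensor_lift R P \<phi> (tensor_ker R M N +>\<^bsub>free_mod R (carrier M \<times> carrier N)\<^esub> f) = free_lift R P \<phi> f"
proof -
  interpret M: module R M by fact
  interpret N: module R N by fact
  interpret P: module R P by fact
  let ?X = "carrier M \<times> carrier N"
  let ?F = "free_mod R ?X"
  interpret F: module R ?F by (rule module_free_mod) (rule M.R.is_cring)
  have g: "free_gen R p \<in> carrier ?F" if "p \<in> ?X" for p
    by (rule free_gen_carrier[OF M.R.is_cring that])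
  have rels: "tensor_rels R M N \<subseteq> carrier ?F"
    unfolding tensor_rels_def Let_def
    by (auto intro!: F.M.minus_closed F.M.a_closed F.smult_closed g)
  note sp = span_submodule[OF F.module_axioms rels, folded tensor_ker_def]
  show "module R (tensor R M N)" unfolding tensor_def
    by (rule module_quot_mod[OF F.module_axioms sp(1)])
  let ?h = "free_lift R P \<phi>"
  have h: "?h \<in> mod_hom R ?F P" using c by (intro free_lift_hom P) auto
  have h_c: "?h f \<in> carrier P" if "f \<in> carrier ?F" for f using h that by (auto simp: mod_hom_def)
  have h_a: "?h (f \<oplus>\<^bsub>?F\<^esub> k) = ?h f \<oplus>\<^bsub>P\<^esub> ?h k" if "f \<in> carrier ?F" "k \<in> carrier ?F" for f k
    using h that by (auto simp: mod_hom_def)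
  have h_s: "?h (a \<odot>\<^bsub>?F\<^esub> f) = a \<odot>\<^bsub>P\<^esub> ?h f" if "f \<in> carrier ?F" "a \<in> carrier R" for a f
    using h that by (auto simp: mod_hom_def)
  have h_0: "?h \<zero>\<^bsub>?F\<^esub> = \<zero>\<^bsub>P\<^esub>" using h_s[of "\<zero>\<^bsub>?F\<^esub>" "\<zero>\<^bsub>R\<^esub>"] h_c[OF F.M.zero_closed] by simp
  have h_n: "?h (\<ominus>\<^bsub>?F\<^esub> f) = \<ominus>\<^bsub>P\<^esub> ?h f" if "f \<in> carrier ?F" for f
    by (rule P.M.minus_equality[symmetric]) (use that h_c h_a[of "\<ominus>\<^bsub>?F\<^esub> f" f] h_0 in \<open>auto simp: F.M.l_neg\<close>)
  have h_m: "?h (f \<ominus>\<^bsub>?F\<^esub> k) = ?h f \<ominus>\<^bsub>P\<^esub> ?h k" if "f \<in> carrier ?F" "k \<in> carrier ?F" for f k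
    using that by (simp add: a_minus_def h_a h_n)
  have h_g: "?h (free_gen R (x, y)) = \<phi> (x, y)" if "x \<in> carrier M" "y \<in> carrier N" for x y
    by (rule free_lift_gen[OF P]) (use that c in auto)
  have K: "submodule {f \<in> carrier ?F. ?h f = \<zero>\<^bsub>P\<^esub>} R ?F"
    by (rule F.submoduleI) (auto simp: h_0 h_n h_a h_s)
  have "tensor_rels R M N \<subseteq> {f \<in> carrier ?F. ?h f = \<zero>\<^bsub>P\<^esub>}"
    using rels unfolding tensor_rels_def Let_def
    by (auto simp: h_m h_a h_s h_g g assms(5-8) c P.M.r_neg a_minus_def[of P])
  from sp(3)[OF K this] have ker: "k \<in> carrier ?F" "?h k = \<zero>\<^bsub>P\<^esub>" if "k \<in> tensor_ker R M N" for k
    using that by auto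
  show L: "tensor_lift R P \<phi> (tensor_ker R M N +>\<^bsub>?F\<^esub> f) = ?h f" if f: "f \<in> carrier ?F" for f
  proof -
    have "?h u = ?h f" if "u \<in> tensor_ker R M N +>\<^bsub>?F\<^esub> f" for u
      using that f ker by (auto simp: a_r_coset_def' h_a h_c)
    moreover have "f \<in> tensor_ker R M N +>\<^bsub>?F\<^esub> f"
      using f subgroup.one_closed[OF submodule.axioms(1)[OF sp(1)]] F.M.l_zero[OF f]
      by (force simp: a_r_coset_def')
    ultimately have "?h ` (tensor_ker R M N +>\<^bsub>?F\<^esub> f) = {?h f}" by blast
    then show ?thesis by (simp add: tensor_lift_def)
  qed
  show "tensor_lift R P \<phi> (pure_tensor R M N x y) = \<phi> (x, y)" if "x \<in> carrier M" "y \<in> carrier N" for x y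
    unfolding pure_tensor_def using L[OF g] that h_g by simp
qed

end

theory Submission
  imports Defs
begin

text \<open>Tensoring a module \<open>N\<close> with a free module on \<open>X\<close> gives the finitely supported families
  \<open>X \<Rightarrow> N\<close> (\<open>fs_mod\<close>), and a map of free modules becomes the action of its matrix on families
  (\<open>fs_mat\<close>). In this description the vanishing of \<open>Tor\<close> is a statement about cycles and boundaries
  of families. It makes sense for a subquotient \<open>H / K\<close> of \<open>N\<close> without forming the quotient: take
  families with values in \<open>H\<close> and read equations modulo \<open>K\<close> (\<open>rel_exact\<close>). The long exact sequence
  is then replaced by two diagram chases inside a single module, \<open>rel_exact_extension\<close> and
  \<open>rel_exact_shift\<close>, and \<open>Tor_zero_iff_rel_exact\<close> translates back.

  Condition (iii) implies (i) as follows. Flatness over \<open>A\<^sub>0\<close>, applied to the inclusion of \<open>I / \<aa>\<close>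
  in \<open>A\<^sub>0\<close>, gives \<open>Tor\<^sub>1 (A / I) = 0\<close> for every ideal \<open>I\<close> that contains \<open>\<aa>\<close>
  (\<open>flat_imp_rel_exact_ideal\<close>). If \<open>Tor\<^sub>i\<close> vanishes on all these cyclic modules, it vanishes on
  every module killed by \<open>\<aa>\<close>, because a family has finitely many values and a finitely generated
  module has a filtration with cyclic quotients (\<open>rel_exact_killed\<close>). It vanishes in particular on
  \<open>I / \<aa>\<close>, and together with \<open>Tor (A\<^sub>0) = 0\<close> this gives the vanishing of \<open>Tor\<^bsub>i+1\<^esub>\<close> on \<open>A / I\<close>:
  induction on \<open>i\<close> (\<open>rel_exact_ideals\<close>). A torsion module is the increasing union of the submodules
  killed by the powers of \<open>\<aa>\<close>, whose successive quotients are killed by \<open>\<aa>\<close> (\<open>rel_exact_torsion\<close>).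

  Condition (i) implies (ii) because \<open>A\<^sub>k\<close> and the cokernel of an injection of \<open>A\<^sub>k\<close>-modules are
  torsion: \<open>Tor\<^sub>1\<close> of that cokernel is the obstruction to injectivity after tensoring
  (\<open>adically_flat_imp_flat\<close>).

  Flatness of the base change is a statement about tensor products over \<open>A\<^sub>k\<close>, whereas \<open>Tor\<close> is
  computed over \<open>A\<close>. The bridge is right exactness: generators and relations of \<open>P\<close> describe every
  \<open>N \<otimes> P\<close> as families modulo the image of a matrix (\<open>tensor_sum_surj\<close>, \<open>tensor_sum_zero_iff\<close>).
  The base change of \<open>M\<close> is presented by the reduction of the matrix that presents \<open>M\<close>
  (\<open>presented_base_change\<close>), so both sides speak about the same families.

  The modules that test flatness and torsion have carriers in one type \<open>'n\<close>, into which \<open>A\<close> embeds.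
  The only test modules used are quotients of \<open>A\<close>, submodules of these, and quotients of modules
  that already live in \<open>'n\<close>; a choice of coset representatives gives them copies in \<open>'n\<close>
  (\<open>quotient_copy\<close>). Larger modules, such as free ones, never serve as test modules, since the
  induction above goes through ideals.\<close>

section \<open>Homomorphisms of modules\<close>

lemma (in abelian_group) neg_zero: "\<ominus> \<zero> = \<zero>"
  by (rule minus_equality) auto

lemma (in abelian_group) diff_zero: "x \<in> carrier G \<Longrightarrow> x \<ominus> \<zero> = x"
  by (simp add: a_minus_def neg_zero)

lemma (in abelian_group) diff_eq_zero_iff:
  assumes "x \<in> carrier G" "y \<in> carrier G"
  shows "x \<ominus> y = \<zero> \<longleftrightarrow> x = y"
proof
  assume "x \<ominus> y = \<zero>"
  then have "(x \<ominus> y) \<oplus> y = y" using assms by simp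
  then show "x = y" using assms by (simp add: a_minus_def a_assoc l_neg)
qed (use assms in \<open>simp add: a_minus_def r_neg\<close>)

lemma (in abelian_group) diff_add_diff:
  assumes "x \<in> carrier G" "y \<in> carrier G" "z \<in> carrier G"
  shows "(x \<ominus> y) \<oplus> (y \<ominus> z) = x \<ominus> z"
proof -
  have "\<ominus> y \<oplus> (y \<oplus> \<ominus> z) = \<ominus> z" using assms by (simp add: r_neg1)
  then show ?thesis using assms by (simp add: a_minus_def a_assoc)
qed

lemma (in abelian_group) diff_swap:
  assumes "x \<in> carrier G" "y \<in> carrier G" "z \<in> carrier G"
  shows "((x \<ominus> y) \<ominus> z) \<oplus> y = x \<ominus> z"
  using assms by (simp add: a_minus_def a_ac r_neg1 r_neg2)

lemma mod_homI:
  assumes "\<And>x. x \<in> carrier M \<Longrightarrow> h x \<in> carrier N"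
    and "\<And>x y. x \<in> carrier M \<Longrightarrow> y \<in> carrier M \<Longrightarrow> h (x \<oplus>\<^bsub>M\<^esub> y) = h x \<oplus>\<^bsub>N\<^esub> h y"
    and "\<And>a x. a \<in> carrier R \<Longrightarrow> x \<in> carrier M \<Longrightarrow> h (a \<odot>\<^bsub>M\<^esub> x) = a \<odot>\<^bsub>N\<^esub> h x"
  shows "h \<in> mod_hom R M N"
  using assms by (auto simp: mod_hom_def)

lemma
  assumes "h \<in> mod_hom R M N"
  shows mod_hom_closed: "x \<in> carrier M \<Longrightarrow> h x \<in> carrier N"
    and mod_hom_add: "x \<in> carrier M \<Longrightarrow> y \<in> carrier M \<Longrightarrow> h (x \<oplus>\<^bsub>M\<^esub> y) = h x \<oplus>\<^bsub>N\<^esub> h y"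
    and mod_hom_smult: "a \<in> carrier R \<Longrightarrow> x \<in> carrier M \<Longrightarrow> h (a \<odot>\<^bsub>M\<^esub> x) = a \<odot>\<^bsub>N\<^esub> h x"
  using assms by (auto simp: mod_hom_def)

lemma
  assumes "module R M" "module R N" "h \<in> mod_hom R M N"
  shows mod_hom_zero: "h \<zero>\<^bsub>M\<^esub> = \<zero>\<^bsub>N\<^esub>"
    and mod_hom_neg: "x \<in> carrier M \<Longrightarrow> h (\<ominus>\<^bsub>M\<^esub> x) = \<ominus>\<^bsub>N\<^esub> h x"
    and mod_hom_diff: "x \<in> carrier M \<Longrightarrow> y \<in> carrier M \<Longrightarrow> h (x \<ominus>\<^bsub>M\<^esub> y) = h x \<ominus>\<^bsub>N\<^esub> h y"
proof -
  interpret M: module R M by fact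
  interpret N: module R N by fact
  note h = mod_hom_closed[OF assms(3)] mod_hom_add[OF assms(3)]
  show z: "h \<zero>\<^bsub>M\<^esub> = \<zero>\<^bsub>N\<^esub>"
    using mod_hom_smult[OF assms(3), of "\<zero>\<^bsub>R\<^esub>" "\<zero>\<^bsub>M\<^esub>"] h(1)[OF M.M.zero_closed] by simp
  show n: "h (\<ominus>\<^bsub>M\<^esub> x) = \<ominus>\<^bsub>N\<^esub> h x" if "x \<in> carrier M" for x
    by (rule N.M.minus_equality[symmetric])
      (use that h(1) h(2)[of "\<ominus>\<^bsub>M\<^esub> x" x] z in \<open>auto simp: M.M.l_neg\<close>)
  show "h (x \<ominus>\<^bsub>M\<^esub> y) = h x \<ominus>\<^bsub>N\<^esub> h y" if "x \<in> carrier M" "y \<in> carrier M" for x y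
    using that by (simp add: a_minus_def h n)
qed

lemma mod_hom_compose:
  assumes "f \<in> mod_hom R M N" "g \<in> mod_hom R N P"
  shows "(\<lambda>x. g (f x)) \<in> mod_hom R M P"
  using assms by (auto simp: mod_hom_def Pi_def)

lemma (in module) submoduleD:
  assumes "submodule H R M"
  shows "x \<in> H \<Longrightarrow> x \<in> carrier M" "\<zero>\<^bsub>M\<^esub> \<in> H"
    "x \<in> H \<Longrightarrow> y \<in> H \<Longrightarrow> x \<oplus>\<^bsub>M\<^esub> y \<in> H" "x \<in> H \<Longrightarrow> \<ominus>\<^bsub>M\<^esub> x \<in> H"
    "x \<in> H \<Longrightarrow> y \<in> H \<Longrightarrow> x \<ominus>\<^bsub>M\<^esub> y \<in> H" "a \<in> carrier R \<Longrightarrow> x \<in> H \<Longrightarrow> a \<odot>\<^bsub>M\<^esub> x \<in> H"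
  using submoduleE[OF assms] subgroup.one_closed[OF submodule.axioms(1)[OF assms]]
  by (auto simp: a_minus_def)

lemma mod_hom_sum:
  assumes N: "module R N" and f: "f \<in> mod_hom R M N" and g: "g \<in> mod_hom R M N"
  shows "(\<lambda>x. f x \<oplus>\<^bsub>N\<^esub> g x) \<in> mod_hom R M N"
proof -
  interpret module R N by (rule N)
  show ?thesis
    by (rule mod_homI)
      (simp_all add: mod_hom_closed[OF f] mod_hom_closed[OF g] mod_hom_add[OF f] mod_hom_add[OF g]
        mod_hom_smult[OF f] mod_hom_smult[OF g] M.a_ac smult_r_distr)
qed

lemma mod_hom_inj_iff:
  assumes M: "module R M" and N: "module R N" and h: "h \<in> mod_hom R M N"
  shows "inj_on h (carrier M) \<longleftrightarrow> (\<forall>x\<in>carrier M. h x = \<zero>\<^bsub>N\<^esub> \<longrightarrow> x = \<zero>\<^bsub>M\<^esub>)"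
proof -
  interpret M: module R M by (rule M)
  interpret N: module R N by (rule N)
  note h0 = mod_hom_zero[OF M N h]
  show ?thesis
  proof (intro iffI ballI impI inj_onI)
    fix x assume "inj_on h (carrier M)" "x \<in> carrier M" "h x = \<zero>\<^bsub>N\<^esub>"
    then show "x = \<zero>\<^bsub>M\<^esub>" using h0 M.M.zero_closed inj_onD by metis
  next
    fix x y assume k: "\<forall>x\<in>carrier M. h x = \<zero>\<^bsub>N\<^esub> \<longrightarrow> x = \<zero>\<^bsub>M\<^esub>"
      and x: "x \<in> carrier M" and y: "y \<in> carrier M" and "h x = h y"
    then have "h (x \<ominus>\<^bsub>M\<^esub> y) = \<zero>\<^bsub>N\<^esub>"
      using mod_hom_diff[OF M N h x y] mod_hom_closed[OF h y] by (simp add: N.M.diff_eq_zero_iff)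
    then have "x \<ominus>\<^bsub>M\<^esub> y = \<zero>\<^bsub>M\<^esub>" using k M.M.minus_closed[OF x y] by blast
    then show "x = y" using x y by (simp add: M.M.diff_eq_zero_iff)
  qed
qed

lemma mod_hom_image_submodule:
  assumes "module R M" "module R N" "h \<in> mod_hom R M N" "submodule H R M"
  shows "submodule (h ` H) R N"
proof -
  interpret M: module R M by fact
  interpret N: module R N by fact
  note h = mod_hom_closed[OF assms(3)] mod_hom_add[OF assms(3)] mod_hom_smult[OF assms(3)]
    mod_hom_zero[OF assms(1-3)] mod_hom_neg[OF assms(1-3)]
  note H = M.submoduleE[OF assms(4)]
  have H0: "\<zero>\<^bsub>M\<^esub> \<in> H" using subgroup.one_closed[OF submodule.axioms(1)[OF assms(4)]] by simp
  show ?thesis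
  proof (rule N.submoduleI)
    show "h ` H \<subseteq> carrier N" using H(1) h(1) by blast
    show "\<zero>\<^bsub>N\<^esub> \<in> h ` H" using H0 h(4) by force
    fix u assume "u \<in> h ` H"
    then obtain x where x: "x \<in> H" "u = h x" by blast
    then have xc: "x \<in> carrier M" using H(1) by blast
    show "\<ominus>\<^bsub>N\<^esub> u \<in> h ` H" using x h(5)[OF xc] H(3) by force
    show "a \<odot>\<^bsub>N\<^esub> u \<in> h ` H" if "a \<in> carrier R" for a
      using x h(3)[OF that xc] H(4)[OF that] by force
    fix v assume "v \<in> h ` H"
    then obtain y where y: "y \<in> H" "v = h y" by blast
    then have yc: "y \<in> carrier M" using H(1) by blast
    show "u \<oplus>\<^bsub>N\<^esub> v \<in> h ` H" using x y h(2)[OF xc yc] H(5) by force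
  qed
qed

lemma free_mod_induct:
  assumes "cring R" "u \<in> carrier (free_mod R X)" "P \<zero>\<^bsub>free_mod R X\<^esub>"
    and "\<And>a x v. a \<in> carrier R \<Longrightarrow> x \<in> X \<Longrightarrow> v \<in> carrier (free_mod R X) \<Longrightarrow> P v \<Longrightarrow>
      P (a \<odot>\<^bsub>free_mod R X\<^esub> free_gen R x \<oplus>\<^bsub>free_mod R X\<^esub> v)"
  shows "P u"
proof -
  obtain xs where xs: "set xs \<subseteq> carrier R \<times> X" "lin_comb R xs = u" using lin_comb_surj[OF assms(1,2)] .
  have "P (lin_comb R xs)" using xs(1)
  proof (induction xs)
    case Nil then show ?case using assms(3) by (simp add: lin_comb_Nil free_mod_simps)
  next
    case (Cons p xs)
    obtain a x where [simp]: "p = (a, x)" by force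
    have c: "lin_comb R xs \<in> carrier (free_mod R X)"
      using Cons.prems by (intro lin_comb_carrier[OF assms(1)]) auto
    have "P (a \<odot>\<^bsub>free_mod R X\<^esub> free_gen R x \<oplus>\<^bsub>free_mod R X\<^esub> lin_comb R xs)"
      using Cons c by (intro assms(4)) auto
    moreover have "a \<in> carrier R" using Cons.prems by auto
    ultimately show ?case by (simp add: lin_comb_Cons[OF assms(1) _ c])
  qed
  then show ?thesis using xs(2) by simp
qed

text \<open>A homomorphism out of a free module is determined by its values on the basis; likewise for
  \<open>fs_hom_eqI\<close> and \<open>tensor_hom_eqI\<close> below. Most identities between maps reduce to one of these three.\<close>

lemma free_hom_eqI:
  assumes "cring R" "module R P" "h \<in> mod_hom R (free_mod R X) P" "k \<in> mod_hom R (free_mod R X) P"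
    and "\<And>x. x \<in> X \<Longrightarrow> h (free_gen R x) = k (free_gen R x)" "u \<in> carrier (free_mod R X)"
  shows "h u = k u"
proof -
  note F = module_free_mod[OF assms(1), of X]
  interpret F: module R "free_mod R X" by (rule F)
  note g = free_gen_carrier[OF assms(1), of _ X]
  show ?thesis
    by (rule free_mod_induct[OF assms(1,6), where P = "\<lambda>u. h u = k u"])
      (auto simp: mod_hom_zero[OF F assms(2)] assms(3-5) g
        mod_hom_add[OF assms(3)] mod_hom_add[OF assms(4)] mod_hom_smult[OF assms(3)] mod_hom_smult[OF assms(4)])
qed

lemma free_lift_basis:
  assumes "module R P" "p \<in> X \<rightarrow> carrier P" "x \<in> X"
  shows "free_lift R P p (free_gen R x) = p x"
  using assms by (intro free_lift_gen) auto


lemma free_lift_gen_id: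
  assumes "cring R" "u \<in> carrier (free_mod R X)"
  shows "free_lift R (free_mod R X) (free_gen R) u = u"
proof (rule free_hom_eqI[OF assms(1) _ _ _ _ assms(2)])
  note F = module_free_mod[OF assms(1), of X]
  have g: "free_gen R \<in> X \<rightarrow> carrier (free_mod R X)" using free_gen_carrier[OF assms(1)] by auto
  show "module R (free_mod R X)" by (rule F)
  show "free_lift R (free_mod R X) (free_gen R) \<in> mod_hom R (free_mod R X) (free_mod R X)"
    by (rule free_lift_hom[OF F g])
  show "(\<lambda>u. u) \<in> mod_hom R (free_mod R X) (free_mod R X)" by (rule mod_homI) auto
  show "free_lift R (free_mod R X) (free_gen R) (free_gen R x) = free_gen R x" if "x \<in> X" for x
    by (rule free_lift_basis[OF F g that])
qed

section \<open>Finitely supported families in a module\<close>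

text \<open>The tensor product of \<open>N\<close> with the free module on \<open>X\<close>, that is the direct sum of copies of \<open>N\<close>
  indexed by \<open>X\<close>. As for \<open>free_mod\<close>, families vanish outside \<open>X\<close>, so that equality of families is
  equality of functions.\<close>

definition fs_mod :: "('a, 'n, 'q) module_scheme \<Rightarrow> 'x set \<Rightarrow> ('a, 'x \<Rightarrow> 'n) module"
  where "fs_mod N X =
    \<lparr>carrier = {f. (\<forall>x. f x \<in> carrier N) \<and> finite {x. f x \<noteq> \<zero>\<^bsub>N\<^esub>} \<and> (\<forall>x. x \<notin> X \<longrightarrow> f x = \<zero>\<^bsub>N\<^esub>)},
     mult = undefined, one = undefined,
     zero = (\<lambda>_. \<zero>\<^bsub>N\<^esub>), add = (\<lambda>f g x. f x \<oplus>\<^bsub>N\<^esub> g x), smult = (\<lambda>a f x. a \<odot>\<^bsub>N\<^esub> f x)\<rparr>"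

definition fs_single :: "('a, 'n, 'q) module_scheme \<Rightarrow> 'x \<Rightarrow> 'n \<Rightarrow> 'x \<Rightarrow> 'n"
  where "fs_single N x n = (\<lambda>y. if y = x then n else \<zero>\<^bsub>N\<^esub>)"

definition fs_lift ::
    "('a, 'n, 'q) module_scheme \<Rightarrow> ('a, 'b, 'p) module_scheme \<Rightarrow> ('x \<Rightarrow> 'n \<Rightarrow> 'b) \<Rightarrow> ('x \<Rightarrow> 'n) \<Rightarrow> 'b"
  where "fs_lift N P \<phi> u = (\<Oplus>\<^bsub>P\<^esub>x\<in>{x. u x \<noteq> \<zero>\<^bsub>N\<^esub>}. \<phi> x (u x))"

lemma fs_mod_simps:
  "f \<in> carrier (fs_mod N X) \<longleftrightarrow>
     (\<forall>x. f x \<in> carrier N) \<and> finite {x. f x \<noteq> \<zero>\<^bsub>N\<^esub>} \<and> (\<forall>x. x \<notin> X \<longrightarrow> f x = \<zero>\<^bsub>N\<^esub>)"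
  "\<zero>\<^bsub>fs_mod N X\<^esub> = (\<lambda>_. \<zero>\<^bsub>N\<^esub>)"
  "f \<oplus>\<^bsub>fs_mod N X\<^esub> g = (\<lambda>x. f x \<oplus>\<^bsub>N\<^esub> g x)"
  "a \<odot>\<^bsub>fs_mod N X\<^esub> f = (\<lambda>x. a \<odot>\<^bsub>N\<^esub> f x)"
  by (auto simp: fs_mod_def)

lemma module_fs_mod:
  fixes N :: "('a, 'n, 'q) module_scheme" and X :: "'x set"
  assumes "module R N"
  shows "module R (fs_mod N X)"
proof -
  interpret module R N by fact
  have fin_add: "finite {x. f x \<oplus>\<^bsub>N\<^esub> g x \<noteq> \<zero>\<^bsub>N\<^esub>}"
    if "finite {x. f x \<noteq> \<zero>\<^bsub>N\<^esub>}" "finite {x. g x \<noteq> \<zero>\<^bsub>N\<^esub>}" for f g :: "'x \<Rightarrow> 'n"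
    by (rule finite_subset[OF _ finite_UnI[OF that]]) auto
  have fin_smult: "finite {x. a \<odot>\<^bsub>N\<^esub> f x \<noteq> \<zero>\<^bsub>N\<^esub>}"
    if "a \<in> carrier R" "finite {x. f x \<noteq> \<zero>\<^bsub>N\<^esub>}" for a and f :: "'x \<Rightarrow> 'n"
    by (rule finite_subset[OF _ that(2)]) (use that(1) in auto)
  show ?thesis
  proof (intro moduleI R.is_cring abelian_groupI, goal_cases)
    case (6 f)
    have "(\<lambda>x. \<ominus>\<^bsub>N\<^esub> f x) \<in> carrier (fs_mod N X)"
    proof -
      have "finite {x. \<ominus>\<^bsub>N\<^esub> f x \<noteq> \<zero>\<^bsub>N\<^esub>}"
        by (rule finite_subset[of _ "{x. f x \<noteq> \<zero>\<^bsub>N\<^esub>}"]) (use 6 in \<open>auto simp: fs_mod_simps\<close>)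
      then show ?thesis using 6 by (auto simp: fs_mod_simps)
    qed
    then show ?case
      using 6 by (intro bexI[of _ "\<lambda>x. \<ominus>\<^bsub>N\<^esub> f x"]) (auto simp: fs_mod_simps M.l_neg fun_eq_iff)
  qed (auto simp: fs_mod_simps fun_eq_iff M.a_ac smult_l_distr smult_r_distr smult_assoc1 fin_add fin_smult)
qed

lemma fs_mod_neg:
  assumes "module R N" "f \<in> carrier (fs_mod N X)"
  shows "\<ominus>\<^bsub>fs_mod N X\<^esub> f = (\<lambda>x. \<ominus>\<^bsub>N\<^esub> f x)"
proof -
  interpret module R N by fact
  interpret F: module R "fs_mod N X" by (rule module_fs_mod) fact
  have "{x. \<ominus>\<^bsub>N\<^esub> f x \<noteq> \<zero>\<^bsub>N\<^esub>} \<subseteq> {x. f x \<noteq> \<zero>\<^bsub>N\<^esub>}" using assms(2) by auto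
  then have "(\<lambda>x. \<ominus>\<^bsub>N\<^esub> f x) \<in> carrier (fs_mod N X)"
    using assms(2) finite_subset by (auto simp: fs_mod_simps)
  then show ?thesis
    by (intro F.M.minus_equality) (use assms(2) in \<open>auto simp: fs_mod_simps fun_eq_iff M.l_neg\<close>)
qed

lemma fs_mod_diff:
  assumes "module R N" "f \<in> carrier (fs_mod N X)" "g \<in> carrier (fs_mod N X)"
  shows "f \<ominus>\<^bsub>fs_mod N X\<^esub> g = (\<lambda>x. f x \<ominus>\<^bsub>N\<^esub> g x)"
  by (simp add: a_minus_def fs_mod_neg[OF assms(1,3)] fs_mod_simps)

lemma fs_single_carrier:
  assumes "module R N" "x \<in> X" "n \<in> carrier N"
  shows "fs_single N x n \<in> carrier (fs_mod N X)"
proof -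
  interpret module R N by fact
  have "finite {y. fs_single N x n y \<noteq> \<zero>\<^bsub>N\<^esub>}"
    by (rule finite_subset[of _ "{x}"]) (auto simp: fs_single_def)
  then show ?thesis using assms by (auto simp: fs_mod_simps fs_single_def)
qed

lemma fs_mod_induct:
  assumes "module R N" "u \<in> carrier (fs_mod N X)" "P \<zero>\<^bsub>fs_mod N X\<^esub>"
    and "\<And>x n v. x \<in> X \<Longrightarrow> n \<in> carrier N \<Longrightarrow> v \<in> carrier (fs_mod N X) \<Longrightarrow> P v \<Longrightarrow>
      P (fs_single N x n \<oplus>\<^bsub>fs_mod N X\<^esub> v)"
  shows "P u"
proof -
  interpret module R N by fact
  have "P u" if "finite S" "u \<in> carrier (fs_mod N X)" "{x. u x \<noteq> \<zero>\<^bsub>N\<^esub>} = S" for S u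
    using that
  proof (induction S arbitrary: u rule: finite_induct)
    case empty
    then show ?case using assms(3) by (simp add: fs_mod_simps)
  next
    case (insert s S)
    let ?g = "\<lambda>x. if x = s then \<zero>\<^bsub>N\<^esub> else u x"
    have supp: "{x. ?g x \<noteq> \<zero>\<^bsub>N\<^esub>} = S" using insert.hyps insert.prems(2) by auto
    have gc: "?g \<in> carrier (fs_mod N X)"
      unfolding fs_mod_simps supp using insert by (auto simp: fs_mod_simps)
    have "s \<in> X" "u s \<in> carrier N" using insert.prems by (auto simp: fs_mod_simps)
    then have "P (fs_single N s (u s) \<oplus>\<^bsub>fs_mod N X\<^esub> ?g)"
      using insert.IH[OF gc supp] gc assms(4) by blast
    moreover have "fs_single N s (u s) \<oplus>\<^bsub>fs_mod N X\<^esub> ?g = u"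
      using insert.prems by (auto simp: fs_mod_simps fs_single_def fun_eq_iff)
    ultimately show ?case by simp
  qed
  then show ?thesis using assms(2) by (auto simp: fs_mod_simps)
qed

lemma fs_lift_eq:
  assumes "module R N" "module R P" "u \<in> carrier (fs_mod N X)" "\<And>x. x \<in> X \<Longrightarrow> \<phi> x \<in> mod_hom R N P"
    "finite S" "{x. u x \<noteq> \<zero>\<^bsub>N\<^esub>} \<subseteq> S" "S \<subseteq> X"
  shows "fs_lift N P \<phi> u = (\<Oplus>\<^bsub>P\<^esub>x\<in>S. \<phi> x (u x))"
proof -
  interpret P: module R P by fact
  have "\<phi> x (u x) \<in> carrier P" if "x \<in> S" for x
    using mod_hom_closed[OF assms(4), of x "u x"] assms(3,7) that by (auto simp: fs_mod_simps)
  then show ?thesis unfolding fs_lift_def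
    by (intro P.M.add.finprod_mono_neutral_cong_left)
      (use assms in \<open>auto simp: mod_hom_zero[OF assms(1,2)]\<close>)
qed

lemma fs_lift_hom:
  assumes "module R N" "module R P" "\<And>x. x \<in> X \<Longrightarrow> \<phi> x \<in> mod_hom R N P"
  shows "fs_lift N P \<phi> \<in> mod_hom R (fs_mod N X) P"
proof -
  interpret N: module R N by fact
  interpret P: module R P by fact
  interpret F: module R "fs_mod N X" by (rule module_fs_mod) fact
  have supp: "finite {x. f x \<noteq> \<zero>\<^bsub>N\<^esub>}" "{x. f x \<noteq> \<zero>\<^bsub>N\<^esub>} \<subseteq> X"
    if "f \<in> carrier (fs_mod N X)" for f
    using that by (auto simp: fs_mod_simps)
  have phi: "\<phi> x (f x) \<in> carrier P" if "f \<in> carrier (fs_mod N X)" "x \<in> X" for f x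
    using mod_hom_closed[OF assms(3), of x "f x"] that by (auto simp: fs_mod_simps)
  have val: "f x \<in> carrier N" if "f \<in> carrier (fs_mod N X)" for f x
    using that by (auto simp: fs_mod_simps)
  show ?thesis
  proof (rule mod_homI)
    show "fs_lift N P \<phi> u \<in> carrier P" if "u \<in> carrier (fs_mod N X)" for u
      unfolding fs_lift_def using supp[OF that] phi[OF that] by (intro P.M.finsum_closed) auto
  next
    fix f g assume f: "f \<in> carrier (fs_mod N X)" and g: "g \<in> carrier (fs_mod N X)"
    let ?S = "{x. f x \<noteq> \<zero>\<^bsub>N\<^esub>} \<union> {x. g x \<noteq> \<zero>\<^bsub>N\<^esub>}"
    have fg: "f \<oplus>\<^bsub>fs_mod N X\<^esub> g \<in> carrier (fs_mod N X)" using f g by simp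
    have S: "finite ?S" "?S \<subseteq> X" using supp[OF f] supp[OF g] by auto
    have "fs_lift N P \<phi> (f \<oplus>\<^bsub>fs_mod N X\<^esub> g) = (\<Oplus>\<^bsub>P\<^esub>x\<in>?S. \<phi> x ((f \<oplus>\<^bsub>fs_mod N X\<^esub> g) x))"
      by (rule fs_lift_eq[OF assms(1,2) fg assms(3)]) (use S in \<open>auto simp: fs_mod_simps\<close>)
    also have "\<dots> = (\<Oplus>\<^bsub>P\<^esub>x\<in>?S. \<phi> x (f x) \<oplus>\<^bsub>P\<^esub> \<phi> x (g x))"
      by (rule P.M.finsum_cong')
        (use S phi[OF f] phi[OF g] val[OF f] val[OF g] in \<open>auto simp: fs_mod_simps mod_hom_add[OF assms(3)] subset_iff\<close>)
    also have "\<dots> = (\<Oplus>\<^bsub>P\<^esub>x\<in>?S. \<phi> x (f x)) \<oplus>\<^bsub>P\<^esub> (\<Oplus>\<^bsub>P\<^esub>x\<in>?S. \<phi> x (g x))"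
      by (rule P.M.finsum_addf) (use S phi[OF f] phi[OF g] in \<open>auto simp: subset_iff\<close>)
    also have "(\<Oplus>\<^bsub>P\<^esub>x\<in>?S. \<phi> x (f x)) = fs_lift N P \<phi> f"
      by (rule fs_lift_eq[symmetric, OF assms(1,2) f assms(3)]) (use S in auto)
    also have "(\<Oplus>\<^bsub>P\<^esub>x\<in>?S. \<phi> x (g x)) = fs_lift N P \<phi> g"
      by (rule fs_lift_eq[symmetric, OF assms(1,2) g assms(3)]) (use S in auto)
    finally show "fs_lift N P \<phi> (f \<oplus>\<^bsub>fs_mod N X\<^esub> g) = fs_lift N P \<phi> f \<oplus>\<^bsub>P\<^esub> fs_lift N P \<phi> g" .
  next
    fix a f assume a: "a \<in> carrier R" and f: "f \<in> carrier (fs_mod N X)"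
    let ?S = "{x. f x \<noteq> \<zero>\<^bsub>N\<^esub>}"
    have af: "a \<odot>\<^bsub>fs_mod N X\<^esub> f \<in> carrier (fs_mod N X)" using a f by simp
    have "fs_lift N P \<phi> (a \<odot>\<^bsub>fs_mod N X\<^esub> f) = (\<Oplus>\<^bsub>P\<^esub>x\<in>?S. \<phi> x ((a \<odot>\<^bsub>fs_mod N X\<^esub> f) x))"
      by (rule fs_lift_eq[OF assms(1,2) af assms(3)]) (use supp[OF f] a in \<open>auto simp: fs_mod_simps\<close>)
    also have "\<dots> = (\<Oplus>\<^bsub>P\<^esub>x\<in>?S. a \<odot>\<^bsub>P\<^esub> \<phi> x (f x))"
      by (rule P.M.finsum_cong')
        (use supp[OF f] phi[OF f] val[OF f] a in \<open>auto simp: fs_mod_simps mod_hom_smult[OF assms(3)] subset_iff\<close>)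
    also have "\<dots> = a \<odot>\<^bsub>P\<^esub> fs_lift N P \<phi> f" unfolding fs_lift_def
      by (rule P.finsum_smult_ldistr[symmetric])
        (use supp[OF f] phi[OF f] a in \<open>auto simp: subset_iff\<close>)
    finally show "fs_lift N P \<phi> (a \<odot>\<^bsub>fs_mod N X\<^esub> f) = a \<odot>\<^bsub>P\<^esub> fs_lift N P \<phi> f" .
  qed
qed

lemma fs_lift_single:
  assumes "module R N" "module R P" "\<phi> x \<in> mod_hom R N P" "n \<in> carrier N"
  shows "fs_lift N P \<phi> (fs_single N x n) = \<phi> x n"
proof -
  interpret P: module R P by fact
  have "fs_lift N P \<phi> (fs_single N x n) = (\<Oplus>\<^bsub>P\<^esub>y\<in>{x}. \<phi> y (fs_single N x n y))"
    by (rule fs_lift_eq[where X = "{x}", OF assms(1,2) fs_single_carrier[OF assms(1)]])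
      (use assms in \<open>auto simp: fs_single_def\<close>)
  also have "\<dots> = \<phi> x n" using mod_hom_closed[OF assms(3,4)] by (simp add: fs_single_def)
  finally show ?thesis .
qed

lemma fs_hom_eqI:
  assumes "module R N" "module R P" "h \<in> mod_hom R (fs_mod N X) P" "k \<in> mod_hom R (fs_mod N X) P"
    and "\<And>x n. x \<in> X \<Longrightarrow> n \<in> carrier N \<Longrightarrow> h (fs_single N x n) = k (fs_single N x n)"
    and "u \<in> carrier (fs_mod N X)"
  shows "h u = k u"
proof -
  note F = module_fs_mod[OF assms(1), of X]
  note g = fs_single_carrier[OF assms(1), of _ X]
  show ?thesis
    by (rule fs_mod_induct[OF assms(1,6), where P = "\<lambda>u. h u = k u"])
      (auto simp: mod_hom_zero[OF F assms(2)] assms(3-5) g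
        mod_hom_add[OF assms(3)] mod_hom_add[OF assms(4)])
qed

lemma fs_map_hom:
  assumes "module R N" "module R P" "f \<in> mod_hom R N P"
  shows "(\<lambda>g x. f (g x)) \<in> mod_hom R (fs_mod N X) (fs_mod P X)"
proof (rule mod_homI)
  note f0 = mod_hom_zero[OF assms]
  fix g assume g: "g \<in> carrier (fs_mod N X)"
  have "{x. f (g x) \<noteq> \<zero>\<^bsub>P\<^esub>} \<subseteq> {x. g x \<noteq> \<zero>\<^bsub>N\<^esub>}" using f0 by auto
  then show "(\<lambda>x. f (g x)) \<in> carrier (fs_mod P X)"
    using g f0 finite_subset by (auto simp: fs_mod_simps mod_hom_closed[OF assms(3)])
qed (auto simp: fs_mod_simps mod_hom_add[OF assms(3)] mod_hom_smult[OF assms(3)])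

section \<open>The map of finitely supported families given by a matrix\<close>

text \<open>The map that the matrix \<open>d\<close>, whose column \<open>x\<close> is \<open>d x\<close>, induces after tensoring with \<open>N\<close>.\<close>

definition fs_mat ::
    "('a, 'n, 'q) module_scheme \<Rightarrow> 'y set \<Rightarrow> ('x \<Rightarrow> 'y \<Rightarrow> 'a) \<Rightarrow> ('x \<Rightarrow> 'n) \<Rightarrow> 'y \<Rightarrow> 'n"
  where "fs_mat N Y d = fs_lift N (fs_mod N Y) (\<lambda>x n y. d x y \<odot>\<^bsub>N\<^esub> n)"

lemma fs_scale_carrier:
  assumes "module R N" "u \<in> carrier (free_mod R X)" "n \<in> carrier N"
  shows "(\<lambda>x. u x \<odot>\<^bsub>N\<^esub> n) \<in> carrier (fs_mod N X)"
proof -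
  interpret module R N by fact
  have "{x. u x \<odot>\<^bsub>N\<^esub> n \<noteq> \<zero>\<^bsub>N\<^esub>} \<subseteq> {x. u x \<noteq> \<zero>\<^bsub>R\<^esub>}" using assms(3) by auto
  then show ?thesis using assms(2,3) finite_subset by (auto simp: fs_mod_simps free_mod_simps)
qed

lemma fs_scale_hom_left:
  assumes "module R N" "n \<in> carrier N"
  shows "(\<lambda>u x. u x \<odot>\<^bsub>N\<^esub> n) \<in> mod_hom R (free_mod R X) (fs_mod N X)"
proof -
  interpret module R N by fact
  show ?thesis
    using fs_scale_carrier[OF assms(1) _ assms(2)] assms(2)
    by (intro mod_homI) (auto simp: fs_mod_simps free_mod_simps smult_l_distr smult_assoc1)
qed

lemma fs_scale_hom_right:
  assumes "module R N" "u \<in> carrier (free_mod R X)"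
  shows "(\<lambda>n x. u x \<odot>\<^bsub>N\<^esub> n) \<in> mod_hom R N (fs_mod N X)"
proof -
  interpret module R N by fact
  have "a \<odot>\<^bsub>N\<^esub> (b \<odot>\<^bsub>N\<^esub> n) = b \<odot>\<^bsub>N\<^esub> (a \<odot>\<^bsub>N\<^esub> n)"
    if "a \<in> carrier R" "b \<in> carrier R" "n \<in> carrier N" for a b n
    using that by (simp add: smult_assoc1[symmetric] R.m_comm)
  then show ?thesis
    using fs_scale_carrier[OF assms(1,2)] assms(2)
    by (intro mod_homI) (auto simp: fs_mod_simps free_mod_simps smult_r_distr)
qed

lemma fs_scale_gen:
  assumes "module R N" "n \<in> carrier N"
  shows "(\<lambda>y. free_gen R x y \<odot>\<^bsub>N\<^esub> n) = fs_single N x n"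
proof -
  interpret module R N by fact
  show ?thesis using assms by (auto simp: free_gen_def fs_single_def fun_eq_iff)
qed

lemma fs_mat_hom:
  assumes "module R N" "d \<in> X \<rightarrow> carrier (free_mod R Y)"
  shows "fs_mat N Y d \<in> mod_hom R (fs_mod N X) (fs_mod N Y)"
  unfolding fs_mat_def
  by (rule fs_lift_hom[OF assms(1) module_fs_mod[OF assms(1)] fs_scale_hom_right[OF assms(1)]])
    (use assms(2) in auto)

lemma fs_mat_single:
  assumes "module R N" "d x \<in> carrier (free_mod R Y)" "n \<in> carrier N"
  shows "fs_mat N Y d (fs_single N x n) = (\<lambda>y. d x y \<odot>\<^bsub>N\<^esub> n)"
  unfolding fs_mat_def
  using fs_lift_single[where \<phi> = "\<lambda>x n y. d x y \<odot>\<^bsub>N\<^esub> n" and x = x,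
      OF assms(1) module_fs_mod[OF assms(1)] fs_scale_hom_right[OF assms(1,2)] assms(3)] .

lemma fs_mat_basis:
  assumes "module R N" "d \<in> Y \<rightarrow> carrier (free_mod R X)" "y \<in> Y" "n \<in> carrier N"
  shows "fs_mat N X d (fs_single N y n) = (\<lambda>x. d y x \<odot>\<^bsub>N\<^esub> n)"
  by (rule fs_mat_single[where d = d, OF assms(1) funcset_mem[OF assms(2,3)] assms(4)])

text \<open>The induced map sends \<open>u \<otimes> n\<close> to \<open>d u \<otimes> n\<close>, where \<open>u \<otimes> n\<close> is the family \<open>\<lambda>x. u x \<odot> n\<close>.\<close>

lemma fs_mat_scale:
  assumes "module R N" "d \<in> X \<rightarrow> carrier (free_mod R Y)"
    and "u \<in> carrier (free_mod R X)" "n \<in> carrier N"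
  shows "fs_mat N Y d (\<lambda>x. u x \<odot>\<^bsub>N\<^esub> n) = (\<lambda>y. free_lift R (free_mod R Y) d u y \<odot>\<^bsub>N\<^esub> n)"
proof -
  interpret module R N by fact
  note F = module_free_mod[OF R.is_cring, of Y]
  show ?thesis
  proof (rule free_hom_eqI[OF R.is_cring module_fs_mod[OF assms(1)] _ _ _ assms(3)])
    show "(\<lambda>u. fs_mat N Y d (\<lambda>x. u x \<odot>\<^bsub>N\<^esub> n)) \<in> mod_hom R (free_mod R X) (fs_mod N Y)"
      by (rule mod_hom_compose[OF fs_scale_hom_left[OF assms(1,4)] fs_mat_hom[OF assms(1,2)]])
    show "(\<lambda>u y. free_lift R (free_mod R Y) d u y \<odot>\<^bsub>N\<^esub> n) \<in> mod_hom R (free_mod R X) (fs_mod N Y)"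
      by (rule mod_hom_compose[OF free_lift_hom[OF F assms(2)] fs_scale_hom_left[OF assms(1,4)]])
    show "fs_mat N Y d (\<lambda>y. free_gen R x y \<odot>\<^bsub>N\<^esub> n) =
        (\<lambda>y. free_lift R (free_mod R Y) d (free_gen R x) y \<odot>\<^bsub>N\<^esub> n)" if "x \<in> X" for x
      using funcset_mem[OF assms(2) that]
      by (simp add: fs_scale_gen[OF assms(1,4)] fs_mat_single[OF assms(1) _ assms(4)] free_lift_gen[OF F])
  qed
qed

lemma fs_mat_natural:
  assumes "module R N" "module R P" "f \<in> mod_hom R N P" "d \<in> X \<rightarrow> carrier (free_mod R Y)"
    and "g \<in> carrier (fs_mod N X)"
  shows "fs_mat P Y d (\<lambda>x. f (g x)) = (\<lambda>y. f (fs_mat N Y d g y))"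
proof -
  have dc: "d x y \<in> carrier R" if "x \<in> X" for x y using funcset_mem[OF assms(4) that] by (simp add: free_mod_simps)
  show ?thesis
  proof (rule fs_hom_eqI[OF assms(1) module_fs_mod[OF assms(2)] _ _ _ assms(5)])
    show "(\<lambda>g. fs_mat P Y d (\<lambda>x. f (g x))) \<in> mod_hom R (fs_mod N X) (fs_mod P Y)"
      by (rule mod_hom_compose[OF fs_map_hom[OF assms(1-3)] fs_mat_hom[OF assms(2,4)]])
    show "(\<lambda>g y. f (fs_mat N Y d g y)) \<in> mod_hom R (fs_mod N X) (fs_mod P Y)"
      by (rule mod_hom_compose[OF fs_mat_hom[OF assms(1,4)] fs_map_hom[OF assms(1-3)]])
    fix x n assume x: "x \<in> X" and n: "n \<in> carrier N"
    have "(\<lambda>y. f (fs_single N x n y)) = fs_single P x (f n)"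
      by (auto simp: fs_single_def mod_hom_zero[OF assms(1-3)])
    then show "fs_mat P Y d (\<lambda>y. f (fs_single N x n y)) = (\<lambda>y. f (fs_mat N Y d (fs_single N x n) y))"
      using x n dc by (simp add: fs_mat_single[OF assms(1) funcset_mem[OF assms(4)]] fs_mat_single[OF assms(2) funcset_mem[OF assms(4)]]
          mod_hom_closed[OF assms(3)] mod_hom_smult[OF assms(3)])
  qed
qed

lemma fs_mod_sub:
  "g \<in> carrier (fs_mod (N\<lparr>carrier := H\<rparr>) X) \<longleftrightarrow> g \<in> carrier (fs_mod N X) \<and> (\<forall>x. g x \<in> H)"
  if "H \<subseteq> carrier N"
  using that by (auto simp: fs_mod_simps)

lemma fs_mat_sub:
  assumes "module R N" "submodule H R N" "d \<in> X \<rightarrow> carrier (free_mod R Y)"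
    and "g \<in> carrier (fs_mod N X)" "\<And>x. g x \<in> H"
  shows "fs_mat N Y d g y \<in> H" and "fs_mat (N\<lparr>carrier := H\<rparr>) Y d g = fs_mat N Y d g"
proof -
  interpret module R N by fact
  let ?H = "N\<lparr>carrier := H\<rparr>"
  have H: "H \<subseteq> carrier N" using submoduleD(1)[OF assms(2)] by blast
  note mH = submodule.submodule_is_module[OF assms(2,1)]
  have inc: "(\<lambda>x. x) \<in> mod_hom R ?H N" using H by (intro mod_homI) auto
  have g: "g \<in> carrier (fs_mod ?H X)" using assms(4,5) H by (simp add: fs_mod_sub)
  from fs_mat_natural[OF mH assms(1) inc assms(3) g]
  show "fs_mat ?H Y d g = fs_mat N Y d g" by simp
  then show "fs_mat N Y d g y \<in> H"
    using mod_hom_closed[OF fs_mat_hom[OF mH assms(3)] g] by (simp add: fs_mod_simps)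
qed

section \<open>Complexes of free modules with coefficients in a subquotient\<close>

lemma module_ring_as_mod:
  assumes "cring R"
  shows "module R (ring_as_mod R (\<lambda>a. a))"
proof -
  interpret cring R by fact
  show ?thesis
  proof (intro moduleI abelian_groupI assms, goal_cases)
    case (6 a)
    then show ?case by (intro bexI[of _ "\<ominus>\<^bsub>R\<^esub> a"]) (auto simp: ring_as_mod_def l_neg)
  qed (auto simp: ring_as_mod_def a_ac l_distr r_distr m_assoc)
qed

lemma ring_as_mod_simps:
  "carrier (ring_as_mod B \<phi>) = carrier B" "\<zero>\<^bsub>ring_as_mod B \<phi>\<^esub> = \<zero>\<^bsub>B\<^esub>"
  "x \<oplus>\<^bsub>ring_as_mod B \<phi>\<^esub> y = x \<oplus>\<^bsub>B\<^esub> y" "a \<odot>\<^bsub>ring_as_mod B \<phi>\<^esub> x = \<phi> a \<otimes>\<^bsub>B\<^esub> x"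
  by (auto simp: ring_as_mod_def)

lemma ideal_submodule_ring:
  assumes "cring R" "ideal I R"
  shows "submodule I R (ring_as_mod R (\<lambda>a. a))"
proof -
  interpret module R "ring_as_mod R (\<lambda>a. a)" by (rule module_ring_as_mod) fact
  interpret I: ideal I R by fact
  have neg: "\<ominus>\<^bsub>ring_as_mod R (\<lambda>a. a)\<^esub> a = \<ominus>\<^bsub>R\<^esub> a" for a
    by (simp add: a_inv_def ring_as_mod_def m_inv_def)
  show ?thesis
    by (rule submoduleI) (auto simp: ring_as_mod_simps neg I.I_l_closed intro: I.a_Hcarr)
qed

lemma (in module) colon_ideal:
  assumes "submodule K R M" "x \<in> carrier M"
  shows "ideal {a \<in> carrier R. a \<odot>\<^bsub>M\<^esub> x \<in> K} R"
proof -
  note K = submoduleD[OF assms(1)]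
  show ?thesis
  proof (rule idealI[OF R.ring_axioms])
    show "subgroup {a \<in> carrier R. a \<odot>\<^bsub>M\<^esub> x \<in> K} (add_monoid R)"
      using K assms(2)
      by (intro subgroup.intro) (auto simp: smult_l_distr smult_l_minus simp flip: a_inv_def)
    fix a b assume a: "a \<in> {a \<in> carrier R. a \<odot>\<^bsub>M\<^esub> x \<in> K}" and b: "b \<in> carrier R"
    then show "b \<otimes> a \<in> {a \<in> carrier R. a \<odot>\<^bsub>M\<^esub> x \<in> K}"
      using K assms(2) by (auto simp: smult_assoc1)
    then show "a \<otimes> b \<in> {a \<in> carrier R. a \<odot>\<^bsub>M\<^esub> x \<in> K}"
      using a b by (simp add: R.m_comm)
  qed
qed

text \<open>Families lift along a homomorphism value by value; the value \<open>\<zero>\<close> is lifted to \<open>\<zero>\<close> to keep the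
  support finite.\<close>

lemma fs_mod_lift:
  assumes "module R N" "module R Q" "p \<in> mod_hom R N Q" "submodule H R N"
    and "g \<in> carrier (fs_mod Q X)" "\<And>x. g x \<in> p ` H"
  obtains g' where "g' \<in> carrier (fs_mod N X)" "\<And>x. g' x \<in> H" "\<And>x. p (g' x) = g x"
proof -
  interpret N: module R N by fact
  note H = N.submoduleD[OF assms(4)]
  define g' where "g' x = (if g x = \<zero>\<^bsub>Q\<^esub> then \<zero>\<^bsub>N\<^esub> else SOME n. n \<in> H \<and> p n = g x)" for x
  have g': "g' x \<in> H \<and> p (g' x) = g x" for x
  proof (cases "g x = \<zero>\<^bsub>Q\<^esub>")
    case True then show ?thesis using H(2) mod_hom_zero[OF assms(1-3)] by (simp add: g'_def)
  next
    case False
    have "\<exists>n. n \<in> H \<and> p n = g x" using assms(6)[of x] by (auto simp: image_iff)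
    from someI_ex[OF this] show ?thesis using False by (simp add: g'_def)
  qed
  have "{x. g' x \<noteq> \<zero>\<^bsub>N\<^esub>} \<subseteq> {x. g x \<noteq> \<zero>\<^bsub>Q\<^esub>}" by (auto simp: g'_def)
  moreover have "g' x = \<zero>\<^bsub>N\<^esub>" if "x \<notin> X" for x using that assms(5) by (simp add: g'_def fs_mod_simps)
  ultimately have "g' \<in> carrier (fs_mod N X)"
    using g' H(1) assms(5) finite_subset by (auto simp: fs_mod_simps)
  with g' show ?thesis using that by blast
qed

text \<open>The differentials are given by their matrices, so that they act on families with coefficients in any module.\<close>

locale free_complex =
  fixes R :: "('a, 'r) ring_scheme" and X :: "nat \<Rightarrow> 'x set" and d :: "nat \<Rightarrow> 'x \<Rightarrow> 'x \<Rightarrow> 'a"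
  assumes cring: "cring R"
    and d_carrier: "\<And>i. d i \<in> X (Suc i) \<rightarrow> carrier (free_mod R (X i))"
    and d_d: "\<And>i x. x \<in> X (Suc (Suc i)) \<Longrightarrow>
      free_lift R (free_mod R (X i)) (d i) (d (Suc i) x) = \<zero>\<^bsub>free_mod R (X i)\<^esub>"
begin

abbreviation chains :: "('a, 'n, 'q) module_scheme \<Rightarrow> nat \<Rightarrow> ('x \<Rightarrow> 'n) set"
  where "chains N i \<equiv> carrier (fs_mod N (X i))"

abbreviation bd :: "('a, 'n, 'q) module_scheme \<Rightarrow> nat \<Rightarrow> ('x \<Rightarrow> 'n) \<Rightarrow> 'x \<Rightarrow> 'n"
  where "bd N i \<equiv> fs_mat N (X i) (d i)"

text \<open>For submodules \<open>K \<subseteq> H\<close> of \<open>N\<close>, this is exactness in degree \<open>i + 1\<close> of the complex with coefficients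
  in \<open>H / K\<close>; for a free resolution of \<open>M\<close> it says that \<open>Tor\<^bsub>i+1\<^esub> (H / K, M) = 0\<close>. Only positive degrees
  matter, hence the shift. With \<open>N\<close> fixed, filtrations and their quotients are handled without
  changing the type of the coefficients.\<close>

definition rel_exact :: "('a, 'n, 'q) module_scheme \<Rightarrow> 'n set \<Rightarrow> 'n set \<Rightarrow> nat \<Rightarrow> bool"
  where "rel_exact N H K i \<longleftrightarrow>
    (\<forall>g\<in>chains N (Suc i). (\<forall>x. g x \<in> H) \<and> (\<forall>y. bd N i g y \<in> K) \<longrightarrow>
      (\<exists>h\<in>chains N (Suc (Suc i)). (\<forall>x. h x \<in> H) \<and> (\<forall>x. g x \<ominus>\<^bsub>N\<^esub> bd N (Suc i) h x \<in> K)))"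

lemma rel_exactI:
  assumes "\<And>g. g \<in> chains N (Suc i) \<Longrightarrow> (\<And>x. g x \<in> H) \<Longrightarrow> (\<And>y. bd N i g y \<in> K) \<Longrightarrow>
    \<exists>h\<in>chains N (Suc (Suc i)). (\<forall>x. h x \<in> H) \<and> (\<forall>x. g x \<ominus>\<^bsub>N\<^esub> bd N (Suc i) h x \<in> K)"
  shows "rel_exact N H K i"
  using assms unfolding rel_exact_def by blast

lemma rel_exactE:
  assumes "rel_exact N H K i" "g \<in> chains N (Suc i)" "\<And>x. g x \<in> H" "\<And>y. bd N i g y \<in> K"
  obtains h where "h \<in> chains N (Suc (Suc i))" "\<And>x. h x \<in> H" "\<And>x. g x \<ominus>\<^bsub>N\<^esub> bd N (Suc i) h x \<in> K"
  using assms unfolding rel_exact_def by blast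

lemma bd_hom: "module R N \<Longrightarrow> bd N i \<in> mod_hom R (fs_mod N (X (Suc i))) (fs_mod N (X i))"
  by (rule fs_mat_hom[OF _ d_carrier])

lemma bd_chain: "module R N \<Longrightarrow> g \<in> chains N (Suc i) \<Longrightarrow> bd N i g \<in> chains N i"
  by (rule mod_hom_closed[OF bd_hom])

lemma chain_diff:
  assumes "module R N" "g \<in> chains N i" "h \<in> chains N i"
  shows "(\<lambda>x. g x \<ominus>\<^bsub>N\<^esub> h x) \<in> chains N i"
proof -
  interpret F: module R "fs_mod N (X i)" by (rule module_fs_mod) fact
  show ?thesis using F.M.minus_closed[OF assms(2,3)] by (simp add: fs_mod_diff[OF assms])
qed

lemma bd_diff:
  assumes "module R N" "g \<in> chains N (Suc i)" "h \<in> chains N (Suc i)"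
  shows "bd N i (\<lambda>x. g x \<ominus>\<^bsub>N\<^esub> h x) = (\<lambda>y. bd N i g y \<ominus>\<^bsub>N\<^esub> bd N i h y)"
  using mod_hom_diff[OF module_fs_mod[OF assms(1)] module_fs_mod[OF assms(1)] bd_hom[OF assms(1)] assms(2,3)]
  by (simp add: fs_mod_diff[OF assms] fs_mod_diff[OF assms(1) bd_chain[OF assms(1,2)] bd_chain[OF assms(1,3)]])

lemma bd_add:
  assumes "module R N" "g \<in> chains N (Suc i)" "h \<in> chains N (Suc i)"
  shows "bd N i (\<lambda>x. g x \<oplus>\<^bsub>N\<^esub> h x) = (\<lambda>y. bd N i g y \<oplus>\<^bsub>N\<^esub> bd N i h y)"
  using mod_hom_add[OF bd_hom[OF assms(1)] assms(2,3)] by (simp add: fs_mod_simps)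

lemma chain_add:
  assumes "module R N" "g \<in> chains N i" "h \<in> chains N i"
  shows "(\<lambda>x. g x \<oplus>\<^bsub>N\<^esub> h x) \<in> chains N i"
proof -
  interpret F: module R "fs_mod N (X i)" by (rule module_fs_mod) fact
  show ?thesis using F.M.a_closed[OF assms(2,3)] by (simp add: fs_mod_simps(3))
qed

lemma bd_zero: "module R N \<Longrightarrow> bd N i (\<lambda>_. \<zero>\<^bsub>N\<^esub>) = (\<lambda>_. \<zero>\<^bsub>N\<^esub>)"
  using mod_hom_zero[OF module_fs_mod module_fs_mod bd_hom] by (simp add: fs_mod_simps)

lemma chain_zero: "module R N \<Longrightarrow> (\<lambda>_. \<zero>\<^bsub>N\<^esub>) \<in> chains N i"
  using abelian_monoid.zero_closed[OF abelian_group.axioms(1)[OF module.axioms(2)[OF module_fs_mod]]]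
  by (simp add: fs_mod_simps(2))

lemma chain_carrier: "g \<in> chains N i \<Longrightarrow> g x \<in> carrier N"
  by (simp add: fs_mod_simps)

lemma bd_natural:
  assumes "module R N" "module R Q" "p \<in> mod_hom R N Q" "g \<in> chains N (Suc i)"
  shows "bd Q i (\<lambda>x. p (g x)) = (\<lambda>y. p (bd N i g y))"
  by (rule fs_mat_natural[OF assms(1-3) d_carrier assms(4)])

lemma bd_sub:
  assumes "module R N" "submodule H R N" "g \<in> chains N (Suc i)" "\<And>x. g x \<in> H"
  shows "bd N i g y \<in> H"
  by (rule fs_mat_sub(1)[OF assms(1,2) d_carrier assms(3,4)])

lemma bd_bd:
  assumes "module R N" "g \<in> chains N (Suc (Suc i))"
  shows "bd N i (bd N (Suc i) g) = (\<lambda>_. \<zero>\<^bsub>N\<^esub>)"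
proof (rule fs_hom_eqI[OF assms(1) module_fs_mod[OF assms(1)] mod_hom_compose[OF bd_hom bd_hom] _ _ assms(2)])
  interpret module R N by fact
  interpret F: module R "fs_mod N (X i)" by (rule module_fs_mod) fact
  show "(\<lambda>u _. \<zero>\<^bsub>N\<^esub>) \<in> mod_hom R (fs_mod N (X (Suc (Suc i)))) (fs_mod N (X i))"
    by (rule mod_homI) (auto simp: fs_mod_simps)
  fix x n assume x: "x \<in> X (Suc (Suc i))" and n: "n \<in> carrier N"
  note dx = funcset_mem[OF d_carrier x]
  have "bd N i (bd N (Suc i) (fs_single N x n)) = (\<lambda>y. free_lift R (free_mod R (X i)) (d i) (d (Suc i) x) y \<odot>\<^bsub>N\<^esub> n)"
    by (simp add: fs_mat_single[where d = "d (Suc i)" and x = x, OF assms(1) dx n] fs_mat_scale[OF assms(1) d_carrier dx n])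
  then show "bd N i (bd N (Suc i) (fs_single N x n)) = (\<lambda>_. \<zero>\<^bsub>N\<^esub>)"
    using n by (simp add: d_d[OF x] free_mod_simps)
qed (use assms in auto)

text \<open>The middle term of the long exact sequence of \<open>0 \<rightarrow> K/L \<rightarrow> H/L \<rightarrow> H/K \<rightarrow> 0\<close>: correct a cycle modulo
  \<open>L\<close> by a boundary so that it takes values in \<open>K\<close>, then correct it there.\<close>

lemma rel_exact_extension:
  assumes N: "module R N" and sub: "submodule H R N" "submodule K R N" "submodule L R N"
    and "L \<subseteq> K" "K \<subseteq> H" and "rel_exact N H K i" "rel_exact N K L i"
  shows "rel_exact N H L i"
proof (rule rel_exactI)
  interpret module R N by fact
  fix g assume g: "g \<in> chains N (Suc i)" "\<And>x. g x \<in> H" "\<And>y. bd N i g y \<in> L"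
  have "bd N i g y \<in> K" for y using g(3) \<open>L \<subseteq> K\<close> by blast
  note cyc = this
  obtain h where h: "h \<in> chains N (Suc (Suc i))" "\<And>x. h x \<in> H" "\<And>x. g x \<ominus>\<^bsub>N\<^esub> bd N (Suc i) h x \<in> K"
      by (rule rel_exactE[OF assms(7) g(1,2) cyc]) blast
  note bh = bd_chain[OF N h(1)]
  have bg: "bd N i g y \<in> carrier N" for y using chain_carrier[OF bd_chain[OF N g(1)]] .
  have "bd N i (\<lambda>x. g x \<ominus>\<^bsub>N\<^esub> bd N (Suc i) h x) y = bd N i g y" for y
    using bg by (simp add: bd_diff[OF N g(1) bh] bd_bd[OF N h(1)] M.diff_zero)
  then have "bd N i (\<lambda>x. g x \<ominus>\<^bsub>N\<^esub> bd N (Suc i) h x) y \<in> L" for y using g(3) by simp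
  note cyc = this
  obtain k where k: "k \<in> chains N (Suc (Suc i))" "\<And>x. k x \<in> K"
    "\<And>x. (g x \<ominus>\<^bsub>N\<^esub> bd N (Suc i) h x) \<ominus>\<^bsub>N\<^esub> bd N (Suc i) k x \<in> L"
      by (rule rel_exactE[OF assms(8) chain_diff[OF N g(1) bh] h(3) cyc]) blast
  have "g x \<ominus>\<^bsub>N\<^esub> bd N (Suc i) (\<lambda>x. h x \<oplus>\<^bsub>N\<^esub> k x) x =
      (g x \<ominus>\<^bsub>N\<^esub> bd N (Suc i) h x) \<ominus>\<^bsub>N\<^esub> bd N (Suc i) k x" for x
    using chain_carrier[OF g(1)] chain_carrier[OF bh] chain_carrier[OF bd_chain[OF N k(1)]]
    by (simp add: bd_add[OF N h(1) k(1)] a_minus_def M.minus_add M.a_assoc)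
  moreover have "h x \<oplus>\<^bsub>N\<^esub> k x \<in> H" for x
    using submoduleD(3)[OF sub(1) h(2)] k(2) \<open>K \<subseteq> H\<close> by blast
  ultimately show "\<exists>h\<in>chains N (Suc (Suc i)). (\<forall>x. h x \<in> H) \<and> (\<forall>x. g x \<ominus>\<^bsub>N\<^esub> bd N (Suc i) h x \<in> L)"
    using chain_add[OF N h(1) k(1)] k(3)
    by (intro bexI[of _ "\<lambda>x. h x \<oplus>\<^bsub>N\<^esub> k x"]) auto
qed

text \<open>Dimension shifting in the same sequence. The boundary of a cycle modulo \<open>K\<close> is a cycle with values
  in \<open>K\<close>; subtracting a family in \<open>K\<close> with the same boundary modulo \<open>L\<close> leaves a cycle modulo \<open>L\<close>.\<close>

lemma rel_exact_shift:
  assumes N: "module R N" and sub: "submodule H R N" "submodule K R N" "submodule L R N"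
    and "L \<subseteq> K" "K \<subseteq> H" and "rel_exact N K L i" "rel_exact N H L (Suc i)"
  shows "rel_exact N H K (Suc i)"
proof (rule rel_exactI)
  interpret module R N by fact
  fix g assume g: "g \<in> chains N (Suc (Suc i))" "\<And>x. g x \<in> H" "\<And>y. bd N (Suc i) g y \<in> K"
  have "bd N i (bd N (Suc i) g) y \<in> L" for y
    using submoduleD(2)[OF sub(3)] by (simp add: bd_bd[OF N g(1)])
  note cyc = this
  obtain h where h: "h \<in> chains N (Suc (Suc i))" "\<And>x. h x \<in> K"
    "\<And>x. bd N (Suc i) g x \<ominus>\<^bsub>N\<^esub> bd N (Suc i) h x \<in> L"
      by (rule rel_exactE[OF assms(7) bd_chain[OF N g(1)] g(3) cyc]) blast
  have 1: "g x \<ominus>\<^bsub>N\<^esub> h x \<in> H" for x using g(2) h(2) \<open>K \<subseteq> H\<close> submoduleD(5)[OF sub(1)] by blast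
  have 2: "bd N (Suc i) (\<lambda>x. g x \<ominus>\<^bsub>N\<^esub> h x) y \<in> L" for y using h(3) by (simp add: bd_diff[OF N g(1) h(1)])
  obtain k where k: "k \<in> chains N (Suc (Suc (Suc i)))" "\<And>x. k x \<in> H"
    "\<And>x. (g x \<ominus>\<^bsub>N\<^esub> h x) \<ominus>\<^bsub>N\<^esub> bd N (Suc (Suc i)) k x \<in> L"
      by (rule rel_exactE[OF assms(8) chain_diff[OF N g(1) h(1)] 1 2]) blast
  have "g x \<ominus>\<^bsub>N\<^esub> bd N (Suc (Suc i)) k x \<in> K" for x
  proof -
    have "((g x \<ominus>\<^bsub>N\<^esub> h x) \<ominus>\<^bsub>N\<^esub> bd N (Suc (Suc i)) k x) \<oplus>\<^bsub>N\<^esub> h x = g x \<ominus>\<^bsub>N\<^esub> bd N (Suc (Suc i)) k x"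
      by (rule M.diff_swap[OF chain_carrier[OF g(1)] chain_carrier[OF h(1)] chain_carrier[OF bd_chain[OF N k(1)]]])
    then show ?thesis using submoduleD(3)[OF sub(2) subsetD[OF \<open>L \<subseteq> K\<close> k(3)[of x]] h(2)[of x]] by simp
  qed
  then show "\<exists>h\<in>chains N (Suc (Suc (Suc i))).
      (\<forall>x. h x \<in> H) \<and> (\<forall>x. g x \<ominus>\<^bsub>N\<^esub> bd N (Suc (Suc i)) h x \<in> K)"
    using k(1,2) by blast
qed

text \<open>Here \<open>H / K\<close> is cyclic, generated by \<open>n\<close>, hence isomorphic to the quotient of the ring by the colon
  ideal. Cycles are transported along \<open>a \<mapsto> a \<odot> n\<close>, with the ring as the module of coefficients.\<close>

lemma rel_exact_cyclic:
  assumes N: "module R N" and K: "submodule K R N" and n: "n \<in> carrier N"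
    and "rel_exact (ring_as_mod R (\<lambda>a. a)) (carrier R) {a \<in> carrier R. a \<odot>\<^bsub>N\<^esub> n \<in> K} i"
  defines "H \<equiv> {k \<oplus>\<^bsub>N\<^esub> a \<odot>\<^bsub>N\<^esub> n | k a. k \<in> K \<and> a \<in> carrier R}"
  shows "rel_exact N H K i"
proof (rule rel_exactI)
  interpret module R N by fact
  note K' = submoduleD[OF K]
  let ?A = "ring_as_mod R (\<lambda>a. a)"
  note A = module_ring_as_mod[OF cring]
  have hom: "(\<lambda>a. a \<odot>\<^bsub>N\<^esub> n) \<in> mod_hom R ?A N"
    using n by (intro mod_homI) (auto simp: ring_as_mod_simps smult_l_distr smult_assoc1)
  fix g assume g: "g \<in> chains N (Suc i)" "\<And>x. g x \<in> H" "\<And>y. bd N i g y \<in> K"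
  \<comment> \<open>The last conjunct makes the chosen coefficients vanish where \<open>g\<close> does, for a finite support.\<close>
  have "\<forall>x. \<exists>a. a \<in> carrier R \<and> g x \<ominus>\<^bsub>N\<^esub> a \<odot>\<^bsub>N\<^esub> n \<in> K \<and> (g x = \<zero>\<^bsub>N\<^esub> \<longrightarrow> a = \<zero>\<^bsub>R\<^esub>)"
  proof
    fix x
    obtain k a where ka: "k \<in> K" "a \<in> carrier R" "g x = k \<oplus>\<^bsub>N\<^esub> a \<odot>\<^bsub>N\<^esub> n" using g(2) unfolding H_def by blast
    show "\<exists>a. a \<in> carrier R \<and> g x \<ominus>\<^bsub>N\<^esub> a \<odot>\<^bsub>N\<^esub> n \<in> K \<and> (g x = \<zero>\<^bsub>N\<^esub> \<longrightarrow> a = \<zero>\<^bsub>R\<^esub>)"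
    proof (cases "g x = \<zero>\<^bsub>N\<^esub>")
      case True
      then show ?thesis using n K'(2) by (intro exI[of _ "\<zero>\<^bsub>R\<^esub>"]) (simp add: M.diff_zero)
    next
      case False
      have "(k \<oplus>\<^bsub>N\<^esub> a \<odot>\<^bsub>N\<^esub> n) \<ominus>\<^bsub>N\<^esub> a \<odot>\<^bsub>N\<^esub> n = k"
        using n ka(1,2) K'(1) by (simp add: a_minus_def M.a_assoc M.r_neg)
      then show ?thesis using ka False by (intro exI[of _ a]) simp
    qed
  qed
  then obtain a where a: "\<And>x. a x \<in> carrier R" "\<And>x. g x \<ominus>\<^bsub>N\<^esub> a x \<odot>\<^bsub>N\<^esub> n \<in> K"
    "\<And>x. g x = \<zero>\<^bsub>N\<^esub> \<Longrightarrow> a x = \<zero>\<^bsub>R\<^esub>" by metis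
  have "{x. a x \<noteq> \<zero>\<^bsub>R\<^esub>} \<subseteq> {x. g x \<noteq> \<zero>\<^bsub>N\<^esub>}" using a(3) by auto
  then have ac: "a \<in> chains ?A (Suc i)"
    using a g(1) finite_subset by (auto simp: fs_mod_simps ring_as_mod_simps)
  have an: "(\<lambda>x. a x \<odot>\<^bsub>N\<^esub> n) \<in> chains N (Suc i)" by (rule mod_hom_closed[OF fs_map_hom[OF A N hom] ac])
  have ban: "bd N i (\<lambda>x. a x \<odot>\<^bsub>N\<^esub> n) = (\<lambda>y. bd ?A i a y \<odot>\<^bsub>N\<^esub> n)" by (rule bd_natural[OF A N hom ac])
  have bac: "bd ?A i a y \<in> carrier R" for y
    using chain_carrier[OF bd_chain[OF A ac]] by (simp add: ring_as_mod_simps)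
  have "bd ?A i a y \<odot>\<^bsub>N\<^esub> n \<in> K" for y
  proof -
    have "bd N i (\<lambda>x. g x \<ominus>\<^bsub>N\<^esub> a x \<odot>\<^bsub>N\<^esub> n) y \<in> K" by (rule bd_sub[OF N K chain_diff[OF N g(1) an] a(2)])
    then have "bd N i g y \<ominus>\<^bsub>N\<^esub> (bd N i g y \<ominus>\<^bsub>N\<^esub> bd ?A i a y \<odot>\<^bsub>N\<^esub> n) \<in> K"
      using K'(5)[OF g(3)] by (simp add: bd_diff[OF N g(1) an] ban)
    then show ?thesis using K'(1)[OF g(3)] bac n
      by (simp add: a_minus_def M.minus_add M.r_neg2)
  qed
  then have "bd ?A i a y \<in> {a \<in> carrier R. a \<odot>\<^bsub>N\<^esub> n \<in> K}" for y using bac by blast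
  note cyc = this
  obtain b where b: "b \<in> chains ?A (Suc (Suc i))"
    "\<And>x. b x \<in> carrier R" "\<And>x. a x \<ominus>\<^bsub>?A\<^esub> bd ?A (Suc i) b x \<in> {a \<in> carrier R. a \<odot>\<^bsub>N\<^esub> n \<in> K}"
      by (rule rel_exactE[OF assms(4) ac a(1) cyc]) blast
  note bb = bd_chain[OF A b(1)]
  have "g x \<ominus>\<^bsub>N\<^esub> bd N (Suc i) (\<lambda>x. b x \<odot>\<^bsub>N\<^esub> n) x \<in> K" for x
  proof -
    have bbc: "bd ?A (Suc i) b x \<in> carrier ?A" using chain_carrier[OF bb] .
    have "a x \<odot>\<^bsub>N\<^esub> n \<ominus>\<^bsub>N\<^esub> bd ?A (Suc i) b x \<odot>\<^bsub>N\<^esub> n \<in> K"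
      using b(3)[of x] mod_hom_diff[OF A N hom chain_carrier[OF ac] bbc, of x] by simp
    then have "(g x \<ominus>\<^bsub>N\<^esub> a x \<odot>\<^bsub>N\<^esub> n) \<oplus>\<^bsub>N\<^esub> (a x \<odot>\<^bsub>N\<^esub> n \<ominus>\<^bsub>N\<^esub> bd ?A (Suc i) b x \<odot>\<^bsub>N\<^esub> n) \<in> K"
      using K'(3)[OF a(2)] by blast
    then show ?thesis
      using M.diff_add_diff[OF chain_carrier[OF g(1), of x] chain_carrier[OF an, of x]
          mod_hom_closed[OF hom bbc]]
      by (simp add: bd_natural[OF A N hom b(1)])
  qed
  moreover have "b x \<odot>\<^bsub>N\<^esub> n \<in> H" for x
  proof -
    have "\<zero>\<^bsub>N\<^esub> \<oplus>\<^bsub>N\<^esub> b x \<odot>\<^bsub>N\<^esub> n \<in> H" unfolding H_def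
      by (rule CollectI, rule exI[of _ "\<zero>\<^bsub>N\<^esub>"], rule exI[of _ "b x"]) (simp add: b(2) K'(2))
    then show ?thesis using b(2)[of x] n by simp
  qed
  ultimately show "\<exists>h\<in>chains N (Suc (Suc i)). (\<forall>x. h x \<in> H) \<and> (\<forall>x. g x \<ominus>\<^bsub>N\<^esub> bd N (Suc i) h x \<in> K)"
    by (intro bexI[OF _ mod_hom_closed[OF fs_map_hom[OF A N hom] b(1)]] conjI allI)
qed

text \<open>Tor commutes with directed unions, as a family takes finitely many values.\<close>

lemma rel_exact_directed:
  assumes "\<And>S. finite S \<Longrightarrow> S \<subseteq> H \<Longrightarrow> \<exists>H'. S \<subseteq> H' \<and> H' \<subseteq> H \<and> rel_exact N H' K i"
  shows "rel_exact N H K i"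
proof (rule rel_exactI)
  fix g assume g: "g \<in> chains N (Suc i)" "\<And>x. g x \<in> H" "\<And>y. bd N i g y \<in> K"
  have "range g \<subseteq> insert \<zero>\<^bsub>N\<^esub> (g ` {x. g x \<noteq> \<zero>\<^bsub>N\<^esub>})" by auto
  then have "finite (range g)" by (rule finite_subset) (use g(1) in \<open>simp add: fs_mod_simps\<close>)
  moreover have "range g \<subseteq> H" using g(2) by (rule image_subsetI)
  ultimately obtain H' where H': "range g \<subseteq> H'" "H' \<subseteq> H" "rel_exact N H' K i" using assms by metis
  have "g x \<in> H'" for x using subsetD[OF H'(1)] by simp
  then obtain h where h: "h \<in> chains N (Suc (Suc i))" "\<And>x. h x \<in> H'"
    "\<And>x. g x \<ominus>\<^bsub>N\<^esub> bd N (Suc i) h x \<in> K"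
    by (rule rel_exactE[OF H'(3) g(1) _ g(3)]) blast
  then show "\<exists>h\<in>chains N (Suc (Suc i)). (\<forall>x. h x \<in> H) \<and> (\<forall>x. g x \<ominus>\<^bsub>N\<^esub> bd N (Suc i) h x \<in> K)"
    by (intro bexI[of _ h] conjI allI subsetD[OF H'(2)])
qed

lemma rel_exact_refl:
  assumes N: "module R N" and K: "submodule K R N"
  shows "rel_exact N K K i"
proof (rule rel_exactI)
  interpret module R N by fact
  fix g assume g: "g \<in> chains N (Suc i)" "\<And>x. g x \<in> K"
  have "g x \<ominus>\<^bsub>N\<^esub> bd N (Suc i) (\<lambda>_. \<zero>\<^bsub>N\<^esub>) x \<in> K" for x
    using g(2) submoduleD(1)[OF K g(2)] by (simp add: bd_zero[OF N] M.diff_zero)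
  then show "\<exists>h\<in>chains N (Suc (Suc i)). (\<forall>x. h x \<in> K) \<and> (\<forall>x. g x \<ominus>\<^bsub>N\<^esub> bd N (Suc i) h x \<in> K)"
    using submoduleD(2)[OF K] by (intro bexI[OF _ chain_zero[OF N]] conjI allI)
qed

text \<open>Adding the elements of a finite set one at a time to \<open>K\<close> yields cyclic quotients.\<close>

lemma rel_exact_cyclic_filtration:
  assumes N: "module R N" and H: "submodule H R N" and K: "submodule K R N" and "K \<subseteq> H"
    and cyc: "\<And>L n. submodule L R N \<Longrightarrow> K \<subseteq> L \<Longrightarrow> n \<in> H \<Longrightarrow>
      rel_exact (ring_as_mod R (\<lambda>a. a)) (carrier R) {a \<in> carrier R. a \<odot>\<^bsub>N\<^esub> n \<in> L} i"
  shows "rel_exact N H K i"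
proof (rule rel_exact_directed)
  interpret module R N by fact
  note H' = submoduleD[OF H]
  fix S assume "finite S" "S \<subseteq> H"
  then have "\<exists>L. submodule L R N \<and> K \<subseteq> L \<and> S \<subseteq> L \<and> L \<subseteq> H \<and> rel_exact N L K i"
  proof (induction S rule: finite_induct)
    case empty
    then show ?case using K rel_exact_refl[OF N K] \<open>K \<subseteq> H\<close> by blast
  next
    case (insert n S)
    then obtain L where L: "submodule L R N" "K \<subseteq> L" "S \<subseteq> L" "L \<subseteq> H" "rel_exact N L K i" by auto
    note L' = submoduleD[OF L(1)]
    have nH: "n \<in> H" using insert.prems by simp
    then have n: "n \<in> carrier N" using H'(1) by blast
    let ?L = "{k \<oplus>\<^bsub>N\<^esub> a \<odot>\<^bsub>N\<^esub> n | k a. k \<in> L \<and> a \<in> carrier R}"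
    have mem: "k \<oplus>\<^bsub>N\<^esub> a \<odot>\<^bsub>N\<^esub> n \<in> ?L" if "k \<in> L" "a \<in> carrier R" for k a
      using that by (intro CollectI exI conjI) (rule refl)
    have LL: "l \<in> ?L" if "l \<in> L" for l
      using that L'(1)[OF that] n
      by (intro CollectI exI[of _ l] exI[of _ "\<zero>\<^bsub>R\<^esub>"] conjI) simp_all
    have nL: "n \<in> ?L"
      using L'(2) n by (intro CollectI exI[of _ "\<zero>\<^bsub>N\<^esub>"] exI[of _ "\<one>\<^bsub>R\<^esub>"] conjI) simp_all
    have sub: "submodule ?L R N"
    proof (rule submoduleI)
      show "?L \<subseteq> carrier N" using L'(1) n by auto
      show "\<zero>\<^bsub>N\<^esub> \<in> ?L" by (rule LL[OF L'(2)])
      fix u assume "u \<in> ?L"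
      then obtain k a where u: "k \<in> L" "a \<in> carrier R" "u = k \<oplus>\<^bsub>N\<^esub> a \<odot>\<^bsub>N\<^esub> n" by blast
      have "\<ominus>\<^bsub>N\<^esub> u = \<ominus>\<^bsub>N\<^esub> k \<oplus>\<^bsub>N\<^esub> (\<ominus>\<^bsub>R\<^esub> a) \<odot>\<^bsub>N\<^esub> n"
        using u n L'(1) by (simp add: M.minus_add smult_l_minus)
      then show "\<ominus>\<^bsub>N\<^esub> u \<in> ?L" using mem[OF L'(4)[OF u(1)] R.a_inv_closed[OF u(2)]] by (simp only:)
      show "b \<odot>\<^bsub>N\<^esub> u \<in> ?L" if b: "b \<in> carrier R" for b
      proof -
        have "b \<odot>\<^bsub>N\<^esub> u = b \<odot>\<^bsub>N\<^esub> k \<oplus>\<^bsub>N\<^esub> (b \<otimes>\<^bsub>R\<^esub> a) \<odot>\<^bsub>N\<^esub> n"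
          using u n b L'(1) by (simp add: smult_r_distr smult_assoc1)
        then show ?thesis using mem[OF L'(6)[OF b u(1)] R.m_closed[OF b u(2)]] by (simp only:)
      qed
      fix v assume "v \<in> ?L"
      then obtain l b where v: "l \<in> L" "b \<in> carrier R" "v = l \<oplus>\<^bsub>N\<^esub> b \<odot>\<^bsub>N\<^esub> n" by blast
      have "u \<oplus>\<^bsub>N\<^esub> v = (k \<oplus>\<^bsub>N\<^esub> l) \<oplus>\<^bsub>N\<^esub> (a \<oplus>\<^bsub>R\<^esub> b) \<odot>\<^bsub>N\<^esub> n"
        using u v n L'(1) by (simp add: smult_l_distr M.a_ac)
      then show "u \<oplus>\<^bsub>N\<^esub> v \<in> ?L"
        using mem[OF L'(3)[OF u(1) v(1)] R.a_closed[OF u(2) v(2)]] by (simp only:)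
    qed
    have "k \<oplus>\<^bsub>N\<^esub> a \<odot>\<^bsub>N\<^esub> n \<in> H" if "k \<in> L" "a \<in> carrier R" for k a
      using H'(3)[OF subsetD[OF L(4) that(1)] H'(6)[OF that(2) nH]] .
    then have "?L \<subseteq> H" by blast
    moreover have "rel_exact N ?L K i"
      by (rule rel_exact_extension[OF N sub L(1) K L(2) _ rel_exact_cyclic[OF N L(1) n cyc[OF L(1,2) nH]] L(5)])
        (use LL in auto)
    moreover have "L \<subseteq> ?L" using LL by (rule subsetI)
    then have "K \<subseteq> ?L" "insert n S \<subseteq> ?L" using L(2,3) nL by simp_all
    ultimately show ?case using sub by (intro exI[of _ ?L] conjI)
  qed
  then show "\<exists>H'. S \<subseteq> H' \<and> H' \<subseteq> H \<and> rel_exact N H' K i" by blast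
qed

text \<open>Relative exactness depends only on the quotient, whatever module represents it.\<close>

lemma rel_exact_quotient:
  assumes N: "module R N" and Q: "module R Q" and p: "p \<in> mod_hom R N Q" "p ` carrier N = carrier Q"
  shows "rel_exact Q (carrier Q) {\<zero>\<^bsub>Q\<^esub>} i \<longleftrightarrow>
    rel_exact N (carrier N) {n \<in> carrier N. p n = \<zero>\<^bsub>Q\<^esub>} i" (is "?L \<longleftrightarrow> ?R")
proof
  interpret N: module R N by fact
  interpret Q: module R Q by fact
  note lift = fs_mod_lift[OF N Q p(1) N.carrier_is_submodule, unfolded p(2)]
  note map = mod_hom_closed[OF fs_map_hom[OF N Q p(1)]]
  note diff = mod_hom_diff[OF N Q p(1)]
  {
    assume L: ?L
    show ?R
    proof (rule rel_exactI)
      fix g assume g: "g \<in> chains N (Suc i)" "\<And>y. bd N i g y \<in> {n \<in> carrier N. p n = \<zero>\<^bsub>Q\<^esub>}"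
      have 1: "p (g x) \<in> carrier Q" for x using chain_carrier[OF map[OF g(1)]] .
      have 2: "bd Q i (\<lambda>x. p (g x)) y \<in> {\<zero>\<^bsub>Q\<^esub>}" for y using g(2) by (simp add: bd_natural[OF N Q p(1) g(1)])
      obtain h where h: "h \<in> chains Q (Suc (Suc i))"
        "\<And>x. h x \<in> carrier Q" "\<And>x. p (g x) \<ominus>\<^bsub>Q\<^esub> bd Q (Suc i) h x \<in> {\<zero>\<^bsub>Q\<^esub>}"
      by (rule rel_exactE[OF L map[OF g(1)] 1 2]) blast
      obtain h' where h': "h' \<in> chains N (Suc (Suc i))" "\<And>x. h' x \<in> carrier N"
        "\<And>x. p (h' x) = h x"
      by (rule lift[OF h(1,2)]) blast
      have "bd Q (Suc i) h x = p (bd N (Suc i) h' x)" for x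
        using fun_cong[OF bd_natural[OF N Q p(1) h'(1)]] h'(3) by simp
      then have "g x \<ominus>\<^bsub>N\<^esub> bd N (Suc i) h' x \<in> {n \<in> carrier N. p n = \<zero>\<^bsub>Q\<^esub>}" for x
        using h(3) chain_carrier[OF g(1)] chain_carrier[OF bd_chain[OF N h'(1)]] by (simp add: diff)
      then show "\<exists>h\<in>chains N (Suc (Suc i)). (\<forall>x. h x \<in> carrier N) \<and>
          (\<forall>x. g x \<ominus>\<^bsub>N\<^esub> bd N (Suc i) h x \<in> {n \<in> carrier N. p n = \<zero>\<^bsub>Q\<^esub>})"
        using h'(2) by (intro bexI[OF _ h'(1)] conjI allI)
    qed
  next
    assume R: ?R
    show ?L
    proof (rule rel_exactI)
      fix g assume g: "g \<in> chains Q (Suc i)" "\<And>x. g x \<in> carrier Q" "\<And>y. bd Q i g y \<in> {\<zero>\<^bsub>Q\<^esub>}"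
      obtain g' where g': "g' \<in> chains N (Suc i)" "\<And>x. g' x \<in> carrier N"
        "\<And>x. p (g' x) = g x"
      by (rule lift[OF g(1,2)]) blast
      have "p (bd N i g' y) = \<zero>\<^bsub>Q\<^esub>" for y
        using fun_cong[OF bd_natural[OF N Q p(1) g'(1)]] g'(3) g(3) by simp
      then have "bd N i g' y \<in> {n \<in> carrier N. p n = \<zero>\<^bsub>Q\<^esub>}" for y
        using chain_carrier[OF bd_chain[OF N g'(1)]] by simp
      note cyc' = this
      obtain h where h: "h \<in> chains N (Suc (Suc i))"
        "\<And>x. h x \<in> carrier N"
        "\<And>x. g' x \<ominus>\<^bsub>N\<^esub> bd N (Suc i) h x \<in> {n \<in> carrier N. p n = \<zero>\<^bsub>Q\<^esub>}"
      by (rule rel_exactE[OF R g'(1,2) cyc']) blast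
      have "g x \<ominus>\<^bsub>Q\<^esub> bd Q (Suc i) (\<lambda>x. p (h x)) x \<in> {\<zero>\<^bsub>Q\<^esub>}" for x
        using h(3)[of x] g'(2)[of x] chain_carrier[OF bd_chain[OF N h(1)], of x]
        by (simp add: bd_natural[OF N Q p(1) h(1)] diff g'(3))
      then show "\<exists>h\<in>chains Q (Suc (Suc i)). (\<forall>x. h x \<in> carrier Q) \<and>
          (\<forall>x. g x \<ominus>\<^bsub>Q\<^esub> bd Q (Suc i) h x \<in> {\<zero>\<^bsub>Q\<^esub>})"
        using chain_carrier[OF map[OF h(1)]] by (intro bexI[OF _ map[OF h(1)]] conjI allI)
    qed
  }
qed

end

section \<open>Acyclicity with torsion coefficients\<close>

lemma ideal_pow_simps:
  "ideal_pow R I 0 = carrier R" "ideal_pow R I (Suc n) = ideal_prod R (ideal_pow R I n) I"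
  by (simp_all add: ideal_pow_def ideals_set_def)

lemma ideal_ideal_pow:
  assumes "cring R" "ideal I R"
  shows "ideal (ideal_pow R I n) R"
proof -
  interpret cring R by fact
  show ?thesis by (induction n) (simp_all add: ideal_pow_simps oneideal ideal_prod_is_ideal assms(2))
qed

lemma ideal_pow_1:
  assumes "cring R" "ideal I R"
  shows "ideal_pow R I (Suc 0) = I"
proof -
  interpret cring R by fact
  show ?thesis using ideal_prod_one[OF assms(2)] ideal_prod_commute[OF oneideal assms(2)]
    by (simp add: ideal_pow_simps)
qed

context free_complex
begin

abbreviation RR where "RR \<equiv> ring_as_mod R (\<lambda>a. a)"

text \<open>The colon ideals of elements of a module killed by \<open>J\<close> contain \<open>J\<close>, so the cyclic quotients in a
  filtration are of the form \<open>R / I\<close> with \<open>J \<subseteq> I\<close>.\<close>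

lemma rel_exact_killed:
  assumes a: "\<And>I. ideal I R \<Longrightarrow> J \<subseteq> I \<Longrightarrow> rel_exact RR (carrier R) I i"
    and J: "ideal J R"
    and N: "module R N" and H: "submodule H R N" and K: "submodule K R N" "K \<subseteq> H"
    and JH: "\<And>a n. a \<in> J \<Longrightarrow> n \<in> H \<Longrightarrow> a \<odot>\<^bsub>N\<^esub> n \<in> K"
  shows "rel_exact N H K i"
proof (rule rel_exact_cyclic_filtration[OF N H K])
  interpret module R N by fact
  fix L n assume L: "submodule L R N" "K \<subseteq> L" and n: "n \<in> H"
  show "rel_exact RR (carrier R) {a \<in> carrier R. a \<odot>\<^bsub>N\<^esub> n \<in> L} i"
  proof (rule a)
    show "ideal {a \<in> carrier R. a \<odot>\<^bsub>N\<^esub> n \<in> L} R" by (rule colon_ideal[OF L(1) submoduleD(1)[OF H n]])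
    show "J \<subseteq> {a \<in> carrier R. a \<odot>\<^bsub>N\<^esub> n \<in> L}"
      using JH[OF _ n] L(2) additive_subgroup.a_subset[OF ideal.axioms(1)[OF J]] by auto
  qed
qed

text \<open>The induction that raises the degree from \<open>1\<close>: apply the shift to \<open>J \<subseteq> I \<subseteq> R\<close>, where \<open>I / J\<close> is
  killed by \<open>J\<close> and therefore covered by the induction hypothesis.\<close>

lemma rel_exact_ideals:
  assumes J: "ideal J R" and e: "\<And>i. rel_exact RR (carrier R) J i"
    and f: "\<And>I. ideal I R \<Longrightarrow> J \<subseteq> I \<Longrightarrow> rel_exact RR (carrier R) I 0"
    and "ideal I R" "J \<subseteq> I"
  shows "rel_exact RR (carrier R) I i"
  using assms(4,5)
proof (induction i arbitrary: I)
  case (Suc i)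
  note A = module_ring_as_mod[OF cring]
  note sI = ideal_submodule_ring[OF cring Suc.prems(1)]
  note sJ = ideal_submodule_ring[OF cring J]
  have sR: "submodule (carrier R) R RR"
    using module.carrier_is_submodule[OF A] by (simp add: ring_as_mod_simps)
  have subI: "I \<subseteq> carrier R" by (rule additive_subgroup.a_subset[OF ideal.axioms(1)[OF Suc.prems(1)]])
  have "rel_exact RR I J i"
  proof (rule rel_exact_killed[OF Suc.IH J A sI sJ Suc.prems(2)])
    fix a n assume "a \<in> J" "n \<in> I"
    then show "a \<odot>\<^bsub>RR\<^esub> n \<in> J" using subI ideal.I_r_closed[OF J] by (auto simp: ring_as_mod_simps)
  qed
  then show ?case by (rule rel_exact_shift[OF A sR sI sJ Suc.prems(2) subI _ e])
qed (rule f)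

lemma rel_exact_torsion:
  assumes J: "ideal J R" and e: "\<And>i. rel_exact RR (carrier R) J i"
    and f: "\<And>I. ideal I R \<Longrightarrow> J \<subseteq> I \<Longrightarrow> rel_exact RR (carrier R) I 0"
    and N: "module R N" and tors: "adic_torsion R J N"
  shows "rel_exact N (carrier N) {\<zero>\<^bsub>N\<^esub>} i"
proof -
  interpret module R N by fact
  \<comment> \<open>The submodules annihilated by the powers of \<open>J\<close>; they start at zero because the zeroth power
    is the unit ideal.\<close>
  define T where "T n = {x \<in> carrier N. \<forall>a\<in>ideal_pow R J n. a \<odot>\<^bsub>N\<^esub> x = \<zero>\<^bsub>N\<^esub>}" for n
  have pow_c: "a \<in> carrier R" if "a \<in> ideal_pow R J n" for a n
    using ideal.Icarr[OF ideal_ideal_pow[OF cring J] that] .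
  have T_sub: "submodule (T n) R N" for n
  proof (rule submoduleI)
    fix b x assume b: "b \<in> carrier R" and x: "x \<in> T n"
    have "a \<odot>\<^bsub>N\<^esub> (b \<odot>\<^bsub>N\<^esub> x) = \<zero>\<^bsub>N\<^esub>" if a: "a \<in> ideal_pow R J n" for a
    proof -
      have "a \<otimes>\<^bsub>R\<^esub> b \<in> ideal_pow R J n" by (rule ideal.I_r_closed[OF ideal_ideal_pow[OF cring J] a b])
      then show ?thesis using x b pow_c[OF a] by (simp add: T_def smult_assoc1[symmetric])
    qed
    then show "b \<odot>\<^bsub>N\<^esub> x \<in> T n" using b x by (simp add: T_def)
  qed (auto simp: T_def smult_r_distr smult_r_minus M.neg_zero pow_c)
  have pow_mono: "ideal_pow R J (Suc n) \<subseteq> ideal_pow R J n" for n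
    using R.ideal_prod_inter[OF ideal_ideal_pow[OF cring J] J] by (auto simp: ideal_pow_simps)
  have T_mono: "T n \<subseteq> T (Suc n)" for n using pow_mono by (auto simp: T_def)
  have T_mono': "T n \<subseteq> T m" if "n \<le> m" for n m using lift_Suc_mono_le[of T, OF T_mono that] .
  have "\<one>\<^bsub>R\<^esub> \<odot>\<^bsub>N\<^esub> x = \<zero>\<^bsub>N\<^esub>" if "x \<in> T 0" for x
    using that by (auto simp: T_def ideal_pow_simps simp del: smult_one)
  then have T_0: "T 0 = {\<zero>\<^bsub>N\<^esub>}" using submoduleD(2)[OF T_sub[of 0]] by (auto simp: T_def)
  have zero_sub: "submodule {\<zero>\<^bsub>N\<^esub>} R N" using T_sub[of 0] unfolding T_0 .
  have step: "rel_exact N (T (Suc n)) (T n) i" for n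
  proof (rule rel_exact_killed[OF rel_exact_ideals[OF J e f] J N T_sub T_sub T_mono])
    fix a x assume a: "a \<in> J" and x: "x \<in> T (Suc n)"
    have ac: "a \<in> carrier R" using ideal.Icarr[OF J a] .
    have "b \<odot>\<^bsub>N\<^esub> (a \<odot>\<^bsub>N\<^esub> x) = \<zero>\<^bsub>N\<^esub>" if b: "b \<in> ideal_pow R J n" for b
    proof -
      have "b \<otimes>\<^bsub>R\<^esub> a \<in> ideal_pow R J (Suc n)" using a b by (simp add: ideal_pow_simps ideal_prod.prod)
      then show ?thesis using x ac pow_c[OF b] by (simp add: T_def smult_assoc1[symmetric])
    qed
    then show "a \<odot>\<^bsub>N\<^esub> x \<in> T n" using ac x by (simp add: T_def)
  qed
  have T_exact: "rel_exact N (T n) {\<zero>\<^bsub>N\<^esub>} i" for n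
  proof (induction n)
    case 0 show ?case unfolding T_0 by (rule rel_exact_refl[OF N zero_sub])
  next
    case (Suc n)
    show ?case
      by (rule rel_exact_extension[OF N T_sub T_sub zero_sub _ T_mono step Suc.IH])
        (use submoduleD(2)[OF T_sub] in auto)
  qed
  show ?thesis
  proof (rule rel_exact_directed)
    fix S assume "finite S" "S \<subseteq> carrier N"
    then have "\<exists>n. S \<subseteq> T n"
    proof (induction S rule: finite_induct)
      case (insert x S)
      then obtain n where n: "S \<subseteq> T n" by auto
      obtain m where m: "x \<in> T m" using tors insert.prems by (auto simp: T_def adic_torsion_def)
      have "insert x S \<subseteq> T (max n m)" using n m T_mono'[of n "max n m"] T_mono'[of m "max n m"] by auto
      then show ?case by (rule exI)
    qed simp
    then obtain n where "S \<subseteq> T n" ..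
    moreover have "T n \<subseteq> carrier N" by (auto simp: T_def)
    ultimately show "\<exists>H'. S \<subseteq> H' \<and> H' \<subseteq> carrier N \<and> rel_exact N H' {\<zero>\<^bsub>N\<^esub>} i"
      using T_exact by (intro exI[of _ "T n"] conjI)
  qed
qed

end

section \<open>Tensor products with a presented module\<close>

lemma quot_proj:
  assumes "module R M" "submodule H R M"
  shows "(\<lambda>x. H +>\<^bsub>M\<^esub> x) \<in> mod_hom R M (quot_mod M H)"
    and "carrier (quot_mod M H) = (\<lambda>x. H +>\<^bsub>M\<^esub> x) ` carrier M"
    and "x \<in> carrier M \<Longrightarrow> H +>\<^bsub>M\<^esub> x = \<zero>\<^bsub>quot_mod M H\<^esub> \<longleftrightarrow> x \<in> H"
proof -
  interpret module R M by fact
  interpret S: submodule H R M by fact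
  have A: "abelian_subgroup H M"
    by (rule abelian_subgroupI3) (auto intro: additive_subgroup.intro S.subgroup_axioms M.abelian_group_axioms)
  interpret A: abelian_subgroup H M by (rule A)
  show car: "carrier (quot_mod M H) = (\<lambda>x. H +>\<^bsub>M\<^esub> x) ` carrier M"
    by (auto simp: quot_mod_def A_RCOSETS_def')
  show "(\<lambda>x. H +>\<^bsub>M\<^esub> x) \<in> mod_hom R M (quot_mod M H)"
  proof (rule mod_homI)
    show "H +>\<^bsub>M\<^esub> (a \<odot>\<^bsub>M\<^esub> x) = a \<odot>\<^bsub>quot_mod M H\<^esub> (H +>\<^bsub>M\<^esub> x)" if "a \<in> carrier R" "x \<in> carrier M" for a x
      by (rule module_quot_mod(2)[OF assms that, symmetric])
  qed (auto simp: car, auto simp: quot_mod_def A.a_rcos_sum)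
  show "H +>\<^bsub>M\<^esub> x = \<zero>\<^bsub>quot_mod M H\<^esub> \<longleftrightarrow> x \<in> H" if x: "x \<in> carrier M"
  proof
    assume "H +>\<^bsub>M\<^esub> x = \<zero>\<^bsub>quot_mod M H\<^esub>"
    then show "x \<in> H" using A.a_rcos_self[OF x] by (simp add: quot_mod_def)
  next
    assume "x \<in> H"
    then show "H +>\<^bsub>M\<^esub> x = \<zero>\<^bsub>quot_mod M H\<^esub>" using A.a_rcos_const by (simp add: quot_mod_def)
  qed
qed

definition bilinear ::
    "('a, 'r) ring_scheme \<Rightarrow> ('a, 'm, 'p) module_scheme \<Rightarrow> ('a, 'n, 'q) module_scheme \<Rightarrow>
     ('a, 'b, 's) module_scheme \<Rightarrow> ('m \<times> 'n \<Rightarrow> 'b) \<Rightarrow> bool"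
  where "bilinear R M N P \<phi> \<longleftrightarrow>
    (\<forall>x\<in>carrier M. (\<lambda>y. \<phi> (x, y)) \<in> mod_hom R N P) \<and> (\<forall>y\<in>carrier N. (\<lambda>x. \<phi> (x, y)) \<in> mod_hom R M P)"

lemma module_cring: "module R M \<Longrightarrow> cring R"
  by (rule module.axioms)

context
  fixes R :: "('a, 'r) ring_scheme" and M :: "('a, 'm, 'p) module_scheme" and N :: "('a, 'n, 'q) module_scheme"
  assumes M: "module R M" and N: "module R N"
begin

lemma tensor_rels_carrier: "tensor_rels R M N \<subseteq> carrier (free_mod R (carrier M \<times> carrier N))"
proof -
  interpret M: module R M by (rule M)
  interpret N: module R N by (rule N)
  interpret F: module R "free_mod R (carrier M \<times> carrier N)" by (rule module_free_mod) (rule module_cring[OF M])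
  have g: "free_gen R p \<in> carrier (free_mod R (carrier M \<times> carrier N))" if "p \<in> carrier M \<times> carrier N" for p
    by (rule free_gen_carrier[OF module_cring[OF M] that])
  show ?thesis
    unfolding tensor_rels_def Let_def
    by (auto intro!: F.M.minus_closed F.M.a_closed F.smult_closed g)
qed

lemma tensor_ker_submodule: "submodule (tensor_ker R M N) R (free_mod R (carrier M \<times> carrier N))"
  unfolding tensor_ker_def by (rule span_submodule(1)[OF module_free_mod[OF module_cring[OF M]] tensor_rels_carrier])

lemma module_tensor: "module R (tensor R M N)"
  unfolding tensor_def by (rule module_quot_mod(1)[OF module_free_mod[OF module_cring[OF M]] tensor_ker_submodule])

lemma tensor_proj:
  "(\<lambda>f. tensor_ker R M N +>\<^bsub>free_mod R (carrier M \<times> carrier N)\<^esub> f) \<in>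
     mod_hom R (free_mod R (carrier M \<times> carrier N)) (tensor R M N)"
  "carrier (tensor R M N) = (\<lambda>f. tensor_ker R M N +>\<^bsub>free_mod R (carrier M \<times> carrier N)\<^esub> f) `
     carrier (free_mod R (carrier M \<times> carrier N))"
  unfolding tensor_def by (rule quot_proj[OF module_free_mod[OF module_cring[OF M]] tensor_ker_submodule])+

lemma tensor_hom_eqI:
  assumes "module R P" "h \<in> mod_hom R (tensor R M N) P" "k \<in> mod_hom R (tensor R M N) P"
    and "\<And>x y. x \<in> carrier M \<Longrightarrow> y \<in> carrier N \<Longrightarrow> h (pure_tensor R M N x y) = k (pure_tensor R M N x y)"
    and "t \<in> carrier (tensor R M N)"
  shows "h t = k t"
proof -
  obtain f where f: "f \<in> carrier (free_mod R (carrier M \<times> carrier N))"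
    "t = tensor_ker R M N +>\<^bsub>free_mod R (carrier M \<times> carrier N)\<^esub> f" using assms(5) tensor_proj(2) by auto
  show ?thesis unfolding f(2)
    by (rule free_hom_eqI[OF module_cring[OF M] assms(1) mod_hom_compose[OF tensor_proj(1) assms(2)]
          mod_hom_compose[OF tensor_proj(1) assms(3)] _ f(1)])
      (use assms(4) in \<open>auto simp: pure_tensor_def\<close>)
qed

text \<open>The tensor product is generated by the pure tensors, stated for submodules so that it can be
  applied to images of homomorphisms.\<close>

lemma tensor_span:
  assumes "submodule H R (tensor R M N)"
    and "\<And>x y. x \<in> carrier M \<Longrightarrow> y \<in> carrier N \<Longrightarrow> pure_tensor R M N x y \<in> H"
  shows "carrier (tensor R M N) = H"
proof
  note H = module.submoduleD[OF module_tensor assms(1)]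
  show "H \<subseteq> carrier (tensor R M N)" using H(1) by blast
  show "carrier (tensor R M N) \<subseteq> H"
  proof
    fix t assume "t \<in> carrier (tensor R M N)"
    then obtain f where f: "f \<in> carrier (free_mod R (carrier M \<times> carrier N))"
      "t = tensor_ker R M N +>\<^bsub>free_mod R (carrier M \<times> carrier N)\<^esub> f" using tensor_proj(2) by auto
    note q = tensor_proj(1)
    note F = module_free_mod[OF module_cring[OF M]]
    show "t \<in> H" unfolding f(2)
    proof (rule free_mod_induct[OF module_cring[OF M] f(1)])
      show "tensor_ker R M N +>\<^bsub>free_mod R (carrier M \<times> carrier N)\<^esub> \<zero>\<^bsub>free_mod R (carrier M \<times> carrier N)\<^esub> \<in> H"
        using H(2) mod_hom_zero[OF F module_tensor q] by simp
      fix a p v assume a: "a \<in> carrier R" and p: "p \<in> carrier M \<times> carrier N"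
        and v: "v \<in> carrier (free_mod R (carrier M \<times> carrier N))"
          "tensor_ker R M N +>\<^bsub>free_mod R (carrier M \<times> carrier N)\<^esub> v \<in> H"
      note g = free_gen_carrier[OF module_cring[OF M] p]
      have "tensor_ker R M N +>\<^bsub>free_mod R (carrier M \<times> carrier N)\<^esub> free_gen R p \<in> H"
        using assms(2) p by (cases p) (auto simp: pure_tensor_def)
      then show "tensor_ker R M N +>\<^bsub>free_mod R (carrier M \<times> carrier N)\<^esub>
        (a \<odot>\<^bsub>free_mod R (carrier M \<times> carrier N)\<^esub> free_gen R p \<oplus>\<^bsub>free_mod R (carrier M \<times> carrier N)\<^esub> v) \<in> H"
        using mod_hom_add[OF q module.smult_closed[OF F a g] v(1)] mod_hom_smult[OF q a g] v(2) H(3,6) a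
        by simp
    qed
  qed
qed

lemma pure_tensor_bilinear: "bilinear R M N (tensor R M N) (\<lambda>(x, y). pure_tensor R M N x y)"
proof -
  interpret M: module R M by (rule M)
  interpret N: module R N by (rule N)
  let ?F = "free_mod R (carrier M \<times> carrier N)"
  note mF = module_free_mod[OF module_cring[OF M], of "carrier M \<times> carrier N"]
  interpret F: module R ?F by (rule mF)
  interpret T: module R "tensor R M N" by (rule module_tensor)
  define q where "q = (\<lambda>f. tensor_ker R M N +>\<^bsub>?F\<^esub> f)"
  have q: "q \<in> mod_hom R ?F (tensor R M N)" using tensor_proj(1) by (simp add: q_def)
  have pt: "pure_tensor R M N x y = q (free_gen R (x, y))" for x y by (simp add: pure_tensor_def q_def)
  have g: "free_gen R (x, y) \<in> carrier ?F" if "x \<in> carrier M" "y \<in> carrier N" for x y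
    by (rule free_gen_carrier[OF module_cring[OF M]]) (use that in auto)
  have eq: "q u = q v" if "u \<ominus>\<^bsub>?F\<^esub> v \<in> tensor_rels R M N" "u \<in> carrier ?F" "v \<in> carrier ?F" for u v
  proof -
    have "u \<ominus>\<^bsub>?F\<^esub> v \<in> tensor_ker R M N"
      using that(1) span_submodule(2)[OF mF tensor_rels_carrier] by (auto simp: tensor_ker_def)
    then have "q (u \<ominus>\<^bsub>?F\<^esub> v) = \<zero>\<^bsub>tensor R M N\<^esub>"
      using quot_proj(3)[OF mF tensor_ker_submodule F.M.minus_closed[OF that(2,3)]]
      by (simp add: q_def tensor_def)
    then show ?thesis
      using mod_hom_diff[OF mF module_tensor q that(2,3)]
        T.M.diff_eq_zero_iff[OF mod_hom_closed[OF q that(2)] mod_hom_closed[OF q that(3)]] by simp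
  qed
  note qa = mod_hom_add[OF q] and qs = mod_hom_smult[OF q] and qc = mod_hom_closed[OF q]
  have 1: "q (free_gen R (x \<oplus>\<^bsub>M\<^esub> x', y)) = q (free_gen R (x, y) \<oplus>\<^bsub>?F\<^esub> free_gen R (x', y))"
    if "x \<in> carrier M" "x' \<in> carrier M" "y \<in> carrier N" for x x' y
    by (rule eq, unfold tensor_rels_def Let_def, rule UnI1, rule UnI1, rule UnI1) (use that g in blast, use that g in auto)
  have 2: "q (free_gen R (x, y \<oplus>\<^bsub>N\<^esub> y')) = q (free_gen R (x, y) \<oplus>\<^bsub>?F\<^esub> free_gen R (x, y'))"
    if "x \<in> carrier M" "y \<in> carrier N" "y' \<in> carrier N" for x y y'
    by (rule eq, unfold tensor_rels_def Let_def, rule UnI1, rule UnI1, rule UnI2) (use that g in blast, use that g in auto)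
  have 3: "q (free_gen R (a \<odot>\<^bsub>M\<^esub> x, y)) = q (a \<odot>\<^bsub>?F\<^esub> free_gen R (x, y))"
    if "a \<in> carrier R" "x \<in> carrier M" "y \<in> carrier N" for a x y
    by (rule eq, unfold tensor_rels_def Let_def, rule UnI1, rule UnI2) (use that g in blast, use that g in auto)
  have 4: "q (free_gen R (x, a \<odot>\<^bsub>N\<^esub> y)) = q (a \<odot>\<^bsub>?F\<^esub> free_gen R (x, y))"
    if "a \<in> carrier R" "x \<in> carrier M" "y \<in> carrier N" for a x y
    by (rule eq, unfold tensor_rels_def Let_def, rule UnI2) (use that g in blast, use that g in auto)
  show ?thesis unfolding bilinear_def
    by (intro conjI ballI mod_homI) (simp_all add: pt qc g 1 2 3 4 qa qs)
qed

lemma pure_tensor_closed: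
  "x \<in> carrier M \<Longrightarrow> y \<in> carrier N \<Longrightarrow> pure_tensor R M N x y \<in> carrier (tensor R M N)"
  using pure_tensor_bilinear by (auto simp: bilinear_def mod_hom_def)

lemma pure_tensor_hom_left: "y \<in> carrier N \<Longrightarrow> (\<lambda>x. pure_tensor R M N x y) \<in> mod_hom R M (tensor R M N)"
  using pure_tensor_bilinear by (simp add: bilinear_def)

lemma pure_tensor_hom_right: "x \<in> carrier M \<Longrightarrow> (\<lambda>y. pure_tensor R M N x y) \<in> mod_hom R N (tensor R M N)"
  using pure_tensor_bilinear by (simp add: bilinear_def)

lemma tensor_lift:
  assumes P: "module R P" and b: "bilinear R M N P \<phi>"
  shows "tensor_lift R P \<phi> \<in> mod_hom R (tensor R M N) P"
    and "x \<in> carrier M \<Longrightarrow> y \<in> carrier N \<Longrightarrow> tensor_lift R P \<phi> (pure_tensor R M N x y) = \<phi> (x, y)"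
proof -
  have l: "(\<lambda>y. \<phi> (x, y)) \<in> mod_hom R N P" if "x \<in> carrier M" for x using b that by (simp add: bilinear_def)
  have r: "(\<lambda>x. \<phi> (x, y)) \<in> mod_hom R M P" if "y \<in> carrier N" for y using b that by (simp add: bilinear_def)
  note U = tensor_universal[OF M N P mod_hom_closed[OF l] mod_hom_add[OF r] mod_hom_add[OF l]
      mod_hom_smult[OF r] mod_hom_smult[OF l]]
  show "tensor_lift R P \<phi> (pure_tensor R M N x y) = \<phi> (x, y)" if "x \<in> carrier M" "y \<in> carrier N"
    by (rule U(2)) (use that in auto)
  let ?F = "free_mod R (carrier M \<times> carrier N)"
  note mF = module_free_mod[OF module_cring[OF M], of "carrier M \<times> carrier N"]
  interpret F: module R ?F by (rule mF)
  define q where "q = (\<lambda>f. tensor_ker R M N +>\<^bsub>?F\<^esub> f)"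
  have q: "q \<in> mod_hom R ?F (tensor R M N)" using tensor_proj(1) by (simp add: q_def)
  have ex: "\<exists>f\<in>carrier ?F. t = q f" if "t \<in> carrier (tensor R M N)" for t
    using that tensor_proj(2) by (auto simp: q_def)
  have val: "tensor_lift R P \<phi> (q f) = free_lift R P \<phi> f" if "f \<in> carrier ?F" for f
    unfolding q_def by (rule U(3)) (use that in auto)
  have "\<phi> \<in> carrier M \<times> carrier N \<rightarrow> carrier P" using mod_hom_closed[OF l] by auto
  note h = free_lift_hom[OF P this]
  show "tensor_lift R P \<phi> \<in> mod_hom R (tensor R M N) P"
  proof (rule mod_homI)
    fix t assume "t \<in> carrier (tensor R M N)"
    then obtain f where f: "f \<in> carrier ?F" "t = q f" using ex by blast
    show "tensor_lift R P \<phi> t \<in> carrier P" using f mod_hom_closed[OF h] by (simp add: val)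
    show "tensor_lift R P \<phi> (a \<odot>\<^bsub>tensor R M N\<^esub> t) = a \<odot>\<^bsub>P\<^esub> tensor_lift R P \<phi> t" if "a \<in> carrier R" for a
      using f mod_hom_smult[OF h that] that by (simp add: val mod_hom_smult[OF q, symmetric])
    fix s assume "s \<in> carrier (tensor R M N)"
    then obtain k where k: "k \<in> carrier ?F" "s = q k" using ex by blast
    show "tensor_lift R P \<phi> (t \<oplus>\<^bsub>tensor R M N\<^esub> s) = tensor_lift R P \<phi> t \<oplus>\<^bsub>P\<^esub> tensor_lift R P \<phi> s"
      using f k mod_hom_add[OF h] by (simp add: val mod_hom_add[OF q, symmetric])
  qed
qed

end

lemma tensor_map:
  assumes M: "module R M" and N: "module R N" and M': "module R M'" and N': "module R N'"
    and f: "f \<in> mod_hom R M M'" and g: "g \<in> mod_hom R N N'"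
  shows "tensor_map R M' N' f g \<in> mod_hom R (tensor R M N) (tensor R M' N')"
    and "x \<in> carrier M \<Longrightarrow> y \<in> carrier N \<Longrightarrow>
      tensor_map R M' N' f g (pure_tensor R M N x y) = pure_tensor R M' N' (f x) (g y)"
proof -
  note b = pure_tensor_bilinear[OF M' N'] and T = module_tensor[OF M' N']
  have "bilinear R M N (tensor R M' N') (\<lambda>(x, y). pure_tensor R M' N' (f x) (g y))"
    unfolding bilinear_def
  proof (intro conjI ballI)
    fix x assume "x \<in> carrier M"
    then have "(\<lambda>y. pure_tensor R M' N' (f x) y) \<in> mod_hom R N' (tensor R M' N')"
      using b mod_hom_closed[OF f] by (simp add: bilinear_def)
    from mod_hom_compose[OF g this]
    show "(\<lambda>y. case (x, y) of (x, y) \<Rightarrow> pure_tensor R M' N' (f x) (g y)) \<in> mod_hom R N (tensor R M' N')" by simp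
  next
    fix y assume "y \<in> carrier N"
    then have "(\<lambda>x. pure_tensor R M' N' x (g y)) \<in> mod_hom R M' (tensor R M' N')"
      using b mod_hom_closed[OF g] by (simp add: bilinear_def)
    from mod_hom_compose[OF f this]
    show "(\<lambda>x. case (x, y) of (x, y) \<Rightarrow> pure_tensor R M' N' (f x) (g y)) \<in> mod_hom R M (tensor R M' N')" by simp
  qed
  note L = tensor_lift[OF M N T this]
  show "tensor_map R M' N' f g \<in> mod_hom R (tensor R M N) (tensor R M' N')"
    unfolding tensor_map_def by (rule L(1))
  show "tensor_map R M' N' f g (pure_tensor R M N x y) = pure_tensor R M' N' (f x) (g y)"
    if "x \<in> carrier M" "y \<in> carrier N"
    unfolding tensor_map_def using L(2)[OF that] by simp
qed

text \<open>\<open>P\<close> is the cokernel of the matrix \<open>d\<close>, with generators \<open>p x\<close> for \<open>x \<in> X\<close> and relations \<open>d y\<close> for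
  \<open>y \<in> Y\<close>.\<close>

definition presented ::
    "('a, 'r) ring_scheme \<Rightarrow> ('a, 'n, 'q) module_scheme \<Rightarrow> 'x set \<Rightarrow> ('x \<Rightarrow> 'n) \<Rightarrow> 'y set \<Rightarrow> ('y \<Rightarrow> 'x \<Rightarrow> 'a) \<Rightarrow> bool"
  where "presented R P X p Y d \<longleftrightarrow>
    module R P \<and> p \<in> X \<rightarrow> carrier P \<and> d \<in> Y \<rightarrow> carrier (free_mod R X) \<and>
    free_lift R P p ` carrier (free_mod R X) = carrier P \<and>
    (\<forall>u\<in>carrier (free_mod R X).
       free_lift R P p u = \<zero>\<^bsub>P\<^esub> \<longleftrightarrow> u \<in> free_lift R (free_mod R X) d ` carrier (free_mod R Y))"

text \<open>The element \<open>\<Sum> u x \<otimes> p x\<close> of \<open>N \<otimes> P\<close>.\<close>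

definition tensor_sum ::
    "('a, 'r) ring_scheme \<Rightarrow> ('a, 'n, 'q) module_scheme \<Rightarrow> ('a, 'm, 'p) module_scheme \<Rightarrow>
     ('x \<Rightarrow> 'm) \<Rightarrow> ('x \<Rightarrow> 'n) \<Rightarrow> ('n \<times> 'm \<Rightarrow> 'a) set"
  where "tensor_sum R N P p = fs_lift N (tensor R N P) (\<lambda>x n. pure_tensor R N P n (p x))"

context
  fixes R :: "('a, 'r) ring_scheme" and N :: "('a, 'n, 'q) module_scheme" and P :: "('a, 'm, 'p) module_scheme"
    and p :: "'x \<Rightarrow> 'm" and X :: "'x set"
  assumes N: "module R N" and P: "module R P" and p: "p \<in> X \<rightarrow> carrier P"
begin

lemma tensor_sum_hom: "tensor_sum R N P p \<in> mod_hom R (fs_mod N X) (tensor R N P)"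
  unfolding tensor_sum_def
  by (rule fs_lift_hom[OF N module_tensor[OF N P] pure_tensor_hom_left[OF N P funcset_mem[OF p]]])

lemma tensor_sum_single:
  assumes "x \<in> X" "n \<in> carrier N"
  shows "tensor_sum R N P p (fs_single N x n) = pure_tensor R N P n (p x)"
  unfolding tensor_sum_def
  using fs_lift_single[where \<phi> = "\<lambda>x n. pure_tensor R N P n (p x)" and x = x,
      OF N module_tensor[OF N P] pure_tensor_hom_left[OF N P funcset_mem[OF p assms(1)]] assms(2)] .

lemma tensor_sum_scale:
  assumes "u \<in> carrier (free_mod R X)" "n \<in> carrier N"
  shows "tensor_sum R N P p (\<lambda>x. u x \<odot>\<^bsub>N\<^esub> n) = pure_tensor R N P n (free_lift R P p u)"
proof (rule free_hom_eqI[OF module_cring[OF N] module_tensor[OF N P] _ _ _ assms(1)])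
  show "(\<lambda>u. tensor_sum R N P p (\<lambda>x. u x \<odot>\<^bsub>N\<^esub> n)) \<in> mod_hom R (free_mod R X) (tensor R N P)"
    by (rule mod_hom_compose[OF fs_scale_hom_left[OF N assms(2)] tensor_sum_hom])
  show "(\<lambda>u. pure_tensor R N P n (free_lift R P p u)) \<in> mod_hom R (free_mod R X) (tensor R N P)"
    by (rule mod_hom_compose[OF free_lift_hom[OF P p] pure_tensor_hom_right[OF N P assms(2)]])
  show "tensor_sum R N P p (\<lambda>xa. free_gen R x xa \<odot>\<^bsub>N\<^esub> n) =
      pure_tensor R N P n (free_lift R P p (free_gen R x))" if "x \<in> X" for x
    using that assms(2)
    by (simp add: fs_scale_gen[OF N] tensor_sum_single free_lift_basis[OF P p])
qed

end

lemma tensor_sum_natural: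
  assumes N: "module R N" and N': "module R N'" and f: "f \<in> mod_hom R N N'"
    and P: "module R P" and p: "p \<in> X \<rightarrow> carrier P" and u: "u \<in> carrier (fs_mod N X)"
  shows "tensor_map R N' P f (\<lambda>z. z) (tensor_sum R N P p u) = tensor_sum R N' P p (\<lambda>x. f (u x))"
proof (rule fs_hom_eqI[OF N module_tensor[OF N' P] _ _ _ u])
  have id: "(\<lambda>z. z) \<in> mod_hom R P P" by (rule mod_homI) auto
  show "(\<lambda>u. tensor_map R N' P f (\<lambda>z. z) (tensor_sum R N P p u)) \<in> mod_hom R (fs_mod N X) (tensor R N' P)"
    by (rule mod_hom_compose[OF tensor_sum_hom[OF N P p] tensor_map(1)[OF N P N' P f id]])
  show "(\<lambda>u. tensor_sum R N' P p (\<lambda>x. f (u x))) \<in> mod_hom R (fs_mod N X) (tensor R N' P)"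
    by (rule mod_hom_compose[OF fs_map_hom[OF N N' f] tensor_sum_hom[OF N' P p]])
  fix x n assume x: "x \<in> X" and n: "n \<in> carrier N"
  have "(\<lambda>y. f (fs_single N x n y)) = fs_single N' x (f n)"
    by (auto simp: fs_single_def mod_hom_zero[OF N N' f])
  then show "tensor_map R N' P f (\<lambda>z. z) (tensor_sum R N P p (fs_single N x n)) =
      tensor_sum R N' P p (\<lambda>y. f (fs_single N x n y))"
    by (simp add: tensor_sum_single[OF N P p x n] tensor_sum_single[OF N' P p x mod_hom_closed[OF f n]]
        tensor_map(2)[OF N P N' P f id n funcset_mem[OF p x]])
qed

lemma tensor_sum_bd:
  assumes pr: "presented R P X p Y d" and N: "module R N" and c: "c \<in> carrier (fs_mod N Y)"
  shows "tensor_sum R N P p (fs_mat N X d c) = \<zero>\<^bsub>tensor R N P\<^esub>"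
proof -
  have P: "module R P" and p: "p \<in> X \<rightarrow> carrier P" and d: "d \<in> Y \<rightarrow> carrier (free_mod R X)"
    using pr by (simp_all add: presented_def)
  note T = module_tensor[OF N P]
  interpret T: module R "tensor R N P" by (rule T)
  note F = module_free_mod[OF module_cring[OF N], of X]
  show ?thesis
  proof (rule fs_hom_eqI[OF N T mod_hom_compose[OF fs_mat_hom[OF N d] tensor_sum_hom[OF N P p]] _ _ c])
    show "(\<lambda>_. \<zero>\<^bsub>tensor R N P\<^esub>) \<in> mod_hom R (fs_mod N Y) (tensor R N P)" by (rule mod_homI) auto
    fix y n assume y: "y \<in> Y" and n: "n \<in> carrier N"
    note dy = funcset_mem[OF d y]
    have "free_lift R (free_mod R X) d (free_gen R y) = d y" by (rule free_lift_basis[OF F d y])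
    then have "d y \<in> free_lift R (free_mod R X) d ` carrier (free_mod R Y)"
      using free_gen_carrier[OF module_cring[OF N] y] by force
    then have "free_lift R P p (d y) = \<zero>\<^bsub>P\<^esub>" using pr dy by (simp add: presented_def)
    then have "tensor_sum R N P p (\<lambda>x. d y x \<odot>\<^bsub>N\<^esub> n) = \<zero>\<^bsub>tensor R N P\<^esub>"
      using tensor_sum_scale[OF N P p dy n] mod_hom_zero[OF P T pure_tensor_hom_right[OF N P n]] by simp
    then show "tensor_sum R N P p (fs_mat N X d (fs_single N y n)) = \<zero>\<^bsub>tensor R N P\<^esub>"
      by (simp add: fs_mat_single[where d = d and x = y, OF N dy n])
  qed
qed

lemma tensor_sum_surj:
  assumes pr: "presented R P X p Y d" and N: "module R N"
  shows "tensor_sum R N P p ` carrier (fs_mod N X) = carrier (tensor R N P)"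
proof -
  have P: "module R P" and p: "p \<in> X \<rightarrow> carrier P"
    and surj: "free_lift R P p ` carrier (free_mod R X) = carrier P"
    using pr by (simp_all add: presented_def)
  note F = module_fs_mod[OF N, of X]
  show ?thesis
  proof (rule tensor_span[OF N P, symmetric])
    show "submodule (tensor_sum R N P p ` carrier (fs_mod N X)) R (tensor R N P)"
      by (rule mod_hom_image_submodule[OF F module_tensor[OF N P] tensor_sum_hom[OF N P p]
            module.carrier_is_submodule[OF F]])
    fix n z assume n: "n \<in> carrier N" and "z \<in> carrier P"
    then obtain u where u: "u \<in> carrier (free_mod R X)" "z = free_lift R P p u" using surj by blast
    show "pure_tensor R N P n z \<in> tensor_sum R N P p ` carrier (fs_mod N X)"
      by (rule image_eqI[OF _ fs_scale_carrier[OF N u(1) n]])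
        (simp add: tensor_sum_scale[OF N P p u(1) n] u(2))
  qed
qed

text \<open>The substantial half of right exactness. The cokernel \<open>Q\<close> of the matrix on families receives a bilinear
  map from \<open>N \<times> P\<close>: send \<open>(n, z)\<close> to the class of \<open>u \<otimes> n\<close>, where \<open>u\<close> expresses \<open>z\<close> in the generators.
  The induced map on \<open>N \<otimes> P\<close> takes \<open>\<Sum> u x \<otimes> p x\<close> back to the class of \<open>u\<close>.\<close>

lemma tensor_sum_ker:
  assumes pr: "presented R P X p Y d" and N: "module R N" and u: "u \<in> carrier (fs_mod N X)"
    and zero: "tensor_sum R N P p u = \<zero>\<^bsub>tensor R N P\<^esub>"
  shows "u \<in> fs_mat N X d ` carrier (fs_mod N Y)"
proof -
  have P: "module R P" and p: "p \<in> X \<rightarrow> carrier P" and d: "d \<in> Y \<rightarrow> carrier (free_mod R X)"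
    and surj: "free_lift R P p ` carrier (free_mod R X) = carrier P"
    and ker: "\<And>u. u \<in> carrier (free_mod R X) \<Longrightarrow> free_lift R P p u = \<zero>\<^bsub>P\<^esub> \<Longrightarrow>
        u \<in> free_lift R (free_mod R X) d ` carrier (free_mod R Y)"
    using pr by (simp_all add: presented_def)
  note cR = module_cring[OF N]
  note F = module_free_mod[OF cR, of X]
  note E = module_fs_mod[OF N, of X] and E' = module_fs_mod[OF N, of Y]
  interpret F: module R "free_mod R X" by (rule F)
  interpret P: module R P by (rule P)
  note pl = free_lift_hom[OF P p]
  define B where "B = fs_mat N X d ` carrier (fs_mod N Y)"
  have B: "submodule B R (fs_mod N X)"
    unfolding B_def by (rule mod_hom_image_submodule[OF E' E fs_mat_hom[OF N d] module.carrier_is_submodule[OF E']])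
  define Q where "Q = quot_mod (fs_mod N X) B"
  define q where "q = (\<lambda>v. B +>\<^bsub>fs_mod N X\<^esub> v)"
  have Q: "module R Q" unfolding Q_def by (rule module_quot_mod(1)[OF E B])
  interpret Q: module R Q by (rule Q)
  have q: "q \<in> mod_hom R (fs_mod N X) Q" unfolding q_def Q_def by (rule quot_proj(1)[OF E B])
  have qB: "q v = \<zero>\<^bsub>Q\<^esub> \<longleftrightarrow> v \<in> B" if "v \<in> carrier (fs_mod N X)" for v
    unfolding q_def Q_def by (rule quot_proj(3)[OF E B that])
  define c where "c z = (SOME u. u \<in> carrier (free_mod R X) \<and> z = free_lift R P p u)" for z
  have pre: "\<exists>u. u \<in> carrier (free_mod R X) \<and> z = free_lift R P p u" if "z \<in> carrier P" for z
  proof -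
    from that have "z \<in> free_lift R P p ` carrier (free_mod R X)" by (simp only: surj)
    then show ?thesis by (elim imageE) (intro exI conjI)
  qed
  have c: "c z \<in> carrier (free_mod R X)" "free_lift R P p (c z) = z" if "z \<in> carrier P" for z
  proof -
    from someI_ex[OF pre[OF that]] show "c z \<in> carrier (free_mod R X)" "free_lift R P p (c z) = z"
      by (simp_all add: c_def)
  qed
  define \<phi> where "\<phi> = (\<lambda>(n, z). q (\<lambda>x. c z x \<odot>\<^bsub>N\<^esub> n))"
  \<comment> \<open>Two expressions of the same element differ by a combination of relations.\<close>
  have \<phi>: "\<phi> (n, free_lift R P p v) = q (\<lambda>x. v x \<odot>\<^bsub>N\<^esub> n)"
    if n: "n \<in> carrier N" and v: "v \<in> carrier (free_mod R X)" for n v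
  proof -
    note h = fs_scale_hom_left[OF N n, of X]
    let ?w = "c (free_lift R P p v)"
    note w = c[OF mod_hom_closed[OF pl v]]
    have dc: "?w \<ominus>\<^bsub>free_mod R X\<^esub> v \<in> carrier (free_mod R X)" using w(1) v by simp
    have "free_lift R P p (?w \<ominus>\<^bsub>free_mod R X\<^esub> v) = \<zero>\<^bsub>P\<^esub>"
      using mod_hom_diff[OF F P pl w(1) v] w(2) mod_hom_closed[OF pl v] by (simp add: P.M.diff_eq_zero_iff)
    from ker[OF dc this] obtain k where k: "k \<in> carrier (free_mod R Y)"
      "?w \<ominus>\<^bsub>free_mod R X\<^esub> v = free_lift R (free_mod R X) d k" by blast
    have "(\<lambda>x. (?w \<ominus>\<^bsub>free_mod R X\<^esub> v) x \<odot>\<^bsub>N\<^esub> n) = fs_mat N X d (\<lambda>y. k y \<odot>\<^bsub>N\<^esub> n)"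
      unfolding k(2) by (rule fs_mat_scale[OF N d k(1) n, symmetric])
    then have "(\<lambda>x. (?w \<ominus>\<^bsub>free_mod R X\<^esub> v) x \<odot>\<^bsub>N\<^esub> n) \<in> B"
      unfolding B_def using fs_scale_carrier[OF N k(1) n] by (rule image_eqI)
    then have "q (\<lambda>x. (?w \<ominus>\<^bsub>free_mod R X\<^esub> v) x \<odot>\<^bsub>N\<^esub> n) = \<zero>\<^bsub>Q\<^esub>"
      using qB mod_hom_closed[OF h dc] by simp
    then have "q (\<lambda>x. ?w x \<odot>\<^bsub>N\<^esub> n) \<ominus>\<^bsub>Q\<^esub> q (\<lambda>x. v x \<odot>\<^bsub>N\<^esub> n) = \<zero>\<^bsub>Q\<^esub>"
      using mod_hom_diff[OF F Q mod_hom_compose[OF h q] w(1) v] by simp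
    then show ?thesis
      using mod_hom_closed[OF mod_hom_compose[OF h q] w(1)] mod_hom_closed[OF mod_hom_compose[OF h q] v]
      by (simp add: \<phi>_def Q.M.diff_eq_zero_iff)
  qed
  have "bilinear R N P Q \<phi>"
    unfolding bilinear_def
  proof (intro conjI ballI)
    fix n assume n: "n \<in> carrier N"
    note h = mod_hom_compose[OF fs_scale_hom_left[OF N n, of X] q]
    show "(\<lambda>z. \<phi> (n, z)) \<in> mod_hom R P Q"
    proof (rule mod_homI)
      fix z assume "z \<in> carrier P"
      from pre[OF this] obtain v where v: "v \<in> carrier (free_mod R X)" "z = free_lift R P p v" by (elim exE conjE)
      show "\<phi> (n, z) \<in> carrier Q" using mod_hom_closed[OF h v(1)] by (simp add: v(2) \<phi>[OF n v(1)])
      show "\<phi> (n, a \<odot>\<^bsub>P\<^esub> z) = a \<odot>\<^bsub>Q\<^esub> \<phi> (n, z)" if a: "a \<in> carrier R" for a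
        using mod_hom_smult[OF h a v(1)] \<phi>[OF n F.smult_closed[OF a v(1)]]
        by (simp add: v(2) \<phi>[OF n v(1)] mod_hom_smult[OF pl a v(1)])
      fix z' assume "z' \<in> carrier P"
      from pre[OF this] obtain v' where v': "v' \<in> carrier (free_mod R X)" "z' = free_lift R P p v'" by (elim exE conjE)
      show "\<phi> (n, z \<oplus>\<^bsub>P\<^esub> z') = \<phi> (n, z) \<oplus>\<^bsub>Q\<^esub> \<phi> (n, z')"
        using mod_hom_add[OF h v(1) v'(1)] \<phi>[OF n F.M.a_closed[OF v(1) v'(1)]]
        by (simp add: v(2) v'(2) \<phi>[OF n v(1)] \<phi>[OF n v'(1)] mod_hom_add[OF pl v(1) v'(1)])
    qed
  next
    fix z assume z: "z \<in> carrier P"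
    show "(\<lambda>n. \<phi> (n, z)) \<in> mod_hom R N Q"
      using mod_hom_compose[OF fs_scale_hom_right[OF N c(1)[OF z]] q] by (simp add: \<phi>_def)
  qed
  note L = tensor_lift[OF N P Q this]
  have "tensor_lift R Q \<phi> (tensor_sum R N P p u) = q u"
  proof (rule fs_hom_eqI[OF N Q mod_hom_compose[OF tensor_sum_hom[OF N P p] L(1)] q _ u])
    fix x n assume x: "x \<in> X" and n: "n \<in> carrier N"
    show "tensor_lift R Q \<phi> (tensor_sum R N P p (fs_single N x n)) = q (fs_single N x n)"
      using \<phi>[OF n free_gen_carrier[OF cR x]] L(2)[OF n funcset_mem[OF p x]]
      by (simp add: tensor_sum_single[OF N P p x n] free_lift_basis[OF P p x] fs_scale_gen[OF N n])
  qed
  then have "q u = \<zero>\<^bsub>Q\<^esub>" using zero mod_hom_zero[OF module_tensor[OF N P] Q L(1)] by simp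
  then show ?thesis using qB[OF u] by (simp add: B_def)
qed

lemma tensor_sum_zero_iff:
  assumes pr: "presented R P X p Y d" and N: "module R N" and u: "u \<in> carrier (fs_mod N X)"
  shows "tensor_sum R N P p u = \<zero>\<^bsub>tensor R N P\<^esub> \<longleftrightarrow> u \<in> fs_mat N X d ` carrier (fs_mod N Y)"
proof
  assume "u \<in> fs_mat N X d ` carrier (fs_mod N Y)"
  then obtain c where "c \<in> carrier (fs_mod N Y)" "u = fs_mat N X d c" by (elim imageE)
  then show "tensor_sum R N P p u = \<zero>\<^bsub>tensor R N P\<^esub>" using tensor_sum_bd[OF pr N] by simp
qed (rule tensor_sum_ker[OF pr N u])

text \<open>Injectivity after tensoring with \<open>P\<close>, in terms of families: this is the form in which flatness is
  proved and used.\<close>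

lemma tensor_map_inj_iff:
  assumes pr: "presented R P X p Y d" and N': "module R N'" and N: "module R N" and f: "f \<in> mod_hom R N' N"
  shows "inj_on (tensor_map R N P f (\<lambda>z. z)) (carrier (tensor R N' P)) \<longleftrightarrow>
    (\<forall>u\<in>carrier (fs_mod N' X). (\<lambda>x. f (u x)) \<in> fs_mat N X d ` carrier (fs_mod N Y) \<longrightarrow>
       u \<in> fs_mat N' X d ` carrier (fs_mod N' Y))" (is "?L \<longleftrightarrow> ?R")
proof -
  have P: "module R P" and p: "p \<in> X \<rightarrow> carrier P" using pr by (simp_all add: presented_def)
  have id: "(\<lambda>z. z) \<in> mod_hom R P P" by (rule mod_homI) auto
  note h = tensor_map(1)[OF N' P N P f id]
  have step: "(tensor_map R N P f (\<lambda>z. z) (tensor_sum R N' P p u) = \<zero>\<^bsub>tensor R N P\<^esub>) =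
      ((\<lambda>x. f (u x)) \<in> fs_mat N X d ` carrier (fs_mod N Y))" if u: "u \<in> carrier (fs_mod N' X)" for u
    unfolding tensor_sum_natural[OF N' N f P p u] by (rule tensor_sum_zero_iff[OF pr N mod_hom_closed[OF fs_map_hom[OF N' N f] u]])
  have "?L \<longleftrightarrow> (\<forall>t\<in>carrier (tensor R N' P). tensor_map R N P f (\<lambda>z. z) t = \<zero>\<^bsub>tensor R N P\<^esub> \<longrightarrow> t = \<zero>\<^bsub>tensor R N' P\<^esub>)"
    by (rule mod_hom_inj_iff[OF module_tensor[OF N' P] module_tensor[OF N P] h])
  also have "\<dots> \<longleftrightarrow> ?R"
    unfolding tensor_sum_surj[OF pr N', symmetric] by (simp add: step tensor_sum_zero_iff[OF pr N'])
  finally show ?thesis .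
qed

lemma presented_free:
  assumes "cring R"
  shows "presented R (free_mod R X) X (free_gen R) {} (\<lambda>_ _. \<zero>\<^bsub>R\<^esub>)"
proof -
  note F = module_free_mod[OF assms, of X]
  interpret F: module R "free_mod R X" by (rule F)
  have g: "free_gen R \<in> X \<rightarrow> carrier (free_mod R X)" using free_gen_carrier[OF assms] by auto
  have e: "carrier (free_mod R {}) = {\<lambda>_. \<zero>\<^bsub>R\<^esub>}"
    by (auto simp: free_mod_simps fun_eq_iff)
  have z: "free_lift R (free_mod R X) (\<lambda>_ _. \<zero>\<^bsub>R\<^esub>) (\<lambda>_. \<zero>\<^bsub>R\<^esub>) = \<zero>\<^bsub>free_mod R X\<^esub>"
    by (simp add: free_lift_def)
  show ?thesis unfolding presented_def e
  proof (intro conjI ballI)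
    show "free_lift R (free_mod R X) (free_gen R) ` carrier (free_mod R X) = carrier (free_mod R X)"
      by (simp add: free_lift_gen_id[OF assms] cong: image_cong_simp)
    show "free_lift R (free_mod R X) (free_gen R) u = \<zero>\<^bsub>free_mod R X\<^esub> \<longleftrightarrow>
        u \<in> free_lift R (free_mod R X) (\<lambda>_ _. \<zero>\<^bsub>R\<^esub>) ` {\<lambda>_. \<zero>\<^bsub>R\<^esub>}"
      if "u \<in> carrier (free_mod R X)" for u
      using free_lift_gen_id[OF assms that] by (simp add: z)
  qed (use F g in auto)
qed

lemma presented_res:
  assumes M: "module R M"
  shows "presented R M (syz_gens R M 0) syz_elt (syz_gens R M (Suc 0)) (\<lambda>s. lin_comb R (syz_list s))"
proof -
  have c: "cring R" using M by (rule module.axioms)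
  have d: "(\<lambda>s. lin_comb R (syz_list s)) \<in> syz_gens R M (Suc 0) \<rightarrow> carrier (free_mod R (syz_gens R M 0))"
    by (auto intro!: lin_comb_carrier[OF c])
  have K: "{u \<in> carrier (free_mod R (syz_gens R M 0)). free_lift R M syz_elt u = \<zero>\<^bsub>M\<^esub>} =
      free_lift R (free_mod R (syz_gens R M 0)) (\<lambda>s. lin_comb R (syz_list s)) ` carrier (free_mod R (syz_gens R M (Suc 0)))"
    using res_exact(2)[OF M] unfolding a_kernel_def' res_mod_def syz_aug_def res_bd_def syz_bd_def by simp
  show ?thesis unfolding presented_def
  proof (intro conjI ballI)
    show "free_lift R M syz_elt ` carrier (free_mod R (syz_gens R M 0)) = carrier M"
      using res_exact(1)[OF M] by (simp add: syz_aug_def res_mod_def)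
    show "free_lift R M syz_elt u = \<zero>\<^bsub>M\<^esub> \<longleftrightarrow>
      u \<in> free_lift R (free_mod R (syz_gens R M 0)) (\<lambda>s. lin_comb R (syz_list s)) ` carrier (free_mod R (syz_gens R M (Suc 0)))"
      if "u \<in> carrier (free_mod R (syz_gens R M 0))" for u
      unfolding K[symmetric] using that by simp
  qed (use M d in auto)
qed

section \<open>Tor as relative exactness\<close>

abbreviation syz_mat :: "('a, 'r) ring_scheme \<Rightarrow> ('a, 'm) syz \<Rightarrow> ('a, 'm) syz \<Rightarrow> 'a"
  where "syz_mat R \<equiv> \<lambda>s. lin_comb R (syz_list s)"

lemma res_free_complex:
  assumes "module R M"
  shows "free_complex R (syz_gens R M) (\<lambda>_. syz_mat R)"
proof (rule free_complex.intro)
  show c: "cring R" by (rule module_cring[OF assms])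
  show "syz_mat R \<in> syz_gens R M (Suc i) \<rightarrow> carrier (free_mod R (syz_gens R M i))" for i
    by (cases i) (auto intro!: lin_comb_carrier[OF c])
  show "free_lift R (free_mod R (syz_gens R M i)) (syz_mat R) (syz_mat R s) =
      \<zero>\<^bsub>free_mod R (syz_gens R M i)\<^esub>" if "s \<in> syz_gens R M (Suc (Suc i))" for i s
    using that by (auto simp: syz_bd_def free_mod_simps)
qed

lemma zero_mod_quot_iff:
  assumes "module R T" "submodule H R T" "Z \<subseteq> carrier T" "\<zero>\<^bsub>T\<^esub> \<in> Z"
  shows "zero_mod (quot_mod (T\<lparr>carrier := Z\<rparr>) H) \<longleftrightarrow> Z \<subseteq> H"
proof -
  have "carrier (quot_mod (T\<lparr>carrier := Z\<rparr>) H) = (\<lambda>z. H +>\<^bsub>T\<^esub> z) ` Z"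
    by (auto simp: quot_mod_def A_RCOSETS_def' a_r_coset_def')
  moreover have "\<zero>\<^bsub>quot_mod (T\<lparr>carrier := Z\<rparr>) H\<^esub> = H" by (simp add: quot_mod_def)
  moreover have "H +>\<^bsub>T\<^esub> z = H \<longleftrightarrow> z \<in> H" if "z \<in> Z" for z
    using quot_proj(3)[OF assms(1,2) subsetD[OF assms(3) that]] by (simp add: quot_mod_def)
  ultimately show ?thesis using assms(4) unfolding zero_mod_def by (simp add: set_eq_iff image_iff subset_iff) metis
qed

text \<open>Each \<open>N \<otimes> F\<^sub>i\<close> is identified with families on the basis of \<open>F\<^sub>i\<close> by \<open>\<Psi> i\<close>, which is bijective because
  \<open>F\<^sub>i\<close> is presented by its basis without relations; the differentials correspond.\<close>

lemma Tor_zero_iff_rel_exact: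
  assumes M: "module R M" and N: "module R N"
  shows "zero_mod (Tor R (Suc i) N M) \<longleftrightarrow>
    free_complex.rel_exact (syz_gens R M) (\<lambda>_. syz_mat R) N (carrier N) {\<zero>\<^bsub>N\<^esub>} i"
proof -
  interpret free_complex R "syz_gens R M" "\<lambda>_. syz_mat R" by (rule res_free_complex[OF M])
  interpret N: module R N by (rule N)
  let ?F = "\<lambda>i. free_mod R (syz_gens R M i)"
  let ?T = "\<lambda>i. tensor R N (?F i)"
  define \<Psi> where "\<Psi> i = tensor_sum R N (?F i) (free_gen R)" for i
  define bt where "bt i = tor_bd R i N M" for i
  note F = module_free_mod[OF cring]
  note pr = presented_free[OF cring]
  note T = module_tensor[OF N F]
  have g: "free_gen R \<in> syz_gens R M i \<rightarrow> carrier (?F i)" for i using free_gen_carrier[OF cring] by auto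
  have id: "(\<lambda>x. x) \<in> mod_hom R N N" by (rule mod_homI) auto
  have rb: "res_bd R M i \<in> mod_hom R (?F (Suc i)) (?F i)" for i using res_bd_hom[OF M] by (simp add: res_mod_def)
  have bt: "bt i \<in> mod_hom R (?T (Suc i)) (?T i)" for i
    unfolding bt_def tor_bd_def res_mod_def by (rule tensor_map(1)[OF N F N F id rb])
  have \<Psi>: "\<Psi> i \<in> mod_hom R (fs_mod N (syz_gens R M i)) (?T i)" for i
    unfolding \<Psi>_def by (rule tensor_sum_hom[OF N F g])
  have \<Psi>_surj: "\<exists>u. u \<in> chains N i \<and> z = \<Psi> i u" if "z \<in> carrier (?T i)" for z i
  proof -
    from that have "z \<in> \<Psi> i ` chains N i" unfolding \<Psi>_def tensor_sum_surj[OF pr N] .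
    then show ?thesis by (elim imageE) (intro exI conjI)
  qed
  have \<Psi>_ker: "u = (\<lambda>_. \<zero>\<^bsub>N\<^esub>)" if "u \<in> chains N i" "\<Psi> i u = \<zero>\<^bsub>?T i\<^esub>" for u i
  proof -
    have "u \<in> fs_mat N (syz_gens R M i) (\<lambda>_ _. \<zero>\<^bsub>R\<^esub>) ` carrier (fs_mod N {})"
      by (rule tensor_sum_ker[OF pr N that(1) that(2)[unfolded \<Psi>_def]])
    then obtain c where c: "c \<in> carrier (fs_mod N {})" "u = fs_mat N (syz_gens R M i) (\<lambda>_ _. \<zero>\<^bsub>R\<^esub>) c"
      by (elim imageE)
    have "c = (\<lambda>_. \<zero>\<^bsub>N\<^esub>)" using c(1) by (auto simp: fs_mod_simps fun_eq_iff)
    then show ?thesis using mod_hom_zero[OF module_fs_mod[OF N] module_fs_mod[OF N] fs_mat_hom[OF N, where X = "{}" and d = "\<lambda>_ _. \<zero>\<^bsub>R\<^esub>"]]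
      unfolding c(2) by (simp add: fs_mod_simps(2))
  qed
  have bt_\<Psi>: "bt i (\<Psi> (Suc i) u) = \<Psi> i (bd N i u)" if "u \<in> chains N (Suc i)" for i u
  proof (rule fs_hom_eqI[OF N T mod_hom_compose[OF \<Psi> bt] mod_hom_compose[OF bd_hom[OF N] \<Psi>] _ that])
    fix x n assume x: "x \<in> syz_gens R M (Suc i)" and n: "n \<in> carrier N"
    note dx = funcset_mem[OF d_carrier x]
    have "res_bd R M i (free_gen R x) = syz_mat R x"
      unfolding res_bd_def syz_bd_def by (rule free_lift_basis[OF F d_carrier x])
    then have "bt i (\<Psi> (Suc i) (fs_single N x n)) = pure_tensor R N (?F i) n (syz_mat R x)"
      using tensor_map(2)[OF N F N F id rb n free_gen_carrier[OF cring x]]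
      by (simp add: \<Psi>_def bt_def tor_bd_def res_mod_def tensor_sum_single[OF N F g x n])
    also have "\<dots> = \<Psi> i (\<lambda>y. syz_mat R x y \<odot>\<^bsub>N\<^esub> n)"
      unfolding \<Psi>_def using tensor_sum_scale[OF N F g dx n] free_lift_gen_id[OF cring dx] by simp
    finally show "bt i (\<Psi> (Suc i) (fs_single N x n)) = \<Psi> i (bd N i (fs_single N x n))"
      by (simp add: fs_mat_basis[OF N d_carrier x n])
  qed
  define Z where "Z = {z \<in> carrier (?T (Suc i)). bt i z = \<zero>\<^bsub>?T i\<^esub>}"
  define H where "H = bt (Suc i) ` carrier (?T (Suc (Suc i)))"
  have "Tor R (Suc i) N M = quot_mod ((?T (Suc i))\<lparr>carrier := Z\<rparr>) H"
    by (simp add: Tor_def tor_term_def res_mod_def tor_cycles_def a_kernel_def' Z_def H_def bt_def)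
  moreover have "submodule H R (?T (Suc i))"
    unfolding H_def by (rule mod_hom_image_submodule[OF T T bt module.carrier_is_submodule[OF T]])
  moreover have "\<zero>\<^bsub>?T (Suc i)\<^esub> \<in> Z" unfolding Z_def
    using mod_hom_zero[OF T T bt] module.submoduleD(2)[OF T module.carrier_is_submodule[OF T]] by simp
  ultimately have "zero_mod (Tor R (Suc i) N M) \<longleftrightarrow> Z \<subseteq> H"
    using zero_mod_quot_iff[OF T, of H "syz_gens R M (Suc i)" Z] by (simp add: Z_def)
  also have "\<dots> \<longleftrightarrow> rel_exact N (carrier N) {\<zero>\<^bsub>N\<^esub>} i"
  proof
    assume ZH: "Z \<subseteq> H"
    show "rel_exact N (carrier N) {\<zero>\<^bsub>N\<^esub>} i"
    proof (rule rel_exactI)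
      fix u assume u: "u \<in> chains N (Suc i)" "\<And>x. u x \<in> carrier N" "\<And>y. bd N i u y \<in> {\<zero>\<^bsub>N\<^esub>}"
      have "bd N i u = (\<lambda>_. \<zero>\<^bsub>N\<^esub>)" using u(3) by auto
      then have "bt i (\<Psi> (Suc i) u) = \<zero>\<^bsub>?T i\<^esub>"
        using mod_hom_zero[OF module_fs_mod[OF N] T \<Psi>] by (simp add: bt_\<Psi>[OF u(1)] fs_mod_simps(2))
      then have "\<Psi> (Suc i) u \<in> H" using ZH mod_hom_closed[OF \<Psi> u(1)] by (auto simp: Z_def)
      then obtain z where z: "z \<in> carrier (?T (Suc (Suc i)))" "\<Psi> (Suc i) u = bt (Suc i) z"
        unfolding H_def by (elim imageE)
      from \<Psi>_surj[OF z(1)] obtain h where h: "h \<in> chains N (Suc (Suc i))" "z = \<Psi> (Suc (Suc i)) h"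
        by (elim exE conjE)
      note bh = bd_chain[OF N h(1)]
      interpret T: module R "?T (Suc i)" by (rule T)
      have "\<Psi> (Suc i) u = \<Psi> (Suc i) (bd N (Suc i) h)" by (simp add: z(2) h(2) bt_\<Psi>[OF h(1)])
      then have "\<Psi> (Suc i) (u \<ominus>\<^bsub>fs_mod N (syz_gens R M (Suc i))\<^esub> bd N (Suc i) h) = \<zero>\<^bsub>?T (Suc i)\<^esub>"
        using mod_hom_diff[OF module_fs_mod[OF N] T \<Psi> u(1) bh] mod_hom_closed[OF \<Psi> bh]
        by (simp add: T.M.diff_eq_zero_iff)
      then have "(\<lambda>x. u x \<ominus>\<^bsub>N\<^esub> bd N (Suc i) h x) = (\<lambda>_. \<zero>\<^bsub>N\<^esub>)"
        using \<Psi>_ker[OF chain_diff[OF N u(1) bh]] by (simp add: fs_mod_diff[OF N u(1) bh])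
      then show "\<exists>h\<in>chains N (Suc (Suc i)). (\<forall>x. h x \<in> carrier N) \<and>
          (\<forall>x. u x \<ominus>\<^bsub>N\<^esub> bd N (Suc i) h x \<in> {\<zero>\<^bsub>N\<^esub>})"
        using chain_carrier[OF h(1)] by (intro bexI[OF _ h(1)] conjI allI) (simp_all add: fun_eq_iff)
    qed
  next
    assume ex: "rel_exact N (carrier N) {\<zero>\<^bsub>N\<^esub>} i"
    show "Z \<subseteq> H"
    proof
      fix z assume "z \<in> Z"
      then have z: "z \<in> carrier (?T (Suc i))" "bt i z = \<zero>\<^bsub>?T i\<^esub>" by (simp_all add: Z_def)
      from \<Psi>_surj[OF z(1)] obtain u where u: "u \<in> chains N (Suc i)" "z = \<Psi> (Suc i) u"
        by (elim exE conjE)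
      have "\<Psi> i (bd N i u) = \<zero>\<^bsub>?T i\<^esub>" using z(2) by (simp add: u(2) bt_\<Psi>[OF u(1)])
      from \<Psi>_ker[OF bd_chain[OF N u(1)] this] have "bd N i u y \<in> {\<zero>\<^bsub>N\<^esub>}" for y by simp
      then obtain h where h: "h \<in> chains N (Suc (Suc i))"
        "\<And>x. u x \<ominus>\<^bsub>N\<^esub> bd N (Suc i) h x \<in> {\<zero>\<^bsub>N\<^esub>}"
        by (rule rel_exactE[OF ex u(1) chain_carrier[OF u(1)]]) blast
      have "u x = bd N (Suc i) h x" for x
        using h(2)[of x] chain_carrier[OF u(1), of x] chain_carrier[OF bd_chain[OF N h(1)], of x]
        by (simp add: N.M.diff_eq_zero_iff)
      then have "u = bd N (Suc i) h" by (rule ext)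
      then have "z = bt (Suc i) (\<Psi> (Suc (Suc i)) h)" by (simp add: u(2) bt_\<Psi>[OF h(1)])
      then show "z \<in> H" unfolding H_def using mod_hom_closed[OF \<Psi> h(1)] by (rule image_eqI)
    qed
  qed
  finally show ?thesis .
qed

section \<open>Copies of quotients in a given universe\<close>

lemma module_surj_image:
  assumes N: "module R N" and car: "carrier Q = s ` carrier N" and zero: "\<zero>\<^bsub>Q\<^esub> = s \<zero>\<^bsub>N\<^esub>"
    and add: "\<And>x y. x \<in> carrier N \<Longrightarrow> y \<in> carrier N \<Longrightarrow> s x \<oplus>\<^bsub>Q\<^esub> s y = s (x \<oplus>\<^bsub>N\<^esub> y)"
    and smult: "\<And>a x. a \<in> carrier R \<Longrightarrow> x \<in> carrier N \<Longrightarrow> a \<odot>\<^bsub>Q\<^esub> s x = s (a \<odot>\<^bsub>N\<^esub> x)"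
  shows "module R Q"
proof -
  interpret module R N by (rule N)
  show ?thesis
  proof (intro moduleI abelian_groupI R.is_cring, goal_cases)
    case (6 q)
    then obtain x where x: "x \<in> carrier N" "q = s x" by (auto simp: car)
    then show ?case by (intro bexI[of _ "s (\<ominus>\<^bsub>N\<^esub> x)"]) (auto simp: car add zero M.l_neg)
  qed (auto simp: car zero add smult M.a_ac smult_l_distr smult_r_distr smult_assoc1)
qed

text \<open>A quotient of \<open>N\<close> is no larger than \<open>N\<close>: label each coset by the image under \<open>\<iota>\<close> of a representative
  and transport the structure to the labels.\<close>

lemma quotient_copy:
  fixes \<iota> :: "'b \<Rightarrow> 'n" and N :: "('a, 'b, 'q) module_scheme"
  assumes N: "module R N" and H: "submodule H R N" and \<iota>: "inj_on \<iota> (carrier N)"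
  obtains Q :: "('a, 'n) module" and s where "module R Q" "s \<in> mod_hom R N Q" "s ` carrier N = carrier Q"
    "{n \<in> carrier N. s n = \<zero>\<^bsub>Q\<^esub>} = H"
proof -
  interpret module R N by (rule N)
  define K where "K = quot_mod N H"
  define q where "q = (\<lambda>x. H +>\<^bsub>N\<^esub> x)"
  have K: "module R K" unfolding K_def by (rule module_quot_mod(1)[OF N H])
  have q: "q \<in> mod_hom R N K" unfolding q_def K_def by (rule quot_proj(1)[OF N H])
  have q0: "q x = \<zero>\<^bsub>K\<^esub> \<longleftrightarrow> x \<in> H" if "x \<in> carrier N" for x
    unfolding q_def K_def by (rule quot_proj(3)[OF N H that])
  define r where "r x = (SOME y. y \<in> carrier N \<and> q y = q x)" for x
  have r: "r x \<in> carrier N \<and> q (r x) = q x" if "x \<in> carrier N" for x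
  proof -
    have "\<exists>y. y \<in> carrier N \<and> q y = q x" using that by blast
    from someI_ex[OF this] show ?thesis by (simp add: r_def)
  qed
  define s where "s x = \<iota> (r x)" for x
  have s_eq: "s x = s y \<longleftrightarrow> q x = q y" if "x \<in> carrier N" "y \<in> carrier N" for x y
  proof
    assume "s x = s y"
    then have "r x = r y" using r that \<iota> by (auto simp: s_def inj_on_def)
    then show "q x = q y" using r that by metis
  next
    assume "q x = q y"
    then show "s x = s y" by (simp add: s_def r_def)
  qed
  define t where "t = inv_into (carrier N) s"
  have t: "t (s x) \<in> carrier N" "q (t (s x)) = q x" if "x \<in> carrier N" for x
  proof -
    have "s x \<in> s ` carrier N" using that by (rule imageI)
    from inv_into_into[OF this] f_inv_into_f[OF this]
    show "t (s x) \<in> carrier N" "q (t (s x)) = q x" using s_eq that by (simp_all add: t_def)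
  qed
  define Q :: "('a, 'n) module" where
    "Q = \<lparr>carrier = s ` carrier N, mult = undefined, one = undefined, zero = s \<zero>\<^bsub>N\<^esub>,
      add = (\<lambda>a b. s (t a \<oplus>\<^bsub>N\<^esub> t b)), smult = (\<lambda>c a. s (c \<odot>\<^bsub>N\<^esub> t a))\<rparr>"
  have add: "s x \<oplus>\<^bsub>Q\<^esub> s y = s (x \<oplus>\<^bsub>N\<^esub> y)" if "x \<in> carrier N" "y \<in> carrier N" for x y
    using that by (simp add: Q_def s_eq t mod_hom_add[OF q])
  have smult: "a \<odot>\<^bsub>Q\<^esub> s x = s (a \<odot>\<^bsub>N\<^esub> x)" if "a \<in> carrier R" "x \<in> carrier N" for a x
    using that by (simp add: Q_def s_eq t mod_hom_smult[OF q])
  have "module R Q" by (rule module_surj_image[OF N _ _ add smult]) (simp_all add: Q_def)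
  moreover have "s \<in> mod_hom R N Q" by (rule mod_homI) (simp_all add: add smult, simp add: Q_def)
  moreover have "s ` carrier N = carrier Q" by (simp add: Q_def)
  moreover have "s x = \<zero>\<^bsub>Q\<^esub> \<longleftrightarrow> x \<in> H" if "x \<in> carrier N" for x
    using q0[OF that] that by (simp add: Q_def s_eq mod_hom_zero[OF N K q])
  then have "{n \<in> carrier N. s n = \<zero>\<^bsub>Q\<^esub>} = H" using submoduleD(1)[OF H] by auto
  ultimately show ?thesis by (rule that)
qed

section \<open>Change of rings\<close>

text \<open>The two structures may be modules over different rings, with different record types, so they need
  not be comparable; sums only depend on the additive part.\<close>

lemma finsum_cong_structure:
  assumes "carrier G = carrier G'" "add G = add G'" "\<zero>\<^bsub>G\<^esub> = \<zero>\<^bsub>G'\<^esub>"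
  shows "finsum G f S = finsum G' f S"
  using assms by (simp add: finsum_def finprod_def)

definition restrict_scalars :: "('a \<Rightarrow> 'b) \<Rightarrow> ('b, 'n, 'q) module_scheme \<Rightarrow> ('a, 'n) module"
  where "restrict_scalars \<phi> N =
    \<lparr>carrier = carrier N, mult = mult N, one = \<one>\<^bsub>N\<^esub>, zero = \<zero>\<^bsub>N\<^esub>, add = add N,
     smult = (\<lambda>a n. \<phi> a \<odot>\<^bsub>N\<^esub> n)\<rparr>"

lemma restrict_scalars_simps:
  "carrier (restrict_scalars \<phi> N) = carrier N" "\<zero>\<^bsub>restrict_scalars \<phi> N\<^esub> = \<zero>\<^bsub>N\<^esub>"
  "add (restrict_scalars \<phi> N) = add N" "a \<odot>\<^bsub>restrict_scalars \<phi> N\<^esub> n = \<phi> a \<odot>\<^bsub>N\<^esub> n"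
  by (simp_all add: restrict_scalars_def)

context
  fixes R :: "('a, 'r) ring_scheme" and B :: "('b, 's) ring_scheme" and \<phi> :: "'a \<Rightarrow> 'b"
  assumes R: "cring R" and B: "cring B" and \<phi>: "\<phi> \<in> ring_hom R B"
begin

lemma ring_hom_zero: "\<phi> \<zero>\<^bsub>R\<^esub> = \<zero>\<^bsub>B\<^esub>"
  using ring_hom_zero[OF \<phi>] cring.axioms(1)[OF R] cring.axioms(1)[OF B] by blast

lemma module_restrict_scalars:
  assumes "module B N"
  shows "module R (restrict_scalars \<phi> N)"
proof -
  interpret module B N by (rule assms)
  note h = ring_hom_closed[OF \<phi>] ring_hom_add[OF \<phi>] ring_hom_mult[OF \<phi>] ring_hom_one[OF \<phi>]
  show ?thesis
  proof (intro moduleI abelian_groupI R, goal_cases)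
    case (6 n)
    then show ?case by (intro bexI[of _ "\<ominus>\<^bsub>N\<^esub> n"]) (auto simp: restrict_scalars_simps M.l_neg)
  qed (auto simp: restrict_scalars_simps h M.a_ac smult_l_distr smult_r_distr smult_assoc1)
qed

lemma restrict_scalars_ring: "restrict_scalars \<phi> (ring_as_mod B (\<lambda>b. b)) = ring_as_mod B \<phi>"
  by (simp add: restrict_scalars_def ring_as_mod_def)

lemma module_ring_hom: "module R (ring_as_mod B \<phi>)"
  using module_restrict_scalars[OF module_ring_as_mod[OF B]] unfolding restrict_scalars_ring .

lemma hom_ring_as_mod: "\<phi> \<in> mod_hom R (ring_as_mod R (\<lambda>a. a)) (ring_as_mod B \<phi>)"
  by (rule mod_homI)
    (auto simp: ring_as_mod_simps ring_hom_closed[OF \<phi>] ring_hom_add[OF \<phi>] ring_hom_mult[OF \<phi>])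

lemma fs_mod_restrict: "carrier (fs_mod (restrict_scalars \<phi> N) X) = carrier (fs_mod N X)"
  by (auto simp: fs_mod_simps restrict_scalars_simps)

lemma fs_mat_restrict:
  "fs_mat (restrict_scalars \<phi> N) X d = fs_mat N X (\<lambda>y x. \<phi> (d y x))"
proof
  fix g
  show "fs_mat (restrict_scalars \<phi> N) X d g = fs_mat N X (\<lambda>y x. \<phi> (d y x)) g"
    unfolding fs_mat_def fs_lift_def restrict_scalars_simps
    by (rule finsum_cong_structure) (auto simp: fs_mod_def restrict_scalars_simps)
qed

lemma mod_hom_restrict:
  "f \<in> mod_hom B N N' \<Longrightarrow> f \<in> mod_hom R (restrict_scalars \<phi> N) (restrict_scalars \<phi> N')"
  by (auto simp: mod_hom_def restrict_scalars_simps ring_hom_closed[OF \<phi>])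

lemma submodule_restrict:
  assumes N: "module B N" and "submodule H B N"
  shows "submodule H R (restrict_scalars \<phi> N)"
proof -
  interpret N: module B N by (rule N)
  note H = N.submoduleD[OF assms(2)]
  note rN = module_restrict_scalars[OF N]
  show ?thesis
  proof (rule module.submoduleI[OF rN])
    fix n assume n: "n \<in> H"
    have "\<ominus>\<^bsub>restrict_scalars \<phi> N\<^esub> n = \<ominus>\<^bsub>N\<^esub> n"
      by (simp add: a_inv_def m_inv_def restrict_scalars_def)
    then show "\<ominus>\<^bsub>restrict_scalars \<phi> N\<^esub> n \<in> H" using H(4)[OF n] by simp
  qed (use H ring_hom_closed[OF \<phi>] in \<open>auto simp: restrict_scalars_simps\<close>)
qed

lemma submodule_unrestrict:
  assumes N: "module B N" and "submodule H R (restrict_scalars \<phi> N)" and surj: "\<phi> ` carrier R = carrier B"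
  shows "submodule H B N"
proof -
  interpret N: module B N by (rule N)
  note rN = module_restrict_scalars[OF N]
  note H = module.submoduleD[OF rN assms(2), unfolded restrict_scalars_simps]
  show ?thesis
  proof (rule N.submoduleI)
    fix n assume n: "n \<in> H"
    have "\<ominus>\<^bsub>restrict_scalars \<phi> N\<^esub> n = \<ominus>\<^bsub>N\<^esub> n"
      by (simp add: a_inv_def m_inv_def restrict_scalars_def)
    then show "\<ominus>\<^bsub>N\<^esub> n \<in> H" using H(4)[OF n] by simp
    show "b \<odot>\<^bsub>N\<^esub> n \<in> H" if "b \<in> carrier B" for b
    proof -
      from that have "b \<in> \<phi> ` carrier R" by (simp only: surj)
      then show ?thesis using H(6)[OF _ n] by auto
    qed
  qed (use H in auto)
qed

end

section \<open>Base change\<close>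

context
  fixes R :: "('a, 'r) ring_scheme" and B :: "('b, 's) ring_scheme" and \<phi> :: "'a \<Rightarrow> 'b"
    and M :: "('a, 'm, 'p) module_scheme"
  assumes R: "cring R" and B: "cring B" and \<phi>: "\<phi> \<in> ring_hom R B" and M: "module R M"
begin

abbreviation (input) BM where "BM \<equiv> ring_as_mod B \<phi>"
abbreviation (input) mult_map where "mult_map b \<equiv> tensor_map R BM M (\<lambda>b'. b \<otimes>\<^bsub>B\<^esub> b') (\<lambda>x. x)"

lemma base_change_simps:
  "carrier (base_change R B \<phi> M) = carrier (tensor R BM M)"
  "\<zero>\<^bsub>base_change R B \<phi> M\<^esub> = \<zero>\<^bsub>tensor R BM M\<^esub>"
  "add (base_change R B \<phi> M) = add (tensor R BM M)"
  "b \<odot>\<^bsub>base_change R B \<phi> M\<^esub> t = mult_map b t"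
  by (simp_all add: base_change_def Let_def)

lemma mult_map:
  assumes b: "b \<in> carrier B"
  shows "mult_map b \<in> mod_hom R (tensor R BM M) (tensor R BM M)"
    and "b' \<in> carrier B \<Longrightarrow> x \<in> carrier M \<Longrightarrow>
      mult_map b (pure_tensor R BM M b' x) = pure_tensor R BM M (b \<otimes>\<^bsub>B\<^esub> b') x"
proof -
  interpret B: cring B by (rule B)
  have l: "(\<lambda>b'. b \<otimes>\<^bsub>B\<^esub> b') \<in> mod_hom R BM BM"
    by (rule mod_homI) (use b in \<open>auto simp: ring_as_mod_simps B.r_distr B.m_lcomm ring_hom_closed[OF \<phi>]\<close>)
  have id: "(\<lambda>x. x) \<in> mod_hom R M M" by (rule mod_homI) auto
  note mB = module_ring_hom[OF R B \<phi>]
  note t = tensor_map[OF mB M mB M l id]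
  show "mult_map b \<in> mod_hom R (tensor R BM M) (tensor R BM M)" by (rule t(1))
  show "mult_map b (pure_tensor R BM M b' x) = pure_tensor R BM M (b \<otimes>\<^bsub>B\<^esub> b') x"
    if "b' \<in> carrier B" "x \<in> carrier M" by (rule t(2)) (use that in \<open>simp_all add: ring_as_mod_simps\<close>)
qed

lemma module_base_change: "module B (base_change R B \<phi> M)"
proof -
  note mB = module_ring_hom[OF R B \<phi>]
  note T = module_tensor[OF mB M]
  interpret T: module R "tensor R BM M" by (rule T)
  interpret B: cring B by (rule B)
  have pl: "pure_tensor R BM M (b \<oplus>\<^bsub>B\<^esub> c) x = pure_tensor R BM M b x \<oplus>\<^bsub>tensor R BM M\<^esub> pure_tensor R BM M c x"
    if "b \<in> carrier B" "c \<in> carrier B" "x \<in> carrier M" for b c x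
    using mod_hom_add[OF pure_tensor_hom_left[OF mB M that(3)], of b c] that by (simp add: ring_as_mod_simps)
  have c: "carrier BM = carrier B" by (simp add: ring_as_mod_simps)
  note eqI = tensor_hom_eqI[OF mB M T, unfolded c]
  have distr: "mult_map (b \<oplus>\<^bsub>B\<^esub> c) t = mult_map b t \<oplus>\<^bsub>tensor R BM M\<^esub> mult_map c t"
    if b: "b \<in> carrier B" and c: "c \<in> carrier B" and t: "t \<in> carrier (tensor R BM M)" for b c t
    by (rule eqI[OF mult_map(1)[OF B.a_closed[OF b c]] mod_hom_sum[OF T mult_map(1)[OF b] mult_map(1)[OF c]] _ t])
      (use b c in \<open>simp add: mult_map(2) B.l_distr pl\<close>)
  have assoc: "mult_map (b \<otimes>\<^bsub>B\<^esub> c) t = mult_map b (mult_map c t)"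
    if b: "b \<in> carrier B" and c: "c \<in> carrier B" and t: "t \<in> carrier (tensor R BM M)" for b c t
    by (rule eqI[OF mult_map(1)[OF B.m_closed[OF b c]] mod_hom_compose[OF mult_map(1)[OF c] mult_map(1)[OF b]] _ t])
      (use b c in \<open>simp add: mult_map(2) B.m_assoc\<close>)
  have id: "(\<lambda>t. t) \<in> mod_hom R (tensor R BM M) (tensor R BM M)" by (rule mod_homI) auto
  have one: "mult_map \<one>\<^bsub>B\<^esub> t = t" if t: "t \<in> carrier (tensor R BM M)" for t
    by (rule eqI[OF mult_map(1)[OF B.one_closed] id _ t]) (simp add: mult_map(2))
  show ?thesis
  proof (intro moduleI abelian_groupI B, goal_cases)
    case (6 t)
    then show ?case
      by (intro bexI[of _ "\<ominus>\<^bsub>tensor R BM M\<^esub> t"]) (auto simp: base_change_simps T.M.l_neg)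
  qed (auto simp: base_change_simps T.M.a_ac distr assoc one mod_hom_closed[OF mult_map(1)] mod_hom_add[OF mult_map(1)])
qed

text \<open>Right exactness for \<open>N = B\<close> describes \<open>B \<otimes> M\<close> as families in \<open>B\<close> modulo the image of the matrix, which
  is a presentation over \<open>B\<close>: a finite combination of the generators \<open>1 \<otimes> p x\<close> with coefficients in \<open>B\<close>
  is exactly \<open>tensor_sum\<close>.\<close>

lemma presented_base_change:
  assumes pr: "presented R M X p Y d"
  shows "presented B (base_change R B \<phi> M) X (\<lambda>x. pure_tensor R BM M \<one>\<^bsub>B\<^esub> (p x)) Y (\<lambda>y x. \<phi> (d y x))"
proof -
  let ?P = "base_change R B \<phi> M"
  let ?p = "\<lambda>x. pure_tensor R BM M \<one>\<^bsub>B\<^esub> (p x)"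
  let ?d = "\<lambda>y x. \<phi> (d y x)"
  have p: "p \<in> X \<rightarrow> carrier M" and d: "d \<in> Y \<rightarrow> carrier (free_mod R X)"
    using pr by (simp_all add: presented_def)
  note mB = module_ring_hom[OF R B \<phi>]
  note T = module_tensor[OF mB M]
  interpret T: module R "tensor R BM M" by (rule T)
  interpret B: cring B by (rule B)
  have P: "module B ?P" by (rule module_base_change)
  have free: "carrier (free_mod B Z) = carrier (fs_mod BM Z)" for Z :: "'z set"
    by (auto simp: free_mod_simps fs_mod_simps ring_as_mod_simps)
  have dB: "?d y \<in> carrier (free_mod B X)" if "y \<in> Y" for y
  proof -
    have dy: "d y \<in> carrier (free_mod R X)" by (rule funcset_mem[OF d that])
    then have "{x. ?d y x \<noteq> \<zero>\<^bsub>B\<^esub>} \<subseteq> {x. d y x \<noteq> \<zero>\<^bsub>R\<^esub>}" using ring_hom_zero[OF R B \<phi>] by auto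
    with dy show ?thesis
      using finite_subset ring_hom_closed[OF \<phi>] ring_hom_zero[OF R B \<phi>] by (auto simp: free_mod_simps)
  qed
  have pB: "?p \<in> X \<rightarrow> carrier ?P"
    using pure_tensor_closed[OF mB M] p by (auto simp: base_change_simps ring_as_mod_simps)
  have sum: "free_lift B ?P ?p u = tensor_sum R BM M p u" if u: "u \<in> carrier (free_mod B X)" for u
  proof -
    have "free_lift B ?P ?p u = (\<Oplus>\<^bsub>?P\<^esub>x\<in>{x. u x \<noteq> \<zero>\<^bsub>B\<^esub>}. pure_tensor R BM M (u x) (p x))"
      unfolding free_lift_def
    proof (rule abelian_monoid.finsum_cong'[OF abelian_group.axioms(1)[OF module.axioms(2)[OF P]]])
      have ux: "u x \<in> carrier B" "u x \<noteq> \<zero>\<^bsub>B\<^esub> \<Longrightarrow> x \<in> X" for x using u by (auto simp: free_mod_simps)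
      show "(\<lambda>x. pure_tensor R BM M (u x) (p x)) \<in> {x. u x \<noteq> \<zero>\<^bsub>B\<^esub>} \<rightarrow> carrier ?P"
        using pure_tensor_closed[OF mB M] funcset_mem[OF p] ux by (auto simp: base_change_simps ring_as_mod_simps)
      show "u x \<odot>\<^bsub>?P\<^esub> ?p x = pure_tensor R BM M (u x) (p x)" if "x \<in> {x. u x \<noteq> \<zero>\<^bsub>B\<^esub>}" for x
        using ux[of x] that funcset_mem[OF p] by (simp add: base_change_simps mult_map(2))
    qed simp
    also have "\<dots> = tensor_sum R BM M p u"
      unfolding tensor_sum_def fs_lift_def
      by (simp add: finsum_cong_structure[of ?P "tensor R BM M"] base_change_simps ring_as_mod_simps)
    finally show ?thesis .
  qed
  have lift: "free_lift B (free_mod B X) ?d c = fs_mat BM X d c" if c: "c \<in> carrier (free_mod B Y)" for c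
  proof -
    have F: "module B (free_mod B X)" by (rule module_free_mod[OF B])
    have cy: "c y \<in> carrier B" "c y \<noteq> \<zero>\<^bsub>B\<^esub> \<Longrightarrow> y \<in> Y" for y using c by (auto simp: free_mod_simps)
    have "free_lift B (free_mod B X) ?d c =
        (\<Oplus>\<^bsub>free_mod B X\<^esub>y\<in>{y. c y \<noteq> \<zero>\<^bsub>B\<^esub>}. (\<lambda>x. d y x \<odot>\<^bsub>BM\<^esub> c y))"
      unfolding free_lift_def
    proof (rule abelian_monoid.finsum_cong'[OF abelian_group.axioms(1)[OF module.axioms(2)[OF F]]])
      have *: "c y \<odot>\<^bsub>free_mod B X\<^esub> ?d y = (\<lambda>x. d y x \<odot>\<^bsub>BM\<^esub> c y)" if "y \<in> {y. c y \<noteq> \<zero>\<^bsub>B\<^esub>}" for y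
        using cy[of y] that dB[of y] by (auto simp: free_mod_simps ring_as_mod_simps B.m_comm)
      then show "c y \<odot>\<^bsub>free_mod B X\<^esub> ?d y = (\<lambda>x. d y x \<odot>\<^bsub>BM\<^esub> c y)" if "y \<in> {y. c y \<noteq> \<zero>\<^bsub>B\<^esub>}" for y
        using that by blast
      show "(\<lambda>y x. d y x \<odot>\<^bsub>BM\<^esub> c y) \<in> {y. c y \<noteq> \<zero>\<^bsub>B\<^esub>} \<rightarrow> carrier (free_mod B X)"
      proof
        fix y assume y: "y \<in> {y. c y \<noteq> \<zero>\<^bsub>B\<^esub>}"
        have "c y \<odot>\<^bsub>free_mod B X\<^esub> ?d y \<in> carrier (free_mod B X)"
          using module.smult_closed[OF F cy(1)[of y] dB[OF cy(2)]] y by simp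
        then show "(\<lambda>x. d y x \<odot>\<^bsub>BM\<^esub> c y) \<in> carrier (free_mod B X)" using *[OF y] by simp
      qed
    qed simp
    also have "\<dots> = fs_mat BM X d c"
      unfolding fs_mat_def fs_lift_def ring_as_mod_simps(2)
      by (rule finsum_cong_structure) (auto simp: free_mod_def fs_mod_def ring_as_mod_def)
    finally show ?thesis .
  qed
  have lift_image: "free_lift B (free_mod B X) ?d ` carrier (free_mod B Y) = fs_mat BM X d ` carrier (fs_mod BM Y)"
    using lift unfolding free by (intro image_cong) auto
  show ?thesis unfolding presented_def
  proof (intro conjI ballI)
    show "free_lift B ?P ?p ` carrier (free_mod B X) = carrier ?P"
    proof -
      have "free_lift B ?P ?p ` carrier (free_mod B X) = tensor_sum R BM M p ` carrier (fs_mod BM X)"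
        using sum unfolding free by (intro image_cong) auto
      then show ?thesis by (simp add: tensor_sum_surj[OF pr mB] base_change_simps)
    qed
    show "free_lift B ?P ?p u = \<zero>\<^bsub>?P\<^esub> \<longleftrightarrow> u \<in> free_lift B (free_mod B X) ?d ` carrier (free_mod B Y)"
      if u: "u \<in> carrier (free_mod B X)" for u
    proof -
      have u': "u \<in> carrier (fs_mod BM X)" using u unfolding free .
      show ?thesis unfolding sum[OF u] lift_image base_change_simps
        by (rule tensor_sum_zero_iff[OF pr mB u'])
    qed
  qed (use P pB dB in auto)
qed

end

section \<open>Adic flatness and flatness of the base change\<close>

text \<open>From here on the bases of the resolution are opaque index sets.\<close>

declare syz_gens.simps [simp del]

text \<open>Adic flatness tests modules in \<open>'n\<close> only, but reaches every quotient of a module that embeds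
  in \<open>'n\<close> as a set.\<close>

lemma adically_flat_rel_exact:
  fixes R :: "('a, 'r) ring_scheme" and M :: "('a, 'm, 'p) module_scheme"
    and N :: "('a, 'b, 'q) module_scheme" and \<iota> :: "'b \<Rightarrow> 'n"
  assumes flat: "adically_flat TYPE('n) R I M" and M: "module R M" and N: "module R N"
    and \<iota>: "inj_on \<iota> (carrier N)" and H: "submodule H R N"
    and pow: "\<And>a x. a \<in> ideal_pow R I n \<Longrightarrow> x \<in> carrier N \<Longrightarrow> a \<in> carrier R \<and> a \<odot>\<^bsub>N\<^esub> x \<in> H"
  shows "free_complex.rel_exact (syz_gens R M) (\<lambda>_. syz_mat R) N (carrier N) H j"
proof -
  interpret free_complex R "syz_gens R M" "\<lambda>_. syz_mat R" by (rule res_free_complex[OF M])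
  obtain Q :: "('a, 'n) module" and s where Q: "module R Q" and s: "s \<in> mod_hom R N Q"
    and surj: "s ` carrier N = carrier Q" and ker: "{x \<in> carrier N. s x = \<zero>\<^bsub>Q\<^esub>} = H"
    by (rule quotient_copy[OF N H \<iota>])
  have "adic_torsion R I Q" unfolding adic_torsion_def
  proof (intro ballI exI)
    fix q a assume q: "q \<in> carrier Q" and a: "a \<in> ideal_pow R I n"
    from q have "q \<in> s ` carrier N" by (simp only: surj)
    then obtain x where x: "x \<in> carrier N" "q = s x" by (elim imageE)
    have "a \<odot>\<^bsub>N\<^esub> x \<in> {x \<in> carrier N. s x = \<zero>\<^bsub>Q\<^esub>}" unfolding ker using pow[OF a x(1)] by simp
    then show "a \<odot>\<^bsub>Q\<^esub> q = \<zero>\<^bsub>Q\<^esub>" using mod_hom_smult[OF s _ x(1)] pow[OF a x(1)] by (simp add: x(2))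
  qed
  then have "zero_mod (Tor R (Suc j) Q M)" using flat Q by (simp add: adically_flat_def)
  then have "rel_exact Q (carrier Q) {\<zero>\<^bsub>Q\<^esub>} j" by (simp add: Tor_zero_iff_rel_exact[OF M Q])
  then show ?thesis by (simp add: rel_exact_quotient[OF N Q s surj] ker)
qed

locale ring_surjection =
  fixes R :: "('a, 'r) ring_scheme" and B :: "('b, 's) ring_scheme" and \<phi> :: "'a \<Rightarrow> 'b"
    and M :: "('a, 'm, 'p) module_scheme" and J :: "'a set"
  assumes R: "cring R" and B: "cring B" and \<phi>: "\<phi> \<in> ring_hom R B" and M: "module R M"
    and surj: "\<phi> ` carrier R = carrier B"
    and J: "ideal J R" and ker: "\<And>a. a \<in> carrier R \<Longrightarrow> \<phi> a = \<zero>\<^bsub>B\<^esub> \<longleftrightarrow> a \<in> J"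

sublocale ring_surjection \<subseteq> free_complex R "syz_gens R M" "\<lambda>_. syz_mat R"
  by (rule res_free_complex[OF M])

context ring_surjection
begin

abbreviation BM where "BM \<equiv> ring_as_mod B \<phi>"
abbreviation chB :: "('b, 'n, 'q) module_scheme \<Rightarrow> nat \<Rightarrow> (('a, 'm) syz \<Rightarrow> 'n) set"
  where "chB N i \<equiv> carrier (fs_mod N (syz_gens R M i))"

abbreviation X where "X \<equiv> syz_gens R M"
abbreviation res where "res N \<equiv> restrict_scalars \<phi> N"

lemmas module_RR = module_ring_as_mod[OF R]
lemmas module_BM = module_ring_hom[OF R B \<phi>]
lemmas module_res = module_restrict_scalars[OF R B \<phi>]

lemma J_carrier: "a \<in> J \<Longrightarrow> a \<in> carrier R"
  by (rule ideal.Icarr[OF J])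

lemma ker_BM: "{a \<in> carrier RR. \<phi> a = \<zero>\<^bsub>BM\<^esub>} = J"
  using ker J_carrier by (auto simp: ring_as_mod_simps)

lemma Tor_iff_rel_exact: "zero_mod (Tor R (Suc j) BM M) \<longleftrightarrow> rel_exact RR (carrier R) J j"
  using rel_exact_quotient[OF module_RR module_BM hom_ring_as_mod[OF R B \<phi>], of j] surj
  by (simp add: Tor_zero_iff_rel_exact[OF M module_BM] ker_BM) (simp add: ring_as_mod_simps)

text \<open>Flatness over \<open>B\<close> of the base change, as a statement about the lowest differential of the resolution
  over \<open>R\<close>: tensoring a \<open>B\<close>-module with the base change over \<open>B\<close> is tensoring it with \<open>M\<close> over \<open>R\<close>.\<close>

lemma flat_base_change_iff:
  "flat_mod TYPE('n) B (base_change R B \<phi> M) \<longleftrightarrow>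
    (\<forall>(N' :: ('b, 'n) module) (N :: ('b, 'n) module) f.
       module B N' \<and> module B N \<and> f \<in> mod_hom B N' N \<and> inj_on f (carrier N') \<longrightarrow>
       (\<forall>u\<in>chB N' 0. (\<lambda>x. f (u x)) \<in> bd (res N) 0 ` chB N (Suc 0) \<longrightarrow>
          u \<in> bd (res N') 0 ` chB N' (Suc 0)))"
proof -
  note pr = presented_base_change[OF R B \<phi> M presented_res[OF M]]
  show ?thesis
    unfolding flat_mod_def fs_mat_restrict[OF R B \<phi>]
    by (auto simp: module_base_change[OF R B \<phi> M] tensor_map_inj_iff[OF pr])
qed

text \<open>For an injection \<open>f\<close> with image \<open>H\<close>, the quotient \<open>N / H\<close> is torsion. If \<open>f u\<close> is the boundary of
  \<open>g\<close>, then \<open>g\<close> is a cycle modulo \<open>H\<close>; correcting \<open>g\<close> by a boundary moves its values into \<open>H\<close>, where \<open>f\<close>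
  can be inverted.\<close>

lemma adically_flat_imp_flat:
  assumes flat: "adically_flat TYPE('n) R I M" and pow: "ideal_pow R I n \<subseteq> J"
  shows "flat_mod TYPE('n) B (base_change R B \<phi> M)"
  unfolding flat_base_change_iff
proof (intro allI impI ballI, elim conjE)
  fix N' N :: "('b, 'n) module" and f u
  assume N': "module B N'" and N: "module B N" and f: "f \<in> mod_hom B N' N" and inj: "inj_on f (carrier N')"
    and u: "u \<in> chB N' 0" and fu: "(\<lambda>x. f (u x)) \<in> bd (res N) 0 ` chB N (Suc 0)"
  interpret N: module B N by (rule N)
  note rN = module_res[OF N] and rN' = module_res[OF N'] and rf = mod_hom_restrict[OF R B \<phi> f]
  interpret rN: module R "res N" by (rule rN)
  define H where "H = f ` carrier N'"
  have HB: "submodule H B N"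
    unfolding H_def by (rule mod_hom_image_submodule[OF N' N f module.carrier_is_submodule[OF N']])
  note H = submodule_restrict[OF R B \<phi> N HB]
  from fu obtain g where g: "g \<in> chains (res N) (Suc 0)" "(\<lambda>x. f (u x)) = bd (res N) 0 g"
    unfolding fs_mod_restrict[OF R B \<phi>, symmetric] by (elim imageE)
  have "rel_exact (res N) (carrier (res N)) H 0"
  proof (rule adically_flat_rel_exact[OF flat M rN _ H])
    show "inj_on (\<lambda>x. x) (carrier (res N))" by simp
    fix a x assume a: "a \<in> ideal_pow R I n" and x: "x \<in> carrier (res N)"
    have aJ: "a \<in> J" using a pow by blast
    have "a \<odot>\<^bsub>res N\<^esub> x = \<zero>\<^bsub>N\<^esub>" using x ker[OF J_carrier[OF aJ]] aJ by (simp add: restrict_scalars_simps)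
    then show "a \<in> carrier R \<and> a \<odot>\<^bsub>res N\<^esub> x \<in> H" using J_carrier[OF aJ] N.submoduleD(2)[OF HB] by simp
  qed
  moreover have "bd (res N) 0 g y \<in> H" for y
  proof -
    have "f (u y) \<in> H" unfolding H_def by (rule imageI) (use u in \<open>simp add: fs_mod_simps\<close>)
    then show ?thesis using fun_cong[OF g(2), of y] by simp
  qed
  ultimately obtain h where h: "h \<in> chains (res N) (Suc (Suc 0))"
    "\<And>x. g x \<ominus>\<^bsub>res N\<^esub> bd (res N) (Suc 0) h x \<in> H"
    by (rule rel_exactE[OF _ g(1) chain_carrier[OF g(1)]]) blast
  note bh = bd_chain[OF rN h(1)]
  have "g x \<ominus>\<^bsub>res N\<^esub> bd (res N) (Suc 0) h x \<in> f ` carrier (res N')" for x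
    using h(2)[of x] by (simp add: H_def restrict_scalars_simps)
  then obtain v where v: "v \<in> chains (res N') (Suc 0)"
    "\<And>x. f (v x) = g x \<ominus>\<^bsub>res N\<^esub> bd (res N) (Suc 0) h x"
    by (rule fs_mod_lift[OF rN' rN rf module.carrier_is_submodule[OF rN'] chain_diff[OF rN g(1) bh]]) blast
  have "f (bd (res N') 0 v y) = f (u y)" for y
  proof -
    have "f (bd (res N') 0 v y) = bd (res N) 0 (\<lambda>x. g x \<ominus>\<^bsub>res N\<^esub> bd (res N) (Suc 0) h x) y"
      using fun_cong[OF bd_natural[OF rN' rN rf v(1)], of y] by (simp add: v(2))
    also have "\<dots> = bd (res N) 0 g y"
      using chain_carrier[OF bd_chain[OF rN g(1)]]
      by (simp add: bd_diff[OF rN g(1) bh] bd_bd[OF rN h(1)] rN.M.diff_zero)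
    finally show ?thesis using fun_cong[OF g(2), of y] by simp
  qed
  moreover have "bd (res N') 0 v y \<in> carrier N'" for y
    using chain_carrier[OF bd_chain[OF rN' v(1)]] by (simp add: restrict_scalars_simps)
  moreover have "u y \<in> carrier N'" for y using u by (simp add: fs_mod_simps)
  ultimately have "u = bd (res N') 0 v" using inj_onD[OF inj] by (intro ext) metis
  moreover have "v \<in> chB N' (Suc 0)" using v(1) unfolding fs_mod_restrict[OF R B \<phi>] .
  ultimately show "u \<in> bd (res N') 0 ` chB N' (Suc 0)" by (rule image_eqI)
qed

lemma adically_flat_imp_Tor_zero:
  fixes \<iota> :: "'a \<Rightarrow> 'n"
  assumes flat: "adically_flat TYPE('n) R I M" and pow: "ideal_pow R I n \<subseteq> J" and \<iota>: "inj_on \<iota> (carrier R)"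
  shows "zero_mod (Tor R (Suc j) BM M)"
proof -
  have "rel_exact RR (carrier RR) J j"
  proof (rule adically_flat_rel_exact[OF flat M module_RR _ ideal_submodule_ring[OF R J]])
    show "inj_on \<iota> (carrier RR)" using \<iota> by (simp add: ring_as_mod_simps)
    show "a \<in> carrier R \<and> a \<odot>\<^bsub>RR\<^esub> x \<in> J" if "a \<in> ideal_pow R I n" "x \<in> carrier RR" for a x
      using that pow J_carrier ideal.I_r_closed[OF J] by (auto simp: ring_as_mod_simps)
  qed
  then show ?thesis by (simp add: Tor_iff_rel_exact ring_as_mod_simps)
qed

text \<open>The class of a boundary with values in \<open>I\<close> maps to zero in \<open>B \<otimes> M\<close>, so flatness, applied to the image \<open>K\<close> of \<open>I\<close>
  in \<open>B\<close>, makes it modulo \<open>J\<close> the boundary of a family with values in \<open>I\<close>. The difference is a cycle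
  modulo \<open>J\<close> and is settled by \<open>Tor\<^sub>1 (B) = 0\<close>.\<close>

lemma flat_imp_rel_exact_ideal:
  fixes \<iota> :: "'a \<Rightarrow> 'n"
  assumes flat: "flat_mod TYPE('n) B (base_change R B \<phi> M)" and tor: "zero_mod (Tor R (Suc 0) BM M)"
    and \<iota>: "inj_on \<iota> (carrier R)" and I: "ideal I R" "J \<subseteq> I"
  shows "rel_exact RR (carrier R) I 0"
proof -
  let ?BB = "ring_as_mod B (\<lambda>b. b)"
  have BB: "module B ?BB" by (rule module_ring_as_mod[OF B])
  \<comment> \<open>Representatives embed \<open>B\<close> in \<open>'n\<close>; \<open>Q\<close> is the resulting copy of \<open>B\<close>.\<close>
  define \<sigma> where "\<sigma> b = (SOME a. a \<in> carrier R \<and> \<phi> a = b)" for b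
  have \<sigma>: "\<sigma> b \<in> carrier R" "\<phi> (\<sigma> b) = b" if "b \<in> carrier B" for b
  proof -
    from that have "b \<in> \<phi> ` carrier R" by (simp only: surj)
    then obtain a where "b = \<phi> a" "a \<in> carrier R" by (elim imageE)
    then have "a \<in> carrier R \<and> \<phi> a = b" by simp
    then have "\<sigma> b \<in> carrier R \<and> \<phi> (\<sigma> b) = b" unfolding \<sigma>_def by (rule someI)
    then show "\<sigma> b \<in> carrier R" "\<phi> (\<sigma> b) = b" by blast+
  qed
  have \<kappa>: "inj_on (\<lambda>b. \<iota> (\<sigma> b)) (carrier ?BB)"
  proof (rule inj_onI)
    fix b c assume "b \<in> carrier ?BB" "c \<in> carrier ?BB"
    then have b: "b \<in> carrier B" and c: "c \<in> carrier B" by (simp_all add: ring_as_mod_simps)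
    assume eq: "\<iota> (\<sigma> b) = \<iota> (\<sigma> c)"
    have "\<sigma> b = \<sigma> c" by (rule inj_onD[OF \<iota> eq \<sigma>(1)[OF b] \<sigma>(1)[OF c]])
    then have "\<phi> (\<sigma> b) = \<phi> (\<sigma> c)" by (rule arg_cong)
    then show "b = c" unfolding \<sigma>(2)[OF b] \<sigma>(2)[OF c] .
  qed
  have zero: "submodule {\<zero>\<^bsub>B\<^esub>} B ?BB"
    by (rule ideal_submodule_ring[OF B ring.zeroideal[OF cring.axioms(1)[OF B]]])
  obtain Q :: "('b, 'n) module" and s where Q: "module B Q" and s: "s \<in> mod_hom B ?BB Q"
    and s_surj: "s ` carrier ?BB = carrier Q" and s_ker: "{x \<in> carrier ?BB. s x = \<zero>\<^bsub>Q\<^esub>} = {\<zero>\<^bsub>B\<^esub>}"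
    by (rule quotient_copy[OF BB zero \<kappa>])
  note rQ = module_res[OF Q]
  define p where "p = (\<lambda>a. s (\<phi> a))"
  have p: "p \<in> mod_hom R RR (res Q)"
    using mod_hom_compose[OF hom_ring_as_mod[OF R B \<phi>]
        mod_hom_restrict[OF R B \<phi> s, unfolded restrict_scalars_ring[OF R B \<phi>]]] by (simp add: p_def)
  have p_ker: "p a = \<zero>\<^bsub>res Q\<^esub> \<longleftrightarrow> a \<in> J" if a: "a \<in> carrier R" for a
  proof -
    have "s b = \<zero>\<^bsub>Q\<^esub> \<longleftrightarrow> b = \<zero>\<^bsub>B\<^esub>" if "b \<in> carrier B" for b
      using that s_ker[unfolded set_eq_iff, rule_format, of b] by (simp add: ring_as_mod_simps)
    then show ?thesis using ring_hom_closed[OF \<phi> a] ker[OF a] by (simp add: p_def restrict_scalars_simps)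
  qed
  note sI = ideal_submodule_ring[OF R I(1)]
  define K where "K = p ` I"
  have "submodule K R (res Q)" unfolding K_def by (rule mod_hom_image_submodule[OF module_RR rQ p sI])
  note K = submodule_unrestrict[OF R B \<phi> Q this surj]
  note K' = module.submoduleD(1)[OF Q K]
  let ?N = "Q\<lparr>carrier := K\<rparr>"
  have N: "module B ?N" by (rule submodule.submodule_is_module[OF K Q])
  note rN = module_res[OF N]
  have inc: "(\<lambda>x. x) \<in> mod_hom B ?N Q" using K' by (intro mod_homI) auto
  have test: "u \<in> bd (res ?N) 0 ` chB ?N (Suc 0)"
    if u: "u \<in> chB ?N 0" "u \<in> bd (res Q) 0 ` chB Q (Suc 0)" for u
  proof -
    have "inj_on (\<lambda>x. x) (carrier ?N)" by simp
    with flat[unfolded flat_base_change_iff, rule_format, of ?N Q "\<lambda>x. x" u] N Q inc u show ?thesis by simp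
  qed
  show ?thesis
  proof (rule rel_exactI)
    interpret RR: module R RR by (rule module_RR)
    interpret rQ: module R "res Q" by (rule rQ)
    fix g assume g: "g \<in> chains RR (Suc 0)" "\<And>x. g x \<in> carrier R" "\<And>y. bd RR 0 g y \<in> I"
    define u where "u y = p (bd RR 0 g y)" for y
    have ubd: "u = bd (res Q) 0 (\<lambda>x. p (g x))" unfolding u_def by (rule bd_natural[OF module_RR rQ p g(1), symmetric])
    have pg: "(\<lambda>x. p (g x)) \<in> chB Q (Suc 0)"
      using mod_hom_closed[OF fs_map_hom[OF module_RR rQ p] g(1)] unfolding fs_mod_restrict[OF R B \<phi>] .
    have "u \<in> chB Q 0" using bd_chain[OF rQ, of "\<lambda>x. p (g x)"] pg
      by (simp add: ubd fs_mod_restrict[OF R B \<phi>])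
    moreover have "u y \<in> K" for y unfolding u_def K_def by (rule imageI) (rule g(3))
    ultimately have "u \<in> chB ?N 0" using K' by (subst fs_mod_sub) auto
    moreover have "u \<in> bd (res Q) 0 ` chB Q (Suc 0)" using ubd pg by (rule image_eqI)
    ultimately have "u \<in> bd (res ?N) 0 ` chB ?N (Suc 0)" by (rule test)
    then obtain v where v: "v \<in> chB ?N (Suc 0)" "u = bd (res ?N) 0 v" by (elim imageE)
    have vK: "v x \<in> K" for x using v(1) by (simp add: fs_mod_simps)
    have vQ: "v \<in> chains (res Q) (Suc 0)" using v(1) K' unfolding fs_mod_restrict[OF R B \<phi>] by (auto simp: fs_mod_simps)
    have vr: "v \<in> chains (res ?N) (Suc 0)" using v(1) unfolding fs_mod_restrict[OF R B \<phi>] .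
    have bv: "u = bd (res Q) 0 v" unfolding v(2)
      using bd_natural[OF rN rQ mod_hom_restrict[OF R B \<phi> inc] vr] by simp
    obtain h where h: "h \<in> chains RR (Suc 0)" "\<And>x. h x \<in> I" "\<And>x. p (h x) = v x"
      by (rule fs_mod_lift[OF module_RR rQ p sI vQ]) (use vK in \<open>auto simp: K_def\<close>)
    have gh: "(\<lambda>x. g x \<ominus>\<^bsub>RR\<^esub> h x) \<in> chains RR (Suc 0)" by (rule chain_diff[OF module_RR g(1) h(1)])
    have ghJ: "bd RR 0 (\<lambda>x. g x \<ominus>\<^bsub>RR\<^esub> h x) y \<in> J" for y
    proof -
      note c = chain_carrier[OF bd_chain[OF module_RR g(1)], of y] chain_carrier[OF bd_chain[OF module_RR h(1)], of y]
      have "p (bd RR 0 h y) = u y"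
        using fun_cong[OF bd_natural[OF module_RR rQ p h(1)], of y] by (simp add: h(3) bv)
      then have "p (bd RR 0 g y \<ominus>\<^bsub>RR\<^esub> bd RR 0 h y) = \<zero>\<^bsub>res Q\<^esub>"
        using mod_hom_diff[OF module_RR rQ p c] mod_hom_closed[OF p c(1)]
        by (simp add: u_def[symmetric] rQ.M.diff_eq_zero_iff)
      then show ?thesis using p_ker RR.M.minus_closed[OF c] by (simp add: bd_diff[OF module_RR g(1) h(1)] ring_as_mod_simps)
    qed
    have ex: "rel_exact RR (carrier R) J 0" using tor by (simp add: Tor_iff_rel_exact)
    have ghR: "g x \<ominus>\<^bsub>RR\<^esub> h x \<in> carrier R" for x using chain_carrier[OF gh] by (simp add: ring_as_mod_simps)
    obtain k where k: "k \<in> chains RR (Suc (Suc 0))" "\<And>x. k x \<in> carrier R"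
      "\<And>x. (g x \<ominus>\<^bsub>RR\<^esub> h x) \<ominus>\<^bsub>RR\<^esub> bd RR (Suc 0) k x \<in> J"
      by (rule rel_exactE[OF ex gh ghR ghJ]) blast
    have "g x \<ominus>\<^bsub>RR\<^esub> bd RR (Suc 0) k x \<in> I" for x
    proof -
      have "((g x \<ominus>\<^bsub>RR\<^esub> h x) \<ominus>\<^bsub>RR\<^esub> bd RR (Suc 0) k x) \<oplus>\<^bsub>RR\<^esub> h x \<in> I"
        by (rule RR.submoduleD(3)[OF sI subsetD[OF I(2) k(3)] h(2)])
      moreover have "((g x \<ominus>\<^bsub>RR\<^esub> h x) \<ominus>\<^bsub>RR\<^esub> bd RR (Suc 0) k x) \<oplus>\<^bsub>RR\<^esub> h x = g x \<ominus>\<^bsub>RR\<^esub> bd RR (Suc 0) k x"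
        by (rule RR.M.diff_swap)
          (use chain_carrier[OF g(1)] chain_carrier[OF h(1)] chain_carrier[OF bd_chain[OF module_RR k(1)]] in auto)
      ultimately show ?thesis by simp
    qed
    then show "\<exists>h\<in>chains RR (Suc (Suc 0)). (\<forall>x. h x \<in> carrier R) \<and> (\<forall>x. g x \<ominus>\<^bsub>RR\<^esub> bd RR (Suc 0) h x \<in> I)"
      using k(2) by (intro bexI[OF _ k(1)] conjI allI)
  qed
qed

end

lemma adic_ring_surjection:
  assumes A: "cring A" and I: "ideal I A" and M: "module A M"
  shows "ring_surjection A (adic_ring A I k) (adic_proj A I k) M (ideal_pow A I (Suc k))"
proof -
  let ?J = "ideal_pow A I (Suc k)"
  have J: "ideal ?J A" by (rule ideal_ideal_pow[OF A I])
  interpret J: ideal ?J A by (rule J)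
  have proj: "adic_proj A I k = (+>\<^bsub>A\<^esub>) ?J" by (simp add: adic_proj_def fun_eq_iff)
  show ?thesis
  proof (rule ring_surjection.intro)
    show "cring (adic_ring A I k)" using J.quotient_is_cring[OF A] by (simp add: adic_ring_def)
    show "adic_proj A I k \<in> ring_hom A (adic_ring A I k)"
      unfolding proj using J.rcos_ring_hom by (simp add: adic_ring_def)
    show "adic_proj A I k ` carrier A = carrier (adic_ring A I k)"
      by (auto simp: adic_ring_def FactRing_def A_RCOSETS_def' adic_proj_def)
    show "adic_proj A I k a = \<zero>\<^bsub>adic_ring A I k\<^esub> \<longleftrightarrow> a \<in> ?J" if a: "a \<in> carrier A" for a
    proof
      assume "adic_proj A I k a = \<zero>\<^bsub>adic_ring A I k\<^esub>"
      then show "a \<in> ?J" using J.a_rcos_self[OF a] by (simp add: adic_ring_def FactRing_def adic_proj_def)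
    next
      assume "a \<in> ?J"
      then show "adic_proj A I k a = \<zero>\<^bsub>adic_ring A I k\<^esub>"
        using J.a_rcos_const by (simp add: adic_ring_def FactRing_def adic_proj_def)
    qed
  qed (rule A, rule M, rule J)
qed

theorem theorem0p3:
  fixes A :: "('a, 'r) ring_scheme" and \<aa> :: "'a set" and M :: "('a, 'm, 'p) module_scheme"
  assumes "cring A" and "ideal \<aa> A" and "module A M"
    and universe: "carrier A \<lesssim> (UNIV :: 'n set)"
  shows
    "(adically_flat TYPE('n) A \<aa> M \<longleftrightarrow>
        (\<forall>k. (\<forall>i>0. zero_mod (Tor A i (adic_mod A \<aa> k) M)) \<and>
             flat_mod TYPE('n) (adic_ring A \<aa> k) (adic_base_change A \<aa> k M))) \<and>
     (adically_flat TYPE('n) A \<aa> M \<longleftrightarrow>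
        (\<forall>i>0. zero_mod (Tor A i (adic_mod A \<aa> 0) M)) \<and>
        flat_mod TYPE('n) (adic_ring A \<aa> 0) (adic_base_change A \<aa> 0 M))"
    (is "(?i \<longleftrightarrow> (\<forall>k. ?Tor k \<and> ?flat k)) \<and> (?i \<longleftrightarrow> ?Tor 0 \<and> ?flat 0)")
proof -
  note surj = adic_ring_surjection[OF assms(1-3)]
  obtain \<iota> :: "'a \<Rightarrow> 'n" where \<iota>: "inj_on \<iota> (carrier A)" using universe by (auto simp: lepoll_def)
  have "?Tor k \<and> ?flat k" if flat: ?i for k
  proof -
    interpret ring_surjection A "adic_ring A \<aa> k" "adic_proj A \<aa> k" M "ideal_pow A \<aa> (Suc k)" by (rule surj)
    have "zero_mod (Tor A i (adic_mod A \<aa> k) M)" if "i > 0" for i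
      using adically_flat_imp_Tor_zero[OF flat order_refl \<iota>, of "i - 1"] that by (simp add: adic_mod_def)
    then show ?thesis
      using adically_flat_imp_flat[OF flat order_refl] by (simp add: adic_base_change_def)
  qed
  moreover have ?i if "?Tor 0" "?flat 0"
    unfolding adically_flat_def
  proof (intro allI impI, elim conjE)
    fix N :: "('a, 'n) module" and i :: nat
    assume N: "module A N" and tors: "adic_torsion A \<aa> N" and i: "i > 0"
    interpret ring_surjection A "adic_ring A \<aa> 0" "adic_proj A \<aa> 0" M \<aa>
      using surj[of 0] unfolding ideal_pow_1[OF assms(1,2)] .
    have T: "zero_mod (Tor A (Suc j) BM M)" for j using that(1) by (simp add: adic_mod_def)
    have "rel_exact N (carrier N) {\<zero>\<^bsub>N\<^esub>} (i - 1)"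
    proof (rule rel_exact_torsion[OF assms(2) _ _ N tors])
      show "rel_exact RR (carrier A) \<aa> j" for j using T by (simp add: Tor_iff_rel_exact)
      show "rel_exact RR (carrier A) I 0" if "ideal I A" "\<aa> \<subseteq> I" for I
        by (rule flat_imp_rel_exact_ideal[OF _ T \<iota> that]) (use \<open>?flat 0\<close> in \<open>simp add: adic_base_change_def\<close>)
    qed
    then have "zero_mod (Tor A (Suc (i - 1)) N M)" by (simp add: Tor_zero_iff_rel_exact[OF assms(3) N])
    then show "zero_mod (Tor A i N M)" using i by simp
  qed
  ultimately show ?thesis by blast
qed

end
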